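(* Let $b_0$ and $s_0$ satisfy the standing assumptions listed in the context, and let $\Pi_n(\,\cdot\mid\mathcal X_n)$ be the posterior obtained from a histogram-type prior $\Pi_n$ and the driftless Gaussian pseudo-likelihood. For $\varepsilon>0$ let $U_{s_0,\varepsilon}=\{s\in\mathcal S_n:\|s-s_0\|_2<\varepsilon\}$, where $\mathcal S_n$ is the space of functions on which $\Pi_n$ is defined, and let $U_{s_0,\varepsilon}^c$ be its complement in $\mathcal S_n$. Assume that for some sequence of positive numbers $\varepsilon_n\to0$, $$\mathbb E_{0,s_0}\big[\Pi_n(U_{s_0,\varepsilon_n}^c\mid\mathcal X_n)\big]\to0\qquad\text{as }n\to\infty.$$ Then also $$\mathbb E_{b_0,s_0}\big[\Pi_n(U_{s_0,\varepsilon_n}^c\mid\mathcal X_n)\big]\to0\qquad\text{as }n\to\infty.$$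
   Context: Model and standing assumptions. $X$ is the strong solution of $dX_t=b_0(t,X_t)\,dt+s_0(t)\,dW_t$, $X_0=0$, $t\in[0,1]$, with $W$ a standard Brownian motion. The drift $b_0:[0,1]\times\mathbb R\to\mathbb R$ is (measurable and) such that for some $K>0$: $|b_0(t,x)|^2\le K(1+|x|^2)$ and $|b_0(t,x)-b_0(t,y)|\le K|x-y|$ for all $t\in[0,1]$, $x,y\in\mathbb R$. The deterministic dispersion coefficient $s_0:[0,1]\to(0,\infty)$ satisfies $|s_0(u)-s_0(v)|\le L|u-v|^\lambda$ for all $u,v\in[0,1]$, with $L>0$, $\lambda\in(0,1]$, and is bounded away from zero (and, by continuity, from infinity). $\mathbb P_{b_0,s_0}$ denotes the law of the path of $X$ and $\mathbb E_{b_0,s_0}$ the expectation under it; $\mathbb P_{0,s_0}$, $\mathbb E_{0,s_0}$ are the corresponding objects when the drift is identically zero. The data are $\mathcal X_n=\{X_{t_{0,n}},\dots,X_{t_{n,n}}\}$ with $t_{i,n}=i/n$; put $Y_{i,n}=X_{t_{i,n}}-X_{t_{i-1,n}}$. Bins and prior. Given an integer $m=m_n<n$, write $n=mN+r$ with $0\le r<m$, $N=N_n=\lfloor n/m\rfloor$. The bins are $B_k=[t_{m(k-1),n},t_{mk,n})$ for $k=1,\dots,N-1$ and $B_N=[t_{m(N-1),n},1]$. A histogram-type prior $\Pi_n$ is the law of $s=\sum_{k=1}^{N_n}\xi_k\mathbf 1_{B_k}$ for random coefficients $\xi_k>0$; $\mathcal S_n$ is the corresponding space of positive functions that are piecewise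 constant on the bins. Posterior. The pseudo-likelihood (acting as if the drift were zero) is $$L_n(s)=\prod_{i=1}^n\frac{1}{\sqrt{2\pi\int_{t_{i-1,n}}^{t_{i,n}}s^2(u)\,du}}\exp\Big(-\frac{Y_{i,n}^2}{2\int_{t_{i-1,n}}^{t_{i,n}}s^2(u)\,du}\Big),$$ and $\Pi_n(S\mid\mathcal X_n)=\int_S L_n(s)\,\Pi_n(ds)\big/\int L_n(s)\,\Pi_n(ds)$ (assumed well defined). $\|\cdot\|_2$ is the $L_2$-norm on $[0,1]$ with respect to Lebesgue measure. *)

theory Defs
  imports "HOL-Probability.Probability"
begin

section \<open>Brownian motion and the stochastic differential equation\<close>

text \<open>The time horizon is \<open>[0,1]\<close>; the processes below are only ever
  evaluated at times in this interval.\<close>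

definition brownian_motion :: "'a measure \<Rightarrow> (real \<Rightarrow> 'a \<Rightarrow> real) \<Rightarrow> bool" where
  "brownian_motion M W \<longleftrightarrow>
     prob_space M \<and>
     (\<forall>t\<in>{0..1}. W t \<in> borel_measurable M) \<and>
     (AE \<omega> in M. W 0 \<omega> = 0) \<and>
     (AE \<omega> in M. continuous_on {0..1} (\<lambda>t. W t \<omega>)) \<and>
     (\<forall>s\<in>{0..1}. \<forall>t\<in>{0..1}. s < t \<longrightarrow>
        distributed M lborel (\<lambda>\<omega>. W t \<omega> - W s \<omega>) (normal_density 0 (sqrt (t - s)))) \<and>
     (\<forall>p :: nat \<Rightarrow> real. \<forall>k. mono p \<and> range p \<subseteq> {0..1} \<longrightarrow>
        prob_space.indep_vars M (\<lambda>_. borel) (\<lambda>i \<omega>. W (p (Suc i)) \<omega> - W (p i) \<omega>) {..<k})"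

definition augmented_filtration :: "'a measure \<Rightarrow> (real \<Rightarrow> 'a \<Rightarrow> real) \<Rightarrow> real \<Rightarrow> 'a measure" where
  "augmented_filtration M W t =
     sigma (space M)
       ({W u -` A \<inter> space M | u A. u \<in> {0..t} \<and> A \<in> sets borel} \<union> null_sets M)"

text \<open>A deterministic step function with nodes \<open>p 0 \<le> \<dots> \<le> p k\<close> and values
  \<open>c 0, \<dots>, c (k - 1)\<close>, and its integral against \<open>W\<close>.\<close>

definition step_fun :: "nat \<Rightarrow> (nat \<Rightarrow> real) \<Rightarrow> (nat \<Rightarrow> real) \<Rightarrow> real \<Rightarrow> real" where
  "step_fun k p c u = (\<Sum>i<k. c i * indicator {p i<..p (Suc i)} u)"

definition step_integral ::
    "(real \<Rightarrow> 'a \<Rightarrow> real) \<Rightarrow> nat \<Rightarrow> (nat \<Rightarrow> real) \<Rightarrow> (nat \<Rightarrow> real) \<Rightarrow> 'a \<Rightarrow> real" where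
  "step_integral W k p c \<omega> = (\<Sum>i<k. c i * (W (p (Suc i)) \<omega> - W (p i) \<omega>))"

text \<open>\<open>Z\<close> is a version of the stochastic integral of the deterministic integrand
  \<open>f\<close> over \<open>[0,t]\<close> against \<open>W\<close>: the mean-square limit of integrals of step
  functions that converge to \<open>f\<close> in \<open>L\<^sub>2([0,t])\<close>. By the Ito isometry the
  limit does not depend, up to null sets, on the approximating sequence, so that
  asking for one sequence is enough.\<close>

definition is_wiener_integral ::
    "'a measure \<Rightarrow> (real \<Rightarrow> 'a \<Rightarrow> real) \<Rightarrow> (real \<Rightarrow> real) \<Rightarrow> real \<Rightarrow> ('a \<Rightarrow> real) \<Rightarrow> bool" where
  "is_wiener_integral M W f t Z \<longleftrightarrow>
     Z \<in> borel_measurable M \<and>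
     (\<exists>(k :: nat \<Rightarrow> nat) (p :: nat \<Rightarrow> nat \<Rightarrow> real) (c :: nat \<Rightarrow> nat \<Rightarrow> real).
        (\<forall>j. mono (p j) \<and> range (p j) \<subseteq> {0..t}) \<and>
        (\<lambda>j. \<integral>\<^sup>+u\<in>{0..t}. ennreal ((f u - step_fun (k j) (p j) (c j) u)\<^sup>2) \<partial>lborel)
          \<longlonglongrightarrow> 0 \<and>
        (\<lambda>j. \<integral>\<^sup>+\<omega>. ennreal ((Z \<omega> - step_integral W (k j) (p j) (c j) \<omega>)\<^sup>2) \<partial>M)
          \<longlonglongrightarrow> 0)"

text \<open>\<open>X\<close> is a strong solution of \<open>dX\<^sub>t = b(t, X\<^sub>t) dt + s(t) dW\<^sub>t\<close>,
  \<open>X\<^sub>0 = 0\<close>, on \<open>[0,1]\<close>, driven by the Brownian motion \<open>W\<close>.\<close>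

definition strong_solution ::
    "'a measure \<Rightarrow> (real \<Rightarrow> 'a \<Rightarrow> real) \<Rightarrow> (real \<Rightarrow> real \<Rightarrow> real) \<Rightarrow> (real \<Rightarrow> real) \<Rightarrow>
       (real \<Rightarrow> 'a \<Rightarrow> real) \<Rightarrow> bool" where
  "strong_solution M W b s X \<longleftrightarrow>
     (\<forall>t\<in>{0..1}. X t \<in> borel_measurable (augmented_filtration M W t)) \<and>
     (AE \<omega> in M. X 0 \<omega> = 0) \<and>
     (AE \<omega> in M. continuous_on {0..1} (\<lambda>t. X t \<omega>)) \<and>
     (AE \<omega> in M. set_integrable lborel {0..1} (\<lambda>u. b u (X u \<omega>))) \<and>
     (\<exists>I. (\<forall>t\<in>{0..1}. is_wiener_integral M W s t (I t)) \<and>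
          (AE \<omega> in M. \<forall>t\<in>{0..1}. X t \<omega> = (LINT u:{0..t}|lborel. b u (X u \<omega>)) + I t \<omega>))"

text \<open>The law of the path of \<open>X\<close>, on real functions on \<open>[0,1]\<close> with the
  \<open>\<sigma>\<close>-algebra generated by the coordinates.\<close>

definition path_law :: "'a measure \<Rightarrow> (real \<Rightarrow> 'a \<Rightarrow> real) \<Rightarrow> (real \<Rightarrow> real) measure" where
  "path_law M X = distr M (PiM {0..1} (\<lambda>_. borel)) (\<lambda>\<omega>. \<lambda>t\<in>{0..1}. X t \<omega>)"

definition drift_conditions :: "(real \<Rightarrow> real \<Rightarrow> real) \<Rightarrow> bool" where
  "drift_conditions b \<longleftrightarrow>
     (\<lambda>(t, x). b t x) \<in> borel_measurable (restrict_space borel {0..1} \<Otimes>\<^sub>M borel) \<and>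
     (\<exists>K>0. (\<forall>t\<in>{0..1}. \<forall>x. \<bar>b t x\<bar>\<^sup>2 \<le> K * (1 + x\<^sup>2)) \<and>
            (\<forall>t\<in>{0..1}. \<forall>x y. \<bar>b t x - b t y\<bar> \<le> K * \<bar>x - y\<bar>))"

definition dispersion_conditions :: "(real \<Rightarrow> real) \<Rightarrow> bool" where
  "dispersion_conditions s \<longleftrightarrow>
     (\<forall>u\<in>{0..1}. s u > 0) \<and>
     (\<exists>L>0. \<exists>\<alpha>\<in>{0<..1}. \<forall>u\<in>{0..1}. \<forall>v\<in>{0..1}. \<bar>s u - s v\<bar> \<le> L * \<bar>u - v\<bar> powr \<alpha>) \<and>
     (\<exists>\<kappa>>0. \<forall>u\<in>{0..1}. \<kappa> \<le> s u)"


section \<open>Histogram-type priors\<close>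

definition grid :: "nat \<Rightarrow> nat \<Rightarrow> real" where
  "grid n i = real i / real n"

definition bin :: "nat \<Rightarrow> nat \<Rightarrow> nat \<Rightarrow> real set" where
  "bin n m k =
     (if k < n div m then {grid n (m * (k - 1))..<grid n (m * k)}
      else {grid n (m * (k - 1))..1})"

definition histogram :: "nat \<Rightarrow> nat \<Rightarrow> (nat \<Rightarrow> real) \<Rightarrow> real \<Rightarrow> real" where
  "histogram n m a = (\<lambda>t\<in>{0..1}. \<Sum>k=1..n div m. a k * indicator (bin n m k) t)"

definition hist_funs :: "nat \<Rightarrow> nat \<Rightarrow> (real \<Rightarrow> real) set" where
  "hist_funs n m = {histogram n m a | a. \<forall>k\<in>{1..n div m}. a k > 0}"

text \<open>Since \<open>hist_funs n m\<close> is parametrised by finitely many coefficients, each of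
  which is a point evaluation, the trace of the coordinate \<open>\<sigma>\<close>-algebra used here
  is its Borel \<open>\<sigma>\<close>-algebra.\<close>

definition hist_space :: "nat \<Rightarrow> nat \<Rightarrow> (real \<Rightarrow> real) measure" where
  "hist_space n m = restrict_space (PiM {0..1} (\<lambda>_. borel)) (hist_funs n m)"

definition random_coefficients :: "nat \<Rightarrow> 'c measure \<Rightarrow> (nat \<Rightarrow> 'c \<Rightarrow> real) \<Rightarrow> bool" where
  "random_coefficients N Q \<xi> \<longleftrightarrow>
     prob_space Q \<and>
     (\<forall>k\<in>{1..N}. \<xi> k \<in> borel_measurable Q \<and> (\<forall>\<omega>\<in>space Q. \<xi> k \<omega> > 0))"

definition hist_prior ::
    "nat \<Rightarrow> nat \<Rightarrow> 'c measure \<Rightarrow> (nat \<Rightarrow> 'c \<Rightarrow> real) \<Rightarrow> (real \<Rightarrow> real) measure" where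
  "hist_prior n m Q \<xi> = distr Q (hist_space n m) (\<lambda>\<omega>. histogram n m (\<lambda>k. \<xi> k \<omega>))"


section \<open>Pseudo-likelihood and posterior\<close>

definition observations :: "nat \<Rightarrow> (real \<Rightarrow> real) \<Rightarrow> nat \<Rightarrow> real" where
  "observations n x = (\<lambda>i\<in>{0..n}. x (grid n i))"

definition pseudo_likelihood :: "nat \<Rightarrow> (nat \<Rightarrow> real) \<Rightarrow> (real \<Rightarrow> real) \<Rightarrow> real" where
  "pseudo_likelihood n d s =
     (\<Prod>i=1..n.
        1 / sqrt (2 * pi * (LINT u:{grid n (i - 1)..grid n i}|lborel. (s u)\<^sup>2)) *
        exp (- (d i - d (i - 1))\<^sup>2 / (2 * (LINT u:{grid n (i - 1)..grid n i}|lborel. (s u)\<^sup>2))))"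

definition posterior_well_defined ::
    "nat \<Rightarrow> (real \<Rightarrow> real) measure \<Rightarrow> (nat \<Rightarrow> real) \<Rightarrow> bool" where
  "posterior_well_defined n prior d \<longleftrightarrow>
     0 < (\<integral>\<^sup>+s. ennreal (pseudo_likelihood n d s) \<partial>prior) \<and>
     (\<integral>\<^sup>+s. ennreal (pseudo_likelihood n d s) \<partial>prior) < \<infinity>"

definition posterior ::
    "nat \<Rightarrow> (real \<Rightarrow> real) measure \<Rightarrow> (nat \<Rightarrow> real) \<Rightarrow> (real \<Rightarrow> real) set \<Rightarrow> real" where
  "posterior n prior d S =
     enn2real ((\<integral>\<^sup>+s\<in>S. ennreal (pseudo_likelihood n d s) \<partial>prior) /
               (\<integral>\<^sup>+s. ennreal (pseudo_likelihood n d s) \<partial>prior))"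

definition L2_dist :: "(real \<Rightarrow> real) \<Rightarrow> (real \<Rightarrow> real) \<Rightarrow> real" where
  "L2_dist f g = sqrt (LINT u:{0..1}|lborel. (f u - g u)\<^sup>2)"

definition L2_nbhd :: "nat \<Rightarrow> nat \<Rightarrow> (real \<Rightarrow> real) \<Rightarrow> real \<Rightarrow> (real \<Rightarrow> real) set" where
  "L2_nbhd n m s0 \<epsilon> = {s \<in> hist_funs n m. L2_dist s s0 < \<epsilon>}"

end

theory Submission
  imports Defs
begin

text \<open>
The posterior mass of a set is a \<open>[0,1]\<close>-valued function of the observed vector
\<open>(X\<^sub>0, X\<^sub>1\<^sub>/\<^sub>n, \<dots>, X\<^sub>1)\<close>. Hence the conclusion follows from a uniform form of contiguity
(\<open>sampled_laws_uniformly_contiguous\<close>, \<open>contiguity_transfer\<close>): for every \<open>e > 0\<close> there is an \<open>a\<close>,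
the same for all \<open>n\<close>, such that the law of the observations with drift is at most \<open>a\<close> times the law
without drift, plus \<open>e\<close>, on every Borel set. Indeed, if the mean of a \<open>[0,1]\<close>-valued function
tends to zero under the second law, Markov's inequality makes the sets where it is large
improbable under the second law, and contiguity makes them improbable under the first.

Contiguity is a consequence of Girsanov's theorem. The proof uses a version in discrete time only.
The observation grid is refined to \<open>N\<close> cells. On each cell the drift contribution is replaced by
\<open>D\<^sub>j = \<integral> b(u, clip X(t\<^sub>j)) du\<close>, which is known when the cell begins and bounded by a constant divided
by \<open>N\<close>. The noise \<open>G\<^sub>j\<close> of the cell is the increment of a Wiener integral: it is independent of the
past and centred Gaussian, with variance \<open>\<sigma>\<^sub>j\<^sup>2\<close> of order \<open>1/N\<close> (\<open>wiener_increment_indep_normal\<close>).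
For such a sequence the weight \<open>Z = \<Prod> exp (- D\<^sub>j G\<^sub>j / \<sigma>\<^sub>j\<^sup>2 - D\<^sub>j\<^sup>2 / (2 \<sigma>\<^sub>j\<^sup>2))\<close> turns the law of the
steps \<open>D\<^sub>j + G\<^sub>j\<close> into that of the steps \<open>G\<^sub>j\<close> (\<open>discrete_girsanov\<close>), and the mean of \<open>1/Z\<close> is at
most the exponential of \<open>\<Sum> (sup |D\<^sub>j|)\<^sup>2 / \<sigma>\<^sub>j\<^sup>2\<close>. Each of these \<open>N\<close> summands is of order \<open>1/N\<close>, so
that the bound does not deteriorate when the grid is refined. Since \<open>1 \<le> a Z + 1 / (a Z)\<close>, this
gives the comparison of laws for the process with frozen drift (\<open>drift_cost\<close>).

As \<open>N\<close> grows, the sums of the frozen drifts converge to the integral of the drift along every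
continuous path that stays in the clipping range, because the drift is Lipschitz in space
(\<open>frozen_drift_sum_tendsto\<close>). Thus the frozen process converges at the observation times, Fatou's
lemma carries the bound to open sets (\<open>sampled_law_bound_open\<close>), and outer regularity extends it to
Borel sets. Leaving the clipping range has small probability when the range is large, since
continuous paths are bounded.

Wiener integrals of deterministic functions are mean-square limits of integrals of step functions.
Ito's isometry makes the integrals over \<open>[0,s]\<close> and \<open>[0,t]\<close> compatible; the independence and the
Gaussian law of the increments are obtained in the limit from characteristic functions.
\<close>

section \<open>Characteristic functions and convergence in mean square\<close>

text \<open>The truncation at \<open>1\<close> makes every member of the sequence integrable, which mean-square
convergence alone ensures only eventually.\<close>

lemma (in finite_measure) AE_subseq_of_L2:
  fixes u :: "nat \<Rightarrow> 'a \<Rightarrow> real"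
  assumes meas[measurable]: "\<And>j. u j \<in> borel_measurable M"
    and lim: "(\<lambda>j. \<integral>\<^sup>+x. ennreal ((u j x)\<^sup>2) \<partial>M) \<longlonglongrightarrow> 0"
  shows "\<exists>r. strict_mono r \<and> (AE x in M. (\<lambda>j. u (r j) x) \<longlonglongrightarrow> 0)"
proof -
  define v where "v j x = min 1 ((u j x)\<^sup>2)" for j x
  have [measurable]: "v j \<in> borel_measurable M" for j unfolding v_def by measurable
  have int: "integrable M (v j)" for j
    by (rule integrable_const_bound[where B=1]) (auto simp: v_def)
  have "(\<lambda>j. \<integral>\<^sup>+x. ennreal (v j x) \<partial>M) \<longlonglongrightarrow> 0"
  proof (rule tendsto_sandwich[OF _ _ tendsto_const lim])
    show "\<forall>\<^sub>F j in sequentially. (\<integral>\<^sup>+x. ennreal (v j x) \<partial>M) \<le> (\<integral>\<^sup>+x. ennreal ((u j x)\<^sup>2) \<partial>M)"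
      by (intro always_eventually allI nn_integral_mono) (auto simp: v_def ennreal_leI)
  qed simp
  moreover have "(\<integral>\<^sup>+x. ennreal (v j x) \<partial>M) = ennreal (\<integral>x. norm (v j x) \<partial>M)" for j
    using nn_integral_eq_integral[OF int, of j] by (auto simp: v_def[abs_def])
  ultimately have "(\<lambda>j. ennreal (\<integral>x. norm (v j x) \<partial>M)) \<longlonglongrightarrow> ennreal 0" by simp
  then have "(\<lambda>j. \<integral>x. norm (v j x) \<partial>M) \<longlonglongrightarrow> 0"
    by (subst (asm) tendsto_ennreal_iff) (auto intro!: Bochner_Integration.integral_nonneg)
  from tendsto_L1_AE_subseq[OF int this]
  obtain r where r: "strict_mono r" "AE x in M. (\<lambda>j. v (r j) x) \<longlonglongrightarrow> 0" by auto
  have "(\<lambda>j. u (r j) x) \<longlonglongrightarrow> 0" if *: "(\<lambda>j. v (r j) x) \<longlonglongrightarrow> 0" for x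
  proof -
    from * have "\<forall>\<^sub>F j in sequentially. v (r j) x < 1" by (rule order_tendstoD) simp
    then have "\<forall>\<^sub>F j in sequentially. v (r j) x = (u (r j) x)\<^sup>2"
      by eventually_elim (auto simp: v_def min_def split: if_splits)
    with * have "(\<lambda>j. (u (r j) x)\<^sup>2) \<longlonglongrightarrow> 0" using tendsto_cong by fastforce
    then have "(\<lambda>j. sqrt ((u (r j) x)\<^sup>2)) \<longlonglongrightarrow> sqrt 0" by (rule tendsto_real_sqrt)
    then show ?thesis by (simp add: tendsto_rabs_zero_iff)
  qed
  with r show ?thesis by fastforce
qed

lemma char_normal:
  assumes "0 < \<sigma>"
  shows "char (density lborel (normal_density 0 \<sigma>)) \<theta> = exp (- (\<theta>\<^sup>2 * \<sigma>\<^sup>2) / 2)"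
proof -
  interpret N: prob_space "density lborel (normal_density 0 \<sigma>)"
    using assms by (rule prob_space_normal_density)
  let ?N = "density lborel (normal_density 0 \<sigma>)"
  have "distributed ?N lborel (\<lambda>x. x) (normal_density 0 \<sigma>)"
    unfolding distributed_def by (auto simp: distr_id2)
  then have "distributed ?N lborel (\<lambda>x. (x - 0) / \<sigma>) std_normal_density"
    by (subst (asm) N.normal_standard_normal_convert[OF assms])
  then have D: "distr ?N lborel (\<lambda>x. x / \<sigma>) = std_normal_distribution"
    unfolding distributed_def by simp
  have "char ?N \<theta> = (\<integral>x. iexp ((\<theta> * \<sigma>) * (x / \<sigma>)) \<partial>?N)"
    using assms by (simp add: char_def)
  also have "\<dots> = char (distr ?N lborel (\<lambda>x. x / \<sigma>)) (\<theta> * \<sigma>)"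
    unfolding char_def by (subst integral_distr; (rule refl | measurable))
  also have "\<dots> = exp (- (\<theta>\<^sup>2 * \<sigma>\<^sup>2) / 2)"
    unfolding D char_std_normal_distribution by (simp add: power_mult_distrib)
  finally show ?thesis .
qed

section \<open>Brownian motion and the isometry for step functions\<close>

locale wiener = prob_space M for M :: "'a measure" +
  fixes W :: "real \<Rightarrow> 'a \<Rightarrow> real"
  assumes BM: "brownian_motion M W"
begin

lemma W_measurable [measurable]: "t \<in> {0..1} \<Longrightarrow> random_variable borel (W t)"
  using BM unfolding brownian_motion_def by auto

lemma W_zero: "AE \<omega> in M. W 0 \<omega> = 0"
  using BM unfolding brownian_motion_def by auto

lemma W_increment_distributed:
  "s \<in> {0..1} \<Longrightarrow> t \<in> {0..1} \<Longrightarrow> s < t \<Longrightarrow>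
     distributed M lborel (\<lambda>\<omega>. W t \<omega> - W s \<omega>) (normal_density 0 (sqrt (t - s)))"
  using BM unfolding brownian_motion_def by auto

lemma W_increments_indep:
  "mono p \<Longrightarrow> range p \<subseteq> {0..1} \<Longrightarrow>
     indep_vars (\<lambda>_. borel) (\<lambda>i \<omega>. W (p (Suc i)) \<omega> - W (p i) \<omega>) {..<k}" for p :: "nat \<Rightarrow> real"
  using BM unfolding brownian_motion_def by blast

lemma W_increment_square_less:
  assumes "s \<in> {0..1}" "t \<in> {0..1}" "s < t"
  shows "has_bochner_integral M (\<lambda>\<omega>. (W t \<omega> - W s \<omega>)\<^sup>2) (t - s)"
proof -
  note D = W_increment_distributed[OF assms]
  have int: "integrable lborel (\<lambda>x. normal_density 0 (sqrt (t - s)) x * (x - 0) ^ 2)"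
    using assms by (intro integrable_normal_moment) auto
  have I: "integrable M (\<lambda>\<omega>. (W t \<omega> - W s \<omega>)\<^sup>2)"
    using distributed_integrable[OF D, of "\<lambda>x. x\<^sup>2"] int by (auto simp: normal_density_nonneg)
  have "(\<integral>\<omega>. (W t \<omega> - W s \<omega>)\<^sup>2 \<partial>M) = (\<integral>x. normal_density 0 (sqrt (t - s)) x * x\<^sup>2 \<partial>lborel)"
    by (rule distributed_integral[OF D, of "\<lambda>x. x\<^sup>2", symmetric]) (auto simp: normal_density_nonneg)
  also have "\<dots> = t - s"
    using integral_normal_moment_even[of "sqrt (t - s)" 0 1] assms by (simp add: fact_numeral)
  finally show ?thesis using I by (simp add: has_bochner_integral_iff)
qed

lemma W_increment_square:
  assumes "s \<in> {0..1}" "t \<in> {0..1}"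
  shows "has_bochner_integral M (\<lambda>\<omega>. (W t \<omega> - W s \<omega>)\<^sup>2) \<bar>t - s\<bar>"
  using W_increment_square_less[of s t] W_increment_square_less[of t s] assms
  by (cases s t rule: linorder_cases) (auto simp: power2_commute has_bochner_integral_zero)

lemma W_square:
  assumes t: "t \<in> {0..1}"
  shows "has_bochner_integral M (\<lambda>\<omega>. (W t \<omega>)\<^sup>2) t"
proof -
  have "has_bochner_integral M (\<lambda>\<omega>. (W t \<omega> - W 0 \<omega>)\<^sup>2) t"
    using W_increment_square[of 0 t] t by auto
  moreover have "AE \<omega> in M. (W t \<omega> - W 0 \<omega>)\<^sup>2 = (W t \<omega>)\<^sup>2"
    using W_zero by eventually_elim simp
  ultimately show ?thesis using t
    by (subst (asm) has_bochner_integral_cong_AE) auto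
qed

text \<open>Polarisation of the variance of increments: this covariance is all that the isometry needs.\<close>

lemma W_prod:
  assumes "a \<in> {0..1}" "b \<in> {0..1}"
  shows "has_bochner_integral M (\<lambda>\<omega>. W a \<omega> * W b \<omega>) (min a b)"
proof -
  have "has_bochner_integral M
    (\<lambda>\<omega>. ((W a \<omega>)\<^sup>2 + (W b \<omega>)\<^sup>2 - (W b \<omega> - W a \<omega>)\<^sup>2) / 2) ((a + b - \<bar>b - a\<bar>) / 2)"
    by (intro has_bochner_integral_divide_zero has_bochner_integral_diff has_bochner_integral_add
      W_square W_increment_square assms)
  also have "(\<lambda>\<omega>. ((W a \<omega>)\<^sup>2 + (W b \<omega>)\<^sup>2 - (W b \<omega> - W a \<omega>)\<^sup>2) / 2) = (\<lambda>\<omega>. W a \<omega> * W b \<omega>)"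
    by (auto simp: fun_eq_iff power2_eq_square algebra_simps)
  also have "(a + b - \<bar>b - a\<bar>) / 2 = min a b" by (auto simp: min_def abs_if)
  finally show ?thesis .
qed

lemma W_increment_prod:
  assumes "p \<in> {0..1}" "q \<in> {0..1}" "a \<in> {0..1}" "b \<in> {0..1}"
  shows "has_bochner_integral M (\<lambda>\<omega>. (W q \<omega> - W p \<omega>) * (W b \<omega> - W a \<omega>))
     (min q b - min q a - min p b + min p a)"
proof -
  have "has_bochner_integral M
    (\<lambda>\<omega>. W q \<omega> * W b \<omega> - W q \<omega> * W a \<omega> - W p \<omega> * W b \<omega> + W p \<omega> * W a \<omega>)
     (min q b - min q a - min p b + min p a)"
    by (intro has_bochner_integral_diff has_bochner_integral_add W_prod assms)
  then show ?thesis by (simp add: algebra_simps)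
qed

end

text \<open>The counterpart in \<open>L\<^sub>2[0,1]\<close> of \<open>W_increment_prod\<close>: both inner products are the same
combination of minima, so that the isometry holds without refining the two partitions to a common one.\<close>

lemma indicator_prod_integral:
  fixes a b p q :: real
  assumes "0 \<le> p" "p \<le> q" "0 \<le> a" "a \<le> b"
  shows "has_bochner_integral lborel (\<lambda>u. indicator {p<..q} u * indicator {a<..b} u)
     (min q b - min q a - min p b + min p a)"
proof -
  have 1: "has_bochner_integral lborel (indicator {0<..x}) x" if "0 \<le> x" for x :: real
    using has_bochner_integral_real_indicator[of "{0<..x}" lborel] that by simp
  have 2: "(\<lambda>u. indicator {p<..q} u * indicator {a<..b} u) =
     (\<lambda>u. indicator {0<..min q b} u - indicator {0<..min q a} u - indicator {0<..min p b} u
       + (indicator {0<..min p a} u :: real))"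
    using assms by (auto simp: fun_eq_iff indicator_def)
  show ?thesis unfolding 2
    by (intro has_bochner_integral_diff has_bochner_integral_add 1) (use assms in auto)
qed

lemma step_fun_measurable [measurable]: "step_fun k p c \<in> borel_measurable borel"
  unfolding step_fun_def by measurable

context wiener
begin

lemma step_integral_measurable [measurable]:
  assumes "range p \<subseteq> {0..1}"
  shows "random_variable borel (step_integral W k p c)"
  using assms unfolding step_integral_def
  by (intro borel_measurable_sum borel_measurable_times borel_measurable_diff) (auto simp: subset_eq)

lemma ito_isometry_prod:
  assumes "mono p" "range p \<subseteq> {0..1}" "mono p'" "range p' \<subseteq> {0..1}"
  obtains v where
    "has_bochner_integral M (\<lambda>\<omega>. step_integral W k p c \<omega> * step_integral W k' p' c' \<omega>) v"
    "has_bochner_integral lborel (\<lambda>u. step_fun k p c u * step_fun k' p' c' u) v"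
proof
  let ?v = "\<lambda>i j. min (p (Suc i)) (p' (Suc j)) - min (p (Suc i)) (p' j)
    - min (p i) (p' (Suc j)) + min (p i) (p' j)"
  have r: "p i \<in> {0..1}" "p' i \<in> {0..1}" "0 \<le> p i" "0 \<le> p' i" for i
    using assms by (auto simp: subset_eq)
  have "has_bochner_integral M (\<lambda>\<omega>. \<Sum>i<k. \<Sum>j<k'. (c i * c' j) *
      ((W (p (Suc i)) \<omega> - W (p i) \<omega>) * (W (p' (Suc j)) \<omega> - W (p' j) \<omega>)))
      (\<Sum>i<k. \<Sum>j<k'. (c i * c' j) * ?v i j)"
    by (intro has_bochner_integral_sum has_bochner_integral_mult_right W_increment_prod r)
  then show "has_bochner_integral M (\<lambda>\<omega>. step_integral W k p c \<omega> * step_integral W k' p' c' \<omega>)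
      (\<Sum>i<k. \<Sum>j<k'. (c i * c' j) * ?v i j)"
    by (simp only: step_integral_def sum_product mult_ac)
  have "has_bochner_integral lborel (\<lambda>u. \<Sum>i<k. \<Sum>j<k'. (c i * c' j) *
      (indicator {p i<..p (Suc i)} u * indicator {p' j<..p' (Suc j)} u))
      (\<Sum>i<k. \<Sum>j<k'. (c i * c' j) * ?v i j)"
    by (intro has_bochner_integral_sum has_bochner_integral_mult_right indicator_prod_integral r
       monoD[OF assms(1)] monoD[OF assms(3)]) auto
  then show "has_bochner_integral lborel (\<lambda>u. step_fun k p c u * step_fun k' p' c' u)
      (\<Sum>i<k. \<Sum>j<k'. (c i * c' j) * ?v i j)"
    by (simp only: step_fun_def sum_product mult_ac)
qed

text \<open>Polarised isometry, for two step functions with unrelated nodes.\<close>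

lemma ito_isometry_diff:
  assumes "mono p" "range p \<subseteq> {0..1}" "mono p'" "range p' \<subseteq> {0..1}"
  shows "(\<integral>\<^sup>+\<omega>. ennreal ((step_integral W k p c \<omega> - step_integral W k' p' c' \<omega>)\<^sup>2) \<partial>M) =
    (\<integral>\<^sup>+u. ennreal ((step_fun k p c u - step_fun k' p' c' u)\<^sup>2) \<partial>lborel)"
proof -
  obtain v1 where 1: "has_bochner_integral M (\<lambda>\<omega>. step_integral W k p c \<omega> * step_integral W k p c \<omega>) v1"
    "has_bochner_integral lborel (\<lambda>u. step_fun k p c u * step_fun k p c u) v1"
    using ito_isometry_prod[OF assms(1,2,1,2)] .
  obtain v2 where 2: "has_bochner_integral M (\<lambda>\<omega>. step_integral W k p c \<omega> * step_integral W k' p' c' \<omega>) v2"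
    "has_bochner_integral lborel (\<lambda>u. step_fun k p c u * step_fun k' p' c' u) v2"
    using ito_isometry_prod[OF assms] .
  obtain v3 where 3: "has_bochner_integral M (\<lambda>\<omega>. step_integral W k' p' c' \<omega> * step_integral W k' p' c' \<omega>) v3"
    "has_bochner_integral lborel (\<lambda>u. step_fun k' p' c' u * step_fun k' p' c' u) v3"
    using ito_isometry_prod[OF assms(3,4,3,4)] .
  have a: "has_bochner_integral M (\<lambda>\<omega>. (step_integral W k p c \<omega> - step_integral W k' p' c' \<omega>)\<^sup>2) (v1 - 2 * v2 + v3)"
    unfolding power2_diff power2_eq_square mult.assoc
    using has_bochner_integral_add[OF has_bochner_integral_diff[OF 1(1)
       has_bochner_integral_mult_right[OF 2(1), of 2]] 3(1)]
    by (simp add: algebra_simps)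
  have b: "has_bochner_integral lborel (\<lambda>u. (step_fun k p c u - step_fun k' p' c' u)\<^sup>2) (v1 - 2 * v2 + v3)"
    unfolding power2_diff power2_eq_square mult.assoc
    using has_bochner_integral_add[OF has_bochner_integral_diff[OF 1(2)
       has_bochner_integral_mult_right[OF 2(2), of 2]] 3(2)]
    by (simp add: algebra_simps)
  show ?thesis using a b by (simp add: nn_integral_eq_integral has_bochner_integral_iff)
qed

lemma step_fun_square_integral:
  assumes "mono p" "range p \<subseteq> {0..1}"
  shows "has_bochner_integral lborel (\<lambda>u. (step_fun k p c u)\<^sup>2) (\<Sum>i<k. (c i)\<^sup>2 * (p (Suc i) - p i))"
proof -
  have r: "0 \<le> p i" "p i \<le> p (Suc i)" for i
    using assms by (auto simp: subset_eq mono_def)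
  have "has_bochner_integral lborel (\<lambda>u. \<Sum>i<k. (c i)\<^sup>2 * indicator {p i<..p (Suc i)} u)
     (\<Sum>i<k. (c i)\<^sup>2 * (p (Suc i) - p i))"
    using r(2) by (intro has_bochner_integral_sum has_bochner_integral_mult_right)
      (auto simp: has_bochner_integral_iff)
  moreover have "(step_fun k p c u)\<^sup>2 = (\<Sum>i<k. (c i)\<^sup>2 * indicator {p i<..p (Suc i)} u)" for u
  proof -
    have disj: "i = j" if "u \<in> {p i<..p (Suc i)}" "u \<in> {p j<..p (Suc j)}" for i j
    proof (rule ccontr)
      assume "i \<noteq> j"
      then consider "Suc i \<le> j" | "Suc j \<le> i" by linarith
      then show False using that monoD[OF assms(1)] by cases (force)+
    qed
    have "(step_fun k p c u)\<^sup>2 = (\<Sum>i<k. \<Sum>j<k. (c i * c j) *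
        (indicator {p i<..p (Suc i)} u * indicator {p j<..p (Suc j)} u))"
      by (simp only: step_fun_def power2_eq_square sum_product mult_ac)
    also have "\<dots> = (\<Sum>i<k. \<Sum>j<k. if i = j then (c i)\<^sup>2 * indicator {p i<..p (Suc i)} u else 0)"
      using disj by (intro sum.cong refl) (auto simp: power2_eq_square split: split_indicator)
    also have "\<dots> = (\<Sum>i<k. (c i)\<^sup>2 * indicator {p i<..p (Suc i)} u)"
      by simp
    finally show ?thesis .
  qed
  ultimately show ?thesis by simp
qed

lemma char_W_increment:
  assumes "s \<in> {0..1}" "t \<in> {0..1}" "s \<le> t"
  shows "char (distr M borel (\<lambda>\<omega>. c * (W t \<omega> - W s \<omega>))) \<theta> = exp (- (\<theta>\<^sup>2 * (c\<^sup>2 * (t - s))) / 2)"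
proof (cases "s = t")
  case True
  then show ?thesis by (simp add: char_def integral_distr prob_space del: distr_const)
next
  case False
  with assms have st: "s < t" by simp
  have [measurable]: "W t \<in> borel_measurable M" "W s \<in> borel_measurable M" using assms by auto
  have "char (distr M borel (\<lambda>\<omega>. c * (W t \<omega> - W s \<omega>))) \<theta>
    = char (distr M lborel (\<lambda>\<omega>. W t \<omega> - W s \<omega>)) (\<theta> * c)"
    by (simp add: char_def integral_distr mult.assoc)
  also have "\<dots> = exp (- (\<theta>\<^sup>2 * (c\<^sup>2 * (t - s))) / 2)"
    using W_increment_distributed[OF assms(1,2) st] st
    by (simp add: distributed_def char_normal power_mult_distrib)
  finally show ?thesis .
qed

lemma char_step_integral:
  assumes "mono p" "range p \<subseteq> {0..1}"
  shows "char (distr M borel (step_integral W k p c)) \<theta>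
     = exp (- (\<theta>\<^sup>2 * (\<integral>u. (step_fun k p c u)\<^sup>2 \<partial>lborel)) / 2)"
proof -
  have r: "p i \<in> {0..1}" "p i \<le> p (Suc i)" for i
    using assms by (auto simp: subset_eq mono_def)
  have "indep_vars (\<lambda>_. borel) (\<lambda>i. (\<lambda>x. c i * x) \<circ> (\<lambda>\<omega>. W (p (Suc i)) \<omega> - W (p i) \<omega>)) {..<k}"
    by (rule indep_vars_compose[OF W_increments_indep[OF assms]]) simp
  then have ind: "indep_vars (\<lambda>_. borel) (\<lambda>i \<omega>. c i * (W (p (Suc i)) \<omega> - W (p i) \<omega>)) {..<k}"
    by (simp add: o_def)
  have "char (distr M borel (\<lambda>\<omega>. \<Sum>i<k. c i * (W (p (Suc i)) \<omega> - W (p i) \<omega>))) \<theta>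
     = (\<Prod>i<k. complex_of_real (exp (- (\<theta>\<^sup>2 * ((c i)\<^sup>2 * (p (Suc i) - p i))) / 2)))"
    unfolding char_distr_sum[OF ind] by (intro prod.cong refl char_W_increment r)
  also have "\<dots> = exp (- (\<theta>\<^sup>2 * (\<Sum>i<k. (c i)\<^sup>2 * (p (Suc i) - p i))) / 2)"
    unfolding of_real_prod[symmetric]
    by (subst exp_sum[symmetric]) (simp_all add: sum_distrib_left sum_negf sum_divide_distrib)
  also have "(\<Sum>i<k. (c i)\<^sup>2 * (p (Suc i) - p i)) = (\<integral>u. (step_fun k p c u)\<^sup>2 \<partial>lborel)"
    using step_fun_square_integral[OF assms, of k c] by (simp add: has_bochner_integral_iff)
  finally show ?thesis unfolding step_integral_def[abs_def] .
qed

end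

section \<open>Independence of the past\<close>

context wiener
begin

definition \<F> :: "real \<Rightarrow> 'a measure" where "\<F> = augmented_filtration M W"

definition gen :: "real \<Rightarrow> 'a set set" where
  "gen t = {W u -` A \<inter> space M | u A. u \<in> {0..t} \<and> A \<in> sets borel} \<union> null_sets M"

lemma gen_Pow: "gen t \<subseteq> Pow (space M)"
  unfolding gen_def using sets.sets_into_space by (fastforce simp: null_sets_def)

lemma space_filtration [simp]: "space (\<F> t) = space M"
  using gen_Pow[of t] unfolding \<F>_def augmented_filtration_def gen_def[symmetric] by (rule space_measure_of)

lemma sets_filtration: "sets (\<F> t) = sigma_sets (space M) (gen t)"
  using gen_Pow[of t] unfolding \<F>_def augmented_filtration_def gen_def[symmetric] by (rule sets_measure_of)

lemma filtration_subalgebra: assumes "t \<in> {0..1}" shows "subalgebra M (\<F> t)"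
proof -
  have "gen t \<subseteq> events"
    using assms by (auto simp: gen_def intro!: measurable_sets[OF W_measurable])
  then show ?thesis
    by (simp add: subalgebra_def sets_filtration sets.sigma_sets_subset)
qed

lemma filtration_mono: "s \<le> t \<Longrightarrow> subalgebra (\<F> t) (\<F> s)"
proof -
  assume "s \<le> t"
  then have "gen s \<subseteq> gen t" by (fastforce simp: gen_def)
  then show ?thesis by (simp add: subalgebra_def sets_filtration sigma_sets_mono')
qed

lemma null_sets_filtration: "null_sets M \<subseteq> sets (\<F> t)"
  by (auto simp: sets_filtration gen_def)

lemma W_adapted: "0 \<le> u \<Longrightarrow> u \<le> t \<Longrightarrow> W u \<in> borel_measurable (\<F> t)"
  by (rule measurableI) (auto simp: sets_filtration gen_def)

text \<open>This is where the augmentation by null sets enters: limits that exist only almost surely stay adapted.\<close>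

lemma measurable_filtration_cong_AE:
  fixes Y Z :: "'a \<Rightarrow> real"
  assumes t: "t \<in> {0..1}" and Y: "Y \<in> borel_measurable (\<F> t)" and Z[measurable]: "Z \<in> borel_measurable M"
    and eq: "AE \<omega> in M. Y \<omega> = Z \<omega>"
  shows "Z \<in> borel_measurable (\<F> t)"
proof (rule measurableI)
  fix B :: "real set" assume B[measurable]: "B \<in> sets borel"
  have YM[measurable]: "Y \<in> borel_measurable M"
    using measurable_from_subalg[OF filtration_subalgebra[OF t] Y] .
  have "{\<omega>\<in>space M. Y \<omega> \<noteq> Z \<omega>} \<in> sets M" by measurable
  then have N: "{\<omega>\<in>space M. Y \<omega> \<noteq> Z \<omega>} \<in> null_sets M"
    using eq by (subst (asm) AE_iff_null) auto
  have "{\<omega>\<in>space M. Y \<omega> \<noteq> Z \<omega> \<and> Z \<omega> \<in> B} \<in> null_sets M"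
    by (rule null_sets_subset[OF N]) auto
  with N have "(Y -` B \<inter> space (\<F> t) - {\<omega>\<in>space M. Y \<omega> \<noteq> Z \<omega>}) \<union> {\<omega>\<in>space M. Y \<omega> \<noteq> Z \<omega> \<and> Z \<omega> \<in> B} \<in> sets (\<F> t)"
    using null_sets_filtration measurable_sets[OF Y B] by (intro sets.Un sets.Diff) auto
  also have "(Y -` B \<inter> space (\<F> t) - {\<omega>\<in>space M. Y \<omega> \<noteq> Z \<omega>}) \<union> {\<omega>\<in>space M. Y \<omega> \<noteq> Z \<omega> \<and> Z \<omega> \<in> B}
     = Z -` B \<inter> space (\<F> t)" by auto
  finally show "Z -` B \<inter> space (\<F> t) \<in> sets (\<F> t)" .
qed simp

text \<open>The times of the cylinder, preceded by \<open>0\<close>, and the nodes of the step function form one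
increasing sequence. The values of \<open>W\<close> at the former are sums of increments, because \<open>W\<close> starts
at \<open>0\<close>, and these increments belong to a block disjoint from the one that the step integral uses.\<close>

lemma cylinder_indep_step_integral:
  assumes s: "s \<in> {0..1}" and U: "finite U" "U \<subseteq> {0..s}" and B: "\<And>u. u \<in> U \<Longrightarrow> B u \<in> sets borel"
    and q: "mono q" "range q \<subseteq> {s..1}" and C: "C \<in> sets borel"
  shows "prob ({\<omega>\<in>space M. \<forall>u\<in>U. W u \<omega> \<in> B u} \<inter> (step_integral W k q c -` C \<inter> space M)) =
    prob {\<omega>\<in>space M. \<forall>u\<in>U. W u \<omega> \<in> B u} * prob (step_integral W k q c -` C \<inter> space M)"
proof -
  define xs where "xs = sorted_list_of_set (insert 0 U)"
  define l where "l = length xs"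
  have set_xs: "set xs = insert 0 U" and sorted: "sorted xs" using U by (simp_all add: xs_def del: sorted_list_of_set_insert_remove)
  have l: "0 < l" using set_xs by (cases xs) (auto simp: l_def)
  have xs0: "xs ! 0 = 0"
  proof -
    have "0 \<in> set xs" by (simp add: set_xs)
    then obtain i where "i < l" "xs ! i = 0" by (auto simp: in_set_conv_nth l_def)
    then have "xs ! 0 \<le> 0" using sorted_nth_mono[OF sorted, of 0 i] by (auto simp: l_def)
    moreover have "0 \<le> xs ! 0" using nth_mem[of 0 xs] l U set_xs by (auto simp: l_def)
    ultimately show ?thesis by simp
  qed
  have xs_s: "xs ! i \<in> {0..s}" if "i < l" for i
    using nth_mem[of i xs] that U set_xs s by (auto simp: l_def)
  define p where "p i = (if i < l then xs ! i else q (i - l))" for i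
  have qs: "s \<le> q i" "q i \<le> 1" for i using q(2) by (auto simp: subset_eq)
  have p: "mono p" "range p \<subseteq> {0..1}"
  proof -
    show "mono p"
    proof (rule monoI)
      fix i j :: nat assume ij: "i \<le> j"
      show "p i \<le> p j"
      proof (cases "j < l")
        case True then show ?thesis using ij sorted_nth_mono[OF sorted ij] by (auto simp: p_def l_def)
      next
        case False
        show ?thesis
        proof (cases "i < l")
          case True then show ?thesis using False xs_s[OF True] qs(1)[of "j - l"] by (auto simp: p_def)
        next
          case F: False then show ?thesis using False ij monoD[OF q(1), of "i - l" "j - l"] by (auto simp: p_def)
        qed
      qed
    qed
    have "p i \<in> {0..1}" for i
      using xs_s[of i] qs[of "i - l"] s by (cases "i < l") (auto simp: p_def)
    then show "range p \<subseteq> {0..1}" by blast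
  qed
  define \<Delta> where "\<Delta> i \<omega> = W (p (Suc i)) \<omega> - W (p i) \<omega>" for i \<omega>
  have ind: "indep_vars (\<lambda>_. borel) \<Delta> {..<l + k}"
    using W_increments_indep[OF p] by (simp add: \<Delta>_def[abs_def])
  define E1 where "E1 = {f \<in> space (Pi\<^sub>M {..<l - 1} (\<lambda>_. borel :: real measure)).
     \<forall>r<l. xs ! r \<in> U \<longrightarrow> (\<Sum>i<r. f i) \<in> B (xs ! r)}"
  have [measurable]: "E1 \<in> sets (Pi\<^sub>M {..<l - 1} (\<lambda>_. borel :: real measure))"
    unfolding E1_def
  proof (rule sets.sets_Collect_countable_All)
    fix r
    show "{f \<in> space (Pi\<^sub>M {..<l - 1} (\<lambda>_. borel :: real measure)). r < l \<longrightarrow> xs ! r \<in> U \<longrightarrow> (\<Sum>i<r. f i) \<in> B (xs ! r)}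
      \<in> sets (Pi\<^sub>M {..<l - 1} (\<lambda>_. borel))"
    proof (cases "r < l \<and> xs ! r \<in> U")
      case True
      have "(\<lambda>f. \<Sum>i<r. f i) \<in> borel_measurable (Pi\<^sub>M {..<l - 1} (\<lambda>_. borel :: real measure))"
        using True by (intro borel_measurable_sum measurable_component_singleton) auto
      from measurable_sets[OF this B[of "xs ! r"]] True show ?thesis
        by (auto simp: vimage_def Int_def conj_commute)
    next
      case False then show ?thesis by (cases "r < l") auto
    qed
  qed
  define E2 where "E2 = (\<lambda>f. \<Sum>i<k. c i * f (l + i)) -` C \<inter> space (Pi\<^sub>M {l..<l + k} (\<lambda>_. borel :: real measure))"
  have "(\<lambda>f. \<Sum>i<k. c i * f (l + i)) \<in> borel_measurable (Pi\<^sub>M {l..<l + k} (\<lambda>_. borel :: real measure))"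
    by (intro borel_measurable_sum borel_measurable_times measurable_component_singleton) auto
  from measurable_sets[OF this C] have E2: "E2 \<in> sets (Pi\<^sub>M {l..<l + k} (\<lambda>_. borel))" by (simp add: E2_def)
  let ?R1 = "\<lambda>\<omega>. restrict (\<lambda>i. \<Delta> i \<omega>) {..<l - 1}"
  let ?R2 = "\<lambda>\<omega>. restrict (\<lambda>i. \<Delta> i \<omega>) {l..<l + k}"
  \<comment> \<open>The increment with index \<open>l - 1\<close> bridges the last cylinder time and the first node, and
      belongs to neither block.\<close>
  have iv: "indep_var (Pi\<^sub>M {..<l - 1} (\<lambda>_. borel)) ?R1 (Pi\<^sub>M {l..<l + k} (\<lambda>_. borel)) ?R2"
    by (rule indep_var_restrict[OF ind]) auto
  have S: "?R2 -` E2 \<inter> space M = step_integral W k q c -` C \<inter> space M"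
  proof -
    have "(\<Sum>i<k. c i * ?R2 \<omega> (l + i)) = step_integral W k q c \<omega>" for \<omega>
      unfolding step_integral_def by (intro sum.cong refl) (simp add: \<Delta>_def p_def Suc_diff_le)
    then show ?thesis by (simp add: E2_def space_PiM vimage_def Int_def)
  qed
  have "AE \<omega> in M. \<omega> \<in> {\<omega>\<in>space M. \<forall>u\<in>U. W u \<omega> \<in> B u} \<longleftrightarrow> \<omega> \<in> ?R1 -` E1 \<inter> space M"
    using W_zero AE_space
  proof eventually_elim
    case (elim \<omega>)
    have *: "(\<Sum>i<r. \<Delta> i \<omega>) = W (xs ! r) \<omega>" if "r < l" for r
    proof -
      have "(\<Sum>i<r. \<Delta> i \<omega>) = (\<Sum>i<r. W (xs ! Suc i) \<omega> - W (xs ! i) \<omega>)"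
        using that by (intro sum.cong) (auto simp: \<Delta>_def p_def)
      also have "\<dots> = W (xs ! r) \<omega>"
        using elim xs0 by (subst sum_lessThan_telescope) simp
      finally show ?thesis .
    qed
    have "(\<Sum>i<r. ?R1 \<omega> i) = W (xs ! r) \<omega>" if "r < l" for r
      using that by (subst *[OF that, symmetric], intro sum.cong) auto
    then have "?R1 \<omega> \<in> E1 \<longleftrightarrow> (\<forall>r<l. xs ! r \<in> U \<longrightarrow> W (xs ! r) \<omega> \<in> B (xs ! r))"
      by (simp add: E1_def space_PiM)
    also have "\<dots> \<longleftrightarrow> (\<forall>u\<in>U. W u \<omega> \<in> B u)"
      using set_xs all_set_conv_all_nth[of xs "\<lambda>u. u \<in> U \<longrightarrow> W u \<omega> \<in> B u"] by (auto simp: l_def)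
    finally show ?case using elim by simp
  qed
  note AEeq = this
  have Um[measurable]: "{\<omega>\<in>space M. \<forall>u\<in>U. W u \<omega> \<in> B u} \<in> events"
  proof (rule sets.sets_Collect_finite_All[OF _ U(1)])
    fix u assume u: "u \<in> U"
    then have "W u \<in> borel_measurable M" using U s by (intro W_measurable) auto
    from measurable_sets[OF this B[OF u]] show "{\<omega>\<in>space M. W u \<omega> \<in> B u} \<in> events"
      by (simp add: vimage_def Int_def conj_commute)
  qed
  have R1m: "?R1 -` E1 \<inter> space M \<in> events"
    using indep_var_rv1[OF iv] by (rule measurable_sets) measurable
  have R2m: "?R2 -` E2 \<inter> space M \<in> events"
    using indep_var_rv2[OF iv] E2 by (rule measurable_sets)
  have "prob ({\<omega>\<in>space M. \<forall>u\<in>U. W u \<omega> \<in> B u} \<inter> (step_integral W k q c -` C \<inter> space M))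
      = prob ((?R1 -` E1 \<inter> space M) \<inter> (?R2 -` E2 \<inter> space M))"
    unfolding S[symmetric]
    by (rule finite_measure_eq_AE) (use AEeq Um R1m R2m in \<open>auto elim!: eventually_mono\<close>)
  also have "(?R1 -` E1 \<inter> space M) \<inter> (?R2 -` E2 \<inter> space M) = (\<lambda>\<omega>. (?R1 \<omega>, ?R2 \<omega>)) -` (E1 \<times> E2) \<inter> space M"
    by auto
  also have "prob \<dots> = prob (?R1 -` E1 \<inter> space M) * prob (?R2 -` E2 \<inter> space M)"
    by (rule indep_varD[OF iv _ E2]) measurable
  also have "prob (?R1 -` E1 \<inter> space M) = prob {\<omega>\<in>space M. \<forall>u\<in>U. W u \<omega> \<in> B u}"
    by (rule finite_measure_eq_AE) (use AEeq Um R1m in auto)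
  finally show ?thesis unfolding S .
qed

text \<open>Cylinder sets together with the null sets are stable under intersection and generate the
augmented filtration, so that independence extends from them by Dynkin's lemma.\<close>

lemma filtration_indep_step_integral:
  assumes s: "s \<in> {0..1}" and q: "mono q" "range q \<subseteq> {s..1}"
    and A: "A \<in> sets (\<F> s)" and C: "C \<in> sets borel"
  shows "prob (A \<inter> (step_integral W k q c -` C \<inter> space M)) =
    prob A * prob (step_integral W k q c -` C \<inter> space M)"
proof -
  define cyl where "cyl U B = {\<omega>\<in>space M. \<forall>u\<in>U. W u \<omega> \<in> B u}" for U and B :: "real \<Rightarrow> real set"
  define P where "P = {cyl U B | U B. finite U \<and> U \<subseteq> {0..s} \<and> (\<forall>u. B u \<in> sets borel)} \<union> null_sets M"
  have rq: "range q \<subseteq> {0..1}" using q s by auto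
  let ?D = "step_integral W k q c -` C \<inter> space M"
  have D: "?D \<in> events" using step_integral_measurable[OF rq] C by (rule measurable_sets)
  have cyl_ev: "cyl U B \<in> events" if "finite U" "U \<subseteq> {0..s}" "\<forall>u. B u \<in> sets borel" for U B
    unfolding cyl_def
  proof (rule sets.sets_Collect_finite_All[OF _ that(1)])
    fix u assume u: "u \<in> U"
    then have "W u \<in> borel_measurable M" using that s by (intro W_measurable) auto
    then have "W u -` B u \<inter> space M \<in> events" using that(3) by (intro measurable_sets) auto
    then show "{\<omega>\<in>space M. W u \<omega> \<in> B u} \<in> events"
      by (simp add: vimage_def Int_def conj_commute)
  qed
  have PE: "P \<subseteq> events" using cyl_ev by (auto simp: P_def)
  have "Int_stable P"
  proof (rule Int_stableI)
    fix a b assume ab: "a \<in> P" "b \<in> P"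
    show "a \<inter> b \<in> P"
    proof (cases "a \<in> null_sets M \<or> b \<in> null_sets M")
      case True
      then have "a \<inter> b \<in> null_sets M"
        using ab PE by (auto intro: null_set_Int1 null_set_Int2)
      then show ?thesis by (simp add: P_def)
    next
      case False
      then obtain U B U' B' where *: "a = cyl U B" "finite U" "U \<subseteq> {0..s}" "\<forall>u. B u \<in> sets borel"
        "b = cyl U' B'" "finite U'" "U' \<subseteq> {0..s}" "\<forall>u. B' u \<in> sets borel"
        using ab by (auto simp: P_def)
      define B'' where "B'' u = (if u \<in> U then B u else UNIV) \<inter> (if u \<in> U' then B' u else UNIV)" for u
      have "a \<inter> b = cyl (U \<union> U') B''" by (auto simp: *(1,5) cyl_def B''_def)
      moreover have "\<forall>u. B'' u \<in> sets borel" using * by (auto simp: B''_def)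
      ultimately show ?thesis using * unfolding P_def
        by (intro UnI1 CollectI exI[of _ "U \<union> U'"] exI[of _ B'']) auto
    qed
  qed
  have "indep_set P {?D}"
    unfolding indep_sets2_eq
  proof (intro conjI ballI)
    show "P \<subseteq> events" by fact
    show "{?D} \<subseteq> events" using D by simp
    fix a b assume a: "a \<in> P" and b: "b \<in> {?D}"
    show "prob (a \<inter> b) = prob a * prob b"
    proof (cases "a \<in> null_sets M")
      case True
      then have "a \<inter> b \<in> null_sets M" using D b by (auto intro: null_set_Int2)
      with True show ?thesis by (simp add: measure_eq_0_null_sets)
    next
      case False
      with a b cylinder_indep_step_integral[OF s _ _ _ q C] show ?thesis
        by (auto simp: P_def cyl_def)
    qed
  qed
  from indep_set_sigma_sets[OF this \<open>Int_stable P\<close>]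
  have ind: "indep_set (sigma_sets (space M) P) (sigma_sets (space M) {?D})" by (simp add: Int_stable_def)
  have "gen s \<subseteq> P"
  proof
    fix a assume "a \<in> gen s"
    then consider "a \<in> null_sets M" | u B where "a = W u -` B \<inter> space M" "u \<in> {0..s}" "B \<in> sets borel"
      by (auto simp: gen_def)
    then show "a \<in> P"
    proof cases
      case 2
      then have "a = cyl {u} (\<lambda>_. B)" by (auto simp: cyl_def)
      with 2 show ?thesis unfolding P_def
        by (intro UnI1 CollectI exI[of _ "{u}"] exI[of _ "\<lambda>_. B"]) auto
    qed (simp add: P_def)
  qed
  then have "A \<in> sigma_sets (space M) P"
    using A sigma_sets_mono'[of "gen s" P] by (auto simp: sets_filtration)
  then show ?thesis by (intro indep_setD[OF ind]) auto
qed

end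

section \<open>Wiener integrals as limits of step integrals\<close>

lemma step_fun_max: "step_fun k (\<lambda>i. max s (p i)) c u = (if s < u then step_fun k p c u else 0)"
  unfolding step_fun_def by (cases "s < u") (auto simp: indicator_def intro!: sum.cong sum.neutral)

lemma step_fun_min: "step_fun k (\<lambda>i. min s (p i)) c u = (if u \<le> s then step_fun k p c u else 0)"
  unfolding step_fun_def by (cases "u \<le> s") (auto simp: indicator_def intro!: sum.cong sum.neutral)

lemma step_fun_outside:
  assumes "range p \<subseteq> {a..b}" "u \<notin> {a<..b}"
  shows "step_fun k p c u = 0"
proof -
  have "a \<le> p i" "p i \<le> b" for i using assms(1) by (auto simp: subset_eq)
  then have "u \<notin> {p i<..p (Suc i)}" for i using assms(2) by (auto intro: order.trans le_less_trans)
  then show ?thesis by (simp add: step_fun_def)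
qed

lemma step_integral_split:
  "step_integral W k p c \<omega> =
     step_integral W k (\<lambda>i. min s (p i)) c \<omega> + step_integral W k (\<lambda>i. max s (p i)) c \<omega>"
  unfolding step_integral_def sum.distrib[symmetric]
  by (intro sum.cong refl) (auto simp: min_def max_def algebra_simps)

lemma nn_integral_square_add_le:
  fixes f g h :: "'a \<Rightarrow> real"
  assumes [measurable]: "f \<in> borel_measurable M" "g \<in> borel_measurable M"
    and "\<And>x. x \<in> space M \<Longrightarrow> h x = f x + g x \<or> h x = f x - g x"
  shows "(\<integral>\<^sup>+x. ennreal ((h x)\<^sup>2) \<partial>M) \<le>
    2 * (\<integral>\<^sup>+x. ennreal ((f x)\<^sup>2) \<partial>M) + 2 * (\<integral>\<^sup>+x. ennreal ((g x)\<^sup>2) \<partial>M)"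
proof -
  have "(\<integral>\<^sup>+x. ennreal ((h x)\<^sup>2) \<partial>M) \<le> (\<integral>\<^sup>+x. 2 * ennreal ((f x)\<^sup>2) + 2 * ennreal ((g x)\<^sup>2) \<partial>M)"
  proof (rule nn_integral_mono)
    fix x assume "x \<in> space M"
    with assms(3) have "(h x)\<^sup>2 \<le> 2 * (f x)\<^sup>2 + 2 * (g x)\<^sup>2"
      using sum_squares_bound[of "f x" "g x"] sum_squares_bound[of "f x" "- g x"]
      by (fastforce simp: power2_sum power2_diff)
    then have "ennreal ((h x)\<^sup>2) \<le> ennreal (2 * (f x)\<^sup>2 + 2 * (g x)\<^sup>2)" by (rule ennreal_leI)
    also have "\<dots> = 2 * ennreal ((f x)\<^sup>2) + 2 * ennreal ((g x)\<^sup>2)"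
      by (simp add: ennreal_plus ennreal_mult)
    finally show "ennreal ((h x)\<^sup>2) \<le> 2 * ennreal ((f x)\<^sup>2) + 2 * ennreal ((g x)\<^sup>2)" .
  qed
  also have "\<dots> = 2 * (\<integral>\<^sup>+x. ennreal ((f x)\<^sup>2) \<partial>M) + 2 * (\<integral>\<^sup>+x. ennreal ((g x)\<^sup>2) \<partial>M)"
    by (subst nn_integral_add) (auto simp: nn_integral_cmult)
  finally show ?thesis .
qed

lemma tendsto_0_double_add:
  fixes a b :: "nat \<Rightarrow> ennreal"
  assumes "a \<longlonglongrightarrow> 0" "b \<longlonglongrightarrow> 0"
  shows "(\<lambda>j. 2 * a j + 2 * b j) \<longlonglongrightarrow> 0"
proof -
  have "(\<lambda>j. 2 * a j + 2 * b j) \<longlonglongrightarrow> 2 * 0 + 2 * 0"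
    by (intro tendsto_add ennreal_tendsto_cmult assms) auto
  then show ?thesis by simp
qed

lemma tendsto_0_le_ennreal:
  fixes a b :: "nat \<Rightarrow> ennreal"
  assumes "b \<longlonglongrightarrow> 0" "\<And>j. a j \<le> b j"
  shows "a \<longlonglongrightarrow> 0"
  by (rule tendsto_sandwich[OF _ _ tendsto_const assms(1)]) (auto simp: assms(2))

context wiener
begin

text \<open>A mean-square limit is an almost sure limit along a subsequence.\<close>

lemma wiener_integral_adapted:
  assumes t: "t \<in> {0..1}" and Z: "is_wiener_integral M W f t Z"
  shows "Z \<in> borel_measurable (\<F> t)"
proof -
  from Z obtain k p c where p: "\<And>j. mono (p j)" "\<And>j. range (p j) \<subseteq> {0..t}"
    and L2: "(\<lambda>j. \<integral>\<^sup>+\<omega>. ennreal ((Z \<omega> - step_integral W (k j) (p j) (c j) \<omega>)\<^sup>2) \<partial>M) \<longlonglongrightarrow> 0"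
    and [measurable]: "Z \<in> borel_measurable M"
    unfolding is_wiener_integral_def by blast
  define S where "S j = step_integral W (k j) (p j) (c j)" for j
  have pt: "p j i \<in> {0..t}" for i j using p(2) by blast
  have S: "S j \<in> borel_measurable (\<F> t)" for j
    unfolding S_def step_integral_def
    by (intro borel_measurable_sum borel_measurable_times borel_measurable_diff W_adapted
        borel_measurable_const) (use pt in auto)
  have [measurable]: "S j \<in> borel_measurable M" for j
    using measurable_from_subalg[OF filtration_subalgebra[OF t] S] .
  obtain r where r: "AE \<omega> in M. (\<lambda>j. Z \<omega> - S (r j) \<omega>) \<longlonglongrightarrow> 0"
  proof -
    have "\<exists>r. strict_mono r \<and> (AE \<omega> in M. (\<lambda>j. Z \<omega> - S (r j) \<omega>) \<longlonglongrightarrow> 0)"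
      by (rule AE_subseq_of_L2) (use L2 in \<open>simp_all add: S_def[symmetric]\<close>)
    with that show ?thesis by blast
  qed
  have "(\<lambda>\<omega>. lim (\<lambda>j. S (r j) \<omega>)) \<in> borel_measurable (\<F> t)"
    using S by (intro borel_measurable_lim_metric)
  moreover have "AE \<omega> in M. lim (\<lambda>j. S (r j) \<omega>) = Z \<omega>"
    using r
  proof eventually_elim
    case (elim \<omega>)
    have "(\<lambda>j. Z \<omega> - (Z \<omega> - S (r j) \<omega>)) \<longlonglongrightarrow> Z \<omega> - 0"
      by (intro tendsto_diff tendsto_const elim)
    then show ?case by (intro limI) simp
  qed
  ultimately show ?thesis by (intro measurable_filtration_cong_AE[OF t, of _ Z]) auto
qed

text \<open>The two Wiener integrals come with unrelated approximating sequences. Moving the nodes of the one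
for \<open>[0,t]\<close> that lie before \<open>s\<close> to \<open>s\<close> approximates the increment: the part that is cut off and
the approximation for \<open>[0,s]\<close> converge to the same function in \<open>L\<^sub>2[0,s]\<close>, so that by the isometry
their integrals differ by a vanishing amount.\<close>

lemma wiener_increment_approx:
  assumes s: "0 \<le> s" "s \<le> t" "t \<le> 1"
    and f[measurable]: "f \<in> borel_measurable borel"
    and Zs: "is_wiener_integral M W f s Zs" and Zt: "is_wiener_integral M W f t Zt"
  obtains k q c where "\<And>j. mono (q j)" "\<And>j. range (q j) \<subseteq> {s..t}"
    "AE \<omega> in M. (\<lambda>j. step_integral W (k j) (q j) (c j) \<omega>) \<longlonglongrightarrow> Zt \<omega> - Zs \<omega>"
    "(\<lambda>j. \<integral>\<^sup>+u\<in>{s<..t}. ennreal ((f u - step_fun (k j) (q j) (c j) u)\<^sup>2) \<partial>lborel) \<longlonglongrightarrow> 0"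
proof -
  from Zt obtain k p c where p: "\<And>j. mono (p j)" "\<And>j. range (p j) \<subseteq> {0..t}"
    and L2: "(\<lambda>j. \<integral>\<^sup>+\<omega>. ennreal ((Zt \<omega> - step_integral W (k j) (p j) (c j) \<omega>)\<^sup>2) \<partial>M) \<longlonglongrightarrow> 0"
    and F: "(\<lambda>j. \<integral>\<^sup>+u\<in>{0..t}. ennreal ((f u - step_fun (k j) (p j) (c j) u)\<^sup>2) \<partial>lborel) \<longlonglongrightarrow> 0"
    and [measurable]: "Zt \<in> borel_measurable M"
    unfolding is_wiener_integral_def by blast
  from Zs obtain k' p' c' where p': "\<And>j. mono (p' j)" "\<And>j. range (p' j) \<subseteq> {0..s}"
    and L2': "(\<lambda>j. \<integral>\<^sup>+\<omega>. ennreal ((Zs \<omega> - step_integral W (k' j) (p' j) (c' j) \<omega>)\<^sup>2) \<partial>M) \<longlonglongrightarrow> 0"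
    and F': "(\<lambda>j. \<integral>\<^sup>+u\<in>{0..s}. ennreal ((f u - step_fun (k' j) (p' j) (c' j) u)\<^sup>2) \<partial>lborel) \<longlonglongrightarrow> 0"
    and [measurable]: "Zs \<in> borel_measurable M"
    unfolding is_wiener_integral_def by blast
  define q where "q j i = max s (p j i)" for j i
  define q' where "q' j i = min s (p j i)" for j i
  have pt: "0 \<le> p j i" "p j i \<le> t" "p j i \<le> 1" for i j
    using subsetD[OF p(2) rangeI, of j i] s by auto
  have p1: "range (p j) \<subseteq> {0..1}" "range (p' j) \<subseteq> {0..1}" for j
    using p(2)[of j] p'(2)[of j] s by auto
  have q: "mono (q j)" "range (q j) \<subseteq> {s..t}" "mono (q' j)" "range (q' j) \<subseteq> {0..1}" "range (q j) \<subseteq> {0..1}" for j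
  proof -
    show "mono (q j)"
      by (rule monoI) (unfold q_def, intro max.mono order_refl monoD[OF p(1)])
    show "mono (q' j)"
      by (rule monoI) (unfold q'_def, intro min.mono order_refl monoD[OF p(1)])
    show "range (q j) \<subseteq> {s..t}" "range (q' j) \<subseteq> {0..1}" "range (q j) \<subseteq> {0..1}"
      using pt s by (auto simp: q_def q'_def le_max_iff_disj min_le_iff_disj)
  qed
  define T where "T j = step_integral W (k j) (p j) (c j)" for j
  define T' where "T' j = step_integral W (k' j) (p' j) (c' j)" for j
  define S where "S j = step_integral W (k j) (q j) (c j)" for j
  define S' where "S' j = step_integral W (k j) (q' j) (c j)" for j
  have [measurable]: "T j \<in> borel_measurable M" "T' j \<in> borel_measurable M"
      "S j \<in> borel_measurable M" "S' j \<in> borel_measurable M" for j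
    unfolding T_def T'_def S_def S'_def by (intro step_integral_measurable p1 q)+
  have split: "T j \<omega> = S' j \<omega> + S j \<omega>" for j \<omega>
    unfolding T_def S_def S'_def q_def[abs_def] q'_def[abs_def] by (rule step_integral_split)
  have D: "(\<lambda>j. \<integral>\<^sup>+\<omega>. ennreal ((S' j \<omega> - T' j \<omega>)\<^sup>2) \<partial>M) \<longlonglongrightarrow> 0"
  proof (rule tendsto_0_le_ennreal[OF tendsto_0_double_add[OF F F']])
    fix j
    let ?g = "step_fun (k j) (p j) (c j)" and ?g' = "step_fun (k' j) (p' j) (c' j)"
    have "(\<integral>\<^sup>+\<omega>. ennreal ((S' j \<omega> - T' j \<omega>)\<^sup>2) \<partial>M)
       = (\<integral>\<^sup>+u. ennreal ((step_fun (k j) (q' j) (c j) u - ?g' u)\<^sup>2) \<partial>lborel)"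
      unfolding S'_def T'_def by (intro ito_isometry_diff q p' p1)
    also have "\<dots> \<le> 2 * (\<integral>\<^sup>+u. ennreal ((indicator {0..t} u * (f u - ?g u))\<^sup>2) \<partial>lborel)
        + 2 * (\<integral>\<^sup>+u. ennreal ((indicator {0..s} u * (f u - ?g' u))\<^sup>2) \<partial>lborel)"
    proof -
      have *: "step_fun (k j) (q' j) (c j) u - ?g' u =
         indicator {0..s} u * (f u - ?g' u) - indicator {0..s} u * (f u - ?g u)" for u
        using step_fun_outside[OF p(2)[of j], of u] step_fun_outside[OF p'(2)[of j], of u] s
        by (auto simp: q'_def[abs_def] step_fun_min indicator_def)
      have "(\<integral>\<^sup>+u. ennreal ((step_fun (k j) (q' j) (c j) u - ?g' u)\<^sup>2) \<partial>lborel) \<le>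
         2 * (\<integral>\<^sup>+u. ennreal ((indicator {0..s} u * (f u - ?g' u))\<^sup>2) \<partial>lborel) +
         2 * (\<integral>\<^sup>+u. ennreal ((indicator {0..s} u * (f u - ?g u))\<^sup>2) \<partial>lborel)"
        by (rule nn_integral_square_add_le) (simp_all add: *)
      also have "\<dots> \<le> 2 * (\<integral>\<^sup>+u. ennreal ((indicator {0..s} u * (f u - ?g' u))\<^sup>2) \<partial>lborel) +
         2 * (\<integral>\<^sup>+u. ennreal ((indicator {0..t} u * (f u - ?g u))\<^sup>2) \<partial>lborel)"
        using s by (intro add_left_mono mult_left_mono nn_integral_mono) (auto simp: indicator_def)
      finally show ?thesis by (simp add: add.commute)
    qed
    also have "\<dots> = 2 * (\<integral>\<^sup>+u\<in>{0..t}. ennreal ((f u - ?g u)\<^sup>2) \<partial>lborel)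
        + 2 * (\<integral>\<^sup>+u\<in>{0..s}. ennreal ((f u - ?g' u)\<^sup>2) \<partial>lborel)"
      by (intro arg_cong2[where f=plus] arg_cong2[where f=times] refl nn_integral_cong)
        (auto simp: indicator_def)
    finally show "(\<integral>\<^sup>+\<omega>. ennreal ((S' j \<omega> - T' j \<omega>)\<^sup>2) \<partial>M) \<le> \<dots>" .
  qed
  have "(\<lambda>j. \<integral>\<^sup>+\<omega>. ennreal (((Zt \<omega> - Zs \<omega>) - S j \<omega>)\<^sup>2) \<partial>M) \<longlonglongrightarrow> 0"
  proof (rule tendsto_0_le_ennreal[OF tendsto_0_double_add[OF tendsto_0_double_add[OF L2 L2'] D]])
    fix j
    have "(\<integral>\<^sup>+\<omega>. ennreal (((Zt \<omega> - Zs \<omega>) - S j \<omega>)\<^sup>2) \<partial>M) \<le>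
       2 * (\<integral>\<^sup>+\<omega>. ennreal (((Zt \<omega> - T j \<omega>) - (Zs \<omega> - T' j \<omega>))\<^sup>2) \<partial>M) + 2 * (\<integral>\<^sup>+\<omega>. ennreal ((S' j \<omega> - T' j \<omega>)\<^sup>2) \<partial>M)"
      by (rule nn_integral_square_add_le) (simp_all add: split)
    also have "\<dots> \<le> 2 * (2 * (\<integral>\<^sup>+\<omega>. ennreal ((Zt \<omega> - T j \<omega>)\<^sup>2) \<partial>M) + 2 * (\<integral>\<^sup>+\<omega>. ennreal ((Zs \<omega> - T' j \<omega>)\<^sup>2) \<partial>M))
        + 2 * (\<integral>\<^sup>+\<omega>. ennreal ((S' j \<omega> - T' j \<omega>)\<^sup>2) \<partial>M)"
      by (intro add_right_mono mult_left_mono nn_integral_square_add_le) auto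
    finally show "(\<integral>\<^sup>+\<omega>. ennreal (((Zt \<omega> - Zs \<omega>) - S j \<omega>)\<^sup>2) \<partial>M) \<le>
      2 * (2 * (\<integral>\<^sup>+\<omega>. ennreal ((Zt \<omega> - step_integral W (k j) (p j) (c j) \<omega>)\<^sup>2) \<partial>M) +
           2 * (\<integral>\<^sup>+\<omega>. ennreal ((Zs \<omega> - step_integral W (k' j) (p' j) (c' j) \<omega>)\<^sup>2) \<partial>M)) +
      2 * (\<integral>\<^sup>+\<omega>. ennreal ((S' j \<omega> - T' j \<omega>)\<^sup>2) \<partial>M)" by (simp add: T_def T'_def)
  qed
  from AE_subseq_of_L2[OF _ this] obtain r where r: "strict_mono r"
    "AE \<omega> in M. (\<lambda>j. (Zt \<omega> - Zs \<omega>) - S (r j) \<omega>) \<longlonglongrightarrow> 0" by auto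
  show ?thesis
  proof (rule that[of "\<lambda>j. q (r j)" "\<lambda>j. k (r j)" "\<lambda>j. c (r j)"])
    show "AE \<omega> in M. (\<lambda>j. step_integral W (k (r j)) (q (r j)) (c (r j)) \<omega>) \<longlonglongrightarrow> Zt \<omega> - Zs \<omega>"
      using r(2)
    proof eventually_elim
      case (elim \<omega>)
      have "(\<lambda>j. (Zt \<omega> - Zs \<omega>) - ((Zt \<omega> - Zs \<omega>) - S (r j) \<omega>)) \<longlonglongrightarrow> (Zt \<omega> - Zs \<omega>) - 0"
        by (intro tendsto_diff tendsto_const elim)
      then show ?case by (simp add: S_def)
    qed
    have "(\<lambda>j. \<integral>\<^sup>+u\<in>{s<..t}. ennreal ((f u - step_fun (k j) (q j) (c j) u)\<^sup>2) \<partial>lborel) \<longlonglongrightarrow> 0"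
    proof (rule tendsto_0_le_ennreal[OF F])
      fix j
      show "(\<integral>\<^sup>+u\<in>{s<..t}. ennreal ((f u - step_fun (k j) (q j) (c j) u)\<^sup>2) \<partial>lborel)
         \<le> (\<integral>\<^sup>+u\<in>{0..t}. ennreal ((f u - step_fun (k j) (p j) (c j) u)\<^sup>2) \<partial>lborel)"
        using s by (intro nn_integral_mono) (auto simp: q_def[abs_def] step_fun_max indicator_def)
    qed
    from LIMSEQ_subseq_LIMSEQ[OF this r(1)]
    show "(\<lambda>j. \<integral>\<^sup>+u\<in>{s<..t}. ennreal ((f u - step_fun (k (r j)) (q (r j)) (c (r j)) u)\<^sup>2) \<partial>lborel) \<longlonglongrightarrow> 0"
      by (simp add: o_def)
  qed (use q in auto)
qed

end

text \<open>Young's inequality \<open>2 C |w| \<le> \<eta> + C\<^sup>2 w\<^sup>2 / \<eta>\<close> controls the cross term in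
\<open>g\<^sup>2 - f\<^sup>2 = w\<^sup>2 - 2 f w\<close>, where \<open>w = f - g\<close>.\<close>

lemma L2_norm_tendsto:
  fixes f :: "'a \<Rightarrow> real" and g :: "nat \<Rightarrow> 'a \<Rightarrow> real"
  assumes "finite_measure M" and [measurable]: "f \<in> borel_measurable M"
    and bound: "AE x in M. \<bar>f x\<bar> \<le> C"
    and g: "\<And>j. integrable M (\<lambda>x. (g j x)\<^sup>2)" and gm[measurable]: "\<And>j. g j \<in> borel_measurable M"
    and lim: "(\<lambda>j. \<integral>\<^sup>+x. ennreal ((f x - g j x)\<^sup>2) \<partial>M) \<longlonglongrightarrow> 0"
  shows "(\<lambda>j. \<integral>x. (g j x)\<^sup>2 \<partial>M) \<longlonglongrightarrow> (\<integral>x. (f x)\<^sup>2 \<partial>M)"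
proof (rule tendstoI)
  interpret finite_measure M by fact
  fix e :: real assume e: "0 < e"
  define m where "m = measure M (space M)"
  define \<eta> where "\<eta> = e / (2 * (m + 1))"
  have m: "0 \<le> m" by (simp add: m_def)
  have \<eta>: "0 < \<eta>" and \<eta>m: "\<eta> * m < e / 2"
    using e m by (auto simp: \<eta>_def field_simps add_pos_nonneg intro!: divide_pos_pos)
  define D where "D = C\<^sup>2 / \<eta> + 1"
  have D: "0 < D" using \<eta> by (auto simp: D_def add_nonneg_pos)
  have f2: "integrable M (\<lambda>x. (f x)\<^sup>2)"
  proof (rule integrable_const_bound[where B="C\<^sup>2"])
    show "AE x in M. norm ((f x)\<^sup>2) \<le> C\<^sup>2"
      using bound by eventually_elim (auto simp: abs_le_square_iff[symmetric])
  qed simp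
  have d2: "integrable M (\<lambda>x. (f x - g j x)\<^sup>2)" for j
  proof (rule Bochner_Integration.integrable_bound)
    show "integrable M (\<lambda>x. 2 * (f x)\<^sup>2 + 2 * (g j x)\<^sup>2)" using f2 g by simp
    show "AE x in M. norm ((f x - g j x)\<^sup>2) \<le> norm (2 * (f x)\<^sup>2 + 2 * (g j x)\<^sup>2)"
    proof (rule AE_I2)
      fix x
      have "(f x - g j x)\<^sup>2 \<le> 2 * (f x)\<^sup>2 + 2 * (g j x)\<^sup>2"
        using sum_squares_bound[of "f x" "- g j x"] by (simp add: power2_diff)
      then show "norm ((f x - g j x)\<^sup>2) \<le> norm (2 * (f x)\<^sup>2 + 2 * (g j x)\<^sup>2)" by simp
    qed
  qed simp
  have "(\<lambda>j. ennreal (\<integral>x. (f x - g j x)\<^sup>2 \<partial>M)) \<longlonglongrightarrow> ennreal 0"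
    using lim d2 by (simp add: nn_integral_eq_integral)
  then have "(\<lambda>j. \<integral>x. (f x - g j x)\<^sup>2 \<partial>M) \<longlonglongrightarrow> 0"
    by (subst (asm) tendsto_ennreal_iff) auto
  then have "\<forall>\<^sub>F j in sequentially. (\<integral>x. (f x - g j x)\<^sup>2 \<partial>M) < e / (2 * D)"
    using e D by (intro order_tendstoD) auto
  then show "\<forall>\<^sub>F j in sequentially. dist (\<integral>x. (g j x)\<^sup>2 \<partial>M) (\<integral>x. (f x)\<^sup>2 \<partial>M) < e"
  proof eventually_elim
    case (elim j)
    have "\<bar>(\<integral>x. (g j x)\<^sup>2 \<partial>M) - (\<integral>x. (f x)\<^sup>2 \<partial>M)\<bar> = \<bar>\<integral>x. (g j x)\<^sup>2 - (f x)\<^sup>2 \<partial>M\<bar>"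
      using g f2 by simp
    also have "\<dots> \<le> (\<integral>x. \<bar>(g j x)\<^sup>2 - (f x)\<^sup>2\<bar> \<partial>M)"
      using integral_norm_bound[of M "\<lambda>x. (g j x)\<^sup>2 - (f x)\<^sup>2"] by simp
    also have "\<dots> \<le> (\<integral>x. \<eta> + D * (f x - g j x)\<^sup>2 \<partial>M)"
    proof (rule integral_mono_AE)
      show "AE x in M. \<bar>(g j x)\<^sup>2 - (f x)\<^sup>2\<bar> \<le> \<eta> + D * (f x - g j x)\<^sup>2"
        using bound
      proof eventually_elim
        case (elim x)
        define w where "w = f x - g j x"
        have "(g j x)\<^sup>2 - (f x)\<^sup>2 = w\<^sup>2 - 2 * (f x * w)"
          by (simp add: w_def power2_eq_square algebra_simps)
        then have "\<bar>(g j x)\<^sup>2 - (f x)\<^sup>2\<bar> \<le> w\<^sup>2 + 2 * (\<bar>f x\<bar> * \<bar>w\<bar>)"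
          unfolding abs_mult[symmetric] using zero_le_power2[of w] by arith
        also have "\<bar>f x\<bar> * \<bar>w\<bar> \<le> C * \<bar>w\<bar>" using elim by (intro mult_right_mono) auto
        also have "w\<^sup>2 + 2 * (C * \<bar>w\<bar>) \<le> \<eta> + D * w\<^sup>2"
        proof -
          have "0 \<le> (\<eta> - C * \<bar>w\<bar>)\<^sup>2 / \<eta>" using \<eta> by simp
          also have "\<dots> = \<eta> - 2 * (C * \<bar>w\<bar>) + C\<^sup>2 / \<eta> * w\<^sup>2"
            using \<eta> by (simp add: power2_eq_square field_simps)
          finally show ?thesis by (simp add: D_def algebra_simps)
        qed
        finally show ?case by (simp add: w_def)
      qed
    qed (use g f2 d2 in auto)
    also have "\<dots> = \<eta> * m + D * (\<integral>x. (f x - g j x)\<^sup>2 \<partial>M)"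
      using d2 by (simp add: m_def)
    also have "\<dots> < e / 2 + e / 2"
      using elim D \<eta>m by (intro add_strict_mono) (auto simp: field_simps)
    finally show ?case by (simp add: dist_real_def)
  qed
qed

section \<open>Increments of Wiener integrals\<close>

context wiener
begin

text \<open>For a step function the two factors separate by independence, and the second one is the
characteristic function of a sum of independent Gaussian increments. Both sides pass to the limit, the
left by dominated convergence and the right because the variances converge.\<close>

lemma wiener_increment_char:
  assumes s: "0 \<le> s" "s \<le> t" "t \<le> 1"
    and f[measurable]: "f \<in> borel_measurable borel" and bound: "\<And>u. \<bar>f u\<bar> \<le> C"
    and Zs: "is_wiener_integral M W f s Zs" and Zt: "is_wiener_integral M W f t Zt"
    and A: "A \<in> sets (\<F> s)"
  shows "(\<integral>\<omega>. indicator A \<omega> * iexp (\<theta> * (Zt \<omega> - Zs \<omega>)) \<partial>M) =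
    prob A * exp (- (\<theta>\<^sup>2 * (LINT u:{s<..t}|lborel. (f u)\<^sup>2)) / 2)"
proof -
  have s01: "s \<in> {0..1}" using s by auto
  have [measurable]: "A \<in> events"
    using A filtration_subalgebra[OF s01] by (auto simp: subalgebra_def)
  have [measurable]: "Zt \<in> borel_measurable M" "Zs \<in> borel_measurable M"
    using Zs Zt by (auto simp: is_wiener_integral_def)
  obtain q k c where q: "\<And>j. mono (q j)" "\<And>j. range (q j) \<subseteq> {s..t}"
    and ae: "AE \<omega> in M. (\<lambda>j. step_integral W (k j) (q j) (c j) \<omega>) \<longlonglongrightarrow> Zt \<omega> - Zs \<omega>"
    and L2: "(\<lambda>j. \<integral>\<^sup>+u\<in>{s<..t}. ennreal ((f u - step_fun (k j) (q j) (c j) u)\<^sup>2) \<partial>lborel) \<longlonglongrightarrow> 0"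
    by (rule wiener_increment_approx[OF s f Zs Zt], rule that)
  have q01: "range (q j) \<subseteq> {0..1}" and qs: "range (q j) \<subseteq> {s..1}" for j
    using q(2)[of j] s by auto
  define S where "S j = step_integral W (k j) (q j) (c j)" for j
  define g where "g j = step_fun (k j) (q j) (c j)" for j
  have Sm[measurable]: "S j \<in> borel_measurable M" for j
    unfolding S_def by (intro step_integral_measurable q01)
  have gm[measurable]: "g j \<in> borel_measurable borel" for j unfolding g_def by measurable
  let ?R = "restrict_space lborel {s<..t}"
  have "(\<lambda>j. \<integral>u. (g j u)\<^sup>2 \<partial>?R) \<longlonglongrightarrow> (\<integral>u. (f u)\<^sup>2 \<partial>?R)"
  proof (rule L2_norm_tendsto)
    show "finite_measure ?R"
      using s by (intro finite_measureI) (simp add: emeasure_restrict_space space_restrict_space)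
    show "f \<in> borel_measurable ?R" "g j \<in> borel_measurable ?R" for j
      by (auto intro!: measurable_restrict_space1)
    show "AE x in ?R. \<bar>f x\<bar> \<le> C" using bound by auto
    show "integrable ?R (\<lambda>x. (g j x)\<^sup>2)" for j
    proof -
      have "integrable lborel (\<lambda>x. (g j x)\<^sup>2)"
        using step_fun_square_integral[OF q(1)[of j] q01[of j], of "k j" "c j"]
        by (auto simp: has_bochner_integral_iff g_def)
      then show ?thesis
        using integrable_mult_indicator[of "{s<..t}" lborel "\<lambda>x. (g j x)\<^sup>2"]
        by (simp add: integrable_restrict_space)
    qed
    show "(\<lambda>j. \<integral>\<^sup>+x. ennreal ((f x - g j x)\<^sup>2) \<partial>?R) \<longlonglongrightarrow> 0"
      using L2 by (simp add: nn_integral_restrict_space g_def)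
  qed
  moreover have "(\<integral>u. (g j u)\<^sup>2 \<partial>?R) = (\<integral>u. (g j u)\<^sup>2 \<partial>lborel)" for j
    unfolding integral_restrict_space[of "{s<..t}" lborel, simplified]
    using step_fun_outside[OF q(2)] by (intro Bochner_Integration.integral_cong) (auto simp: g_def indicator_def)
  moreover have "(\<integral>u. (f u)\<^sup>2 \<partial>?R) = (LINT u:{s<..t}|lborel. (f u)\<^sup>2)"
    by (simp add: integral_restrict_space set_lebesgue_integral_def)
  ultimately have v: "(\<lambda>j. \<integral>u. (g j u)\<^sup>2 \<partial>lborel) \<longlonglongrightarrow> (LINT u:{s<..t}|lborel. (f u)\<^sup>2)" by simp
  have eq: "(\<integral>\<omega>. indicator A \<omega> * iexp (\<theta> * S j \<omega>) \<partial>M)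
      = prob A * exp (- (\<theta>\<^sup>2 * (\<integral>u. (g j u)\<^sup>2 \<partial>lborel)) / 2)" for j
  proof -
    have "indep_set (sigma_sets (space M) {A}) (sigma_sets (space M) {S j -` C \<inter> space M | C. C \<in> sets borel})"
    proof (rule indep_set_sigma_sets)
      show "indep_set {A} {S j -` C \<inter> space M | C. C \<in> sets borel}"
        unfolding indep_sets2_eq
        using filtration_indep_step_integral[OF s01 q(1) qs A] measurable_sets[OF Sm[of j]] \<open>A \<in> events\<close>
        by (auto simp: S_def)
      show "Int_stable {S j -` C \<inter> space M | C. C \<in> sets borel}"
      proof (rule Int_stableI, safe)
        fix C C' :: "real set" assume "C \<in> sets borel" "C' \<in> sets borel"
        then show "\<exists>D. S j -` C \<inter> space M \<inter> (S j -` C' \<inter> space M) = S j -` D \<inter> space M \<and> D \<in> sets borel"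
          by (intro exI[of _ "C \<inter> C'"]) auto
      qed
    qed (simp add: Int_stable_def)
    then have "indep_var borel (indicator A :: 'a \<Rightarrow> real) borel (S j)"
      unfolding indep_var_eq
    proof (intro conjI, goal_cases)
      case 3
      have sub: "sigma_sets (space M) {indicator A -` C \<inter> space M |C. C \<in> sets (borel :: real measure)} \<subseteq> sigma_sets (space M) {A}"
      proof (rule sigma_sets_mono, safe)
        fix C :: "real set"
        have AM: "A \<subseteq> space M" using \<open>A \<in> events\<close> by (rule sets.sets_into_space)
        have *: "indicator A -` C \<inter> space M =
            (if (1::real) \<in> C then A else {}) \<union> (if (0::real) \<in> C then space M - A else {})"
          using AM by (auto simp: indicator_def of_bool_def split: if_splits)
        have "A \<union> (space M - A) = space M" using AM by auto
        then show "indicator A -` C \<inter> space M \<in> sigma_sets (space M) {A}"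
          unfolding * by (auto intro: sigma_sets.intros sigma_sets_top)
      qed
      from 3 show ?case
        using sub unfolding indep_sets2_eq by auto
    qed (use Sm in measurable)
    then have "indep_var borel (complex_of_real \<circ> (indicator A :: 'a \<Rightarrow> real)) borel ((\<lambda>x. iexp (\<theta> * x)) \<circ> S j)"
      by (rule indep_var_compose) auto
    then have iv: "indep_var borel (\<lambda>\<omega>. indicator A \<omega> :: complex) borel (\<lambda>\<omega>. iexp (\<theta> * S j \<omega>))"
      by (simp add: o_def of_real_indicator)
    have i1: "integrable M (\<lambda>\<omega>. indicator A \<omega> :: complex)"
      by (rule integrable_const_bound[where B=1]) (auto simp: indicator_def)
    have i2: "integrable M (\<lambda>\<omega>. iexp (\<theta> * S j \<omega>))"
      by (rule integrable_const_bound[where B=1]) auto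
    have "(\<integral>\<omega>. indicator A \<omega> * iexp (\<theta> * S j \<omega>) \<partial>M) =
       (\<integral>\<omega>. indicator A \<omega> \<partial>M) * (\<integral>\<omega>. iexp (\<theta> * S j \<omega>) \<partial>M)"
      by (rule indep_var_lebesgue_integral[OF iv i1 i2])
    also have "(\<integral>\<omega>. iexp (\<theta> * S j \<omega>) \<partial>M) = char (distr M borel (S j)) \<theta>"
      by (simp add: char_def integral_distr)
    also have "\<dots> = exp (- (\<theta>\<^sup>2 * (\<integral>u. (g j u)\<^sup>2 \<partial>lborel)) / 2)"
      unfolding S_def g_def by (rule char_step_integral[OF q(1) q01])
    also have "(\<integral>\<omega>. indicator A \<omega> \<partial>M) = complex_of_real (prob A)"
      using integral_complex_of_real[of M "indicator A"] by (simp add: of_real_indicator)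
    finally show ?thesis by simp
  qed
  have "(\<lambda>j. \<integral>\<omega>. indicator A \<omega> * iexp (\<theta> * S j \<omega>) \<partial>M)
     \<longlonglongrightarrow> (\<integral>\<omega>. indicator A \<omega> * iexp (\<theta> * (Zt \<omega> - Zs \<omega>)) \<partial>M)"
  proof (rule integral_dominated_convergence[where w="\<lambda>_. 1"])
    show "AE \<omega> in M. (\<lambda>j. indicator A \<omega> * iexp (\<theta> * S j \<omega>)) \<longlonglongrightarrow> indicator A \<omega> * iexp (\<theta> * (Zt \<omega> - Zs \<omega>))"
      using ae
    proof eventually_elim
      case (elim \<omega>)
      then show ?case unfolding S_def[symmetric] by (intro tendsto_intros)
    qed
    show "AE \<omega> in M. norm (indicator A \<omega> * iexp (\<theta> * S j \<omega>)) \<le> 1" for j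
      by (auto simp: norm_mult indicator_def)
  qed auto
  moreover have "(\<lambda>j. complex_of_real (prob A * exp (- (\<theta>\<^sup>2 * (\<integral>u. (g j u)\<^sup>2 \<partial>lborel)) / 2)))
     \<longlonglongrightarrow> complex_of_real (prob A * exp (- (\<theta>\<^sup>2 * (LINT u:{s<..t}|lborel. (f u)\<^sup>2)) / 2))"
    by (intro tendsto_intros v) auto
  ultimately show ?thesis unfolding eq by (rule LIMSEQ_unique)
qed

text \<open>By Levy's uniqueness theorem the law of the increment conditioned on any event of the past is the
Gaussian one; this states independence and the law at once.\<close>

lemma wiener_increment_indep_normal:
  assumes s: "0 \<le> s" "s \<le> t" "t \<le> 1"
    and f[measurable]: "f \<in> borel_measurable borel" and bound: "\<And>u. \<bar>f u\<bar> \<le> C"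
    and Zs: "is_wiener_integral M W f s Zs" and Zt: "is_wiener_integral M W f t Zt"
    and v: "0 < (LINT u:{s<..t}|lborel. (f u)\<^sup>2)"
    and A: "A \<in> sets (\<F> s)" and B: "B \<in> sets borel"
  shows "prob (A \<inter> ((\<lambda>\<omega>. Zt \<omega> - Zs \<omega>) -` B \<inter> space M)) =
    prob A * measure (density lborel (normal_density 0 (sqrt (LINT u:{s<..t}|lborel. (f u)\<^sup>2)))) B"
proof (cases "prob A = 0")
  case True
  have AM: "A \<in> events"
    using A filtration_subalgebra[of s] s by (auto simp: subalgebra_def)
  have "prob (A \<inter> ((\<lambda>\<omega>. Zt \<omega> - Zs \<omega>) -` B \<inter> space M)) \<le> prob A"
    using AM by (intro finite_measure_mono) auto
  with True show ?thesis by (simp add: measure_le_0_iff)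
next
  case False
  let ?v = "LINT u:{s<..t}|lborel. (f u)\<^sup>2"
  let ?N = "density lborel (normal_density 0 (sqrt ?v))"
  have AM[measurable]: "A \<in> events"
    using A filtration_subalgebra[of s] s by (auto simp: subalgebra_def)
  have [measurable]: "Zt \<in> borel_measurable M" "Zs \<in> borel_measurable M"
    using Zs Zt by (auto simp: is_wiener_integral_def)
  have A0: "emeasure M A \<noteq> 0" "emeasure M A \<noteq> \<infinity>" using False by (auto simp: emeasure_eq_measure)
  define U where "U = uniform_measure M A"
  interpret U: prob_space U unfolding U_def by (rule prob_space_uniform_measure[OF A0])
  have [measurable_cong]: "sets U = sets M" by (simp add: U_def)
  have spU: "space U = space M" using \<open>sets U = sets M\<close> by (rule sets_eq_imp_space_eq)
  define G where "G \<omega> = Zt \<omega> - Zs \<omega>" for \<omega>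
  have [measurable]: "G \<in> borel_measurable M" unfolding G_def[abs_def] by measurable
  have U_dens: "U = density M (\<lambda>\<omega>. ennreal (indicator A \<omega> / prob A))"
    unfolding U_def uniform_measure_def
    using False by (intro density_cong) (auto simp: emeasure_eq_measure divide_ennreal zero_less_measure_iff ennreal_indicator[symmetric])
  have "distr U borel G = ?N"
  proof (rule Levy_uniqueness)
    show "real_distribution (distr U borel G)" by (simp add: real_distribution_def U.prob_space_distr real_distribution_axioms_def)
    have "prob_space ?N" using v by (intro prob_space_normal_density) auto
    then show "real_distribution ?N" by (simp add: real_distribution_def real_distribution_axioms_def)
    show "char (distr U borel G) = char ?N"
    proof
      fix \<theta>
      have "char (distr U borel G) \<theta> = (\<integral>\<omega>. iexp (\<theta> * G \<omega>) \<partial>U)"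
        unfolding char_def by (subst integral_distr; (rule refl | measurable))
      also have "\<dots> = (\<integral>\<omega>. (indicator A \<omega> / prob A) *\<^sub>R iexp (\<theta> * G \<omega>) \<partial>M)"
        unfolding U_dens by (subst integral_density) (auto simp: indicator_def)
      also have "\<dots> = (\<integral>\<omega>. (indicator A \<omega> * iexp (\<theta> * G \<omega>)) / prob A \<partial>M)"
        by (intro Bochner_Integration.integral_cong) (auto simp: indicator_def scaleR_conv_of_real)
      also have "\<dots> = (\<integral>\<omega>. indicator A \<omega> * iexp (\<theta> * G \<omega>) \<partial>M) / prob A" by simp
      also have "\<dots> = exp (- (\<theta>\<^sup>2 * ?v) / 2)"
        unfolding G_def wiener_increment_char[OF s f bound Zs Zt A] using False by simp
      also have "\<dots> = char ?N \<theta>" using v by (simp add: char_normal)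
      finally show "char (distr U borel G) \<theta> = char ?N \<theta>" .
    qed
  qed
  then have "measure ?N B = measure (distr U borel G) B" by simp
  also have "\<dots> = measure U (G -` B \<inter> space M)" using B by (simp add: measure_distr spU)
  also have "\<dots> = prob (A \<inter> (G -` B \<inter> space M)) / prob A"
  proof -
    have "G -` B \<inter> space M \<in> events" using B by measurable
    then show ?thesis unfolding U_def using A0 AM by (subst measure_uniform_measure) auto
  qed
  finally show ?thesis using False by (simp add: G_def[abs_def])
qed

end

section \<open>Girsanov transformation in discrete time\<close>

lemma nn_integral_indicator_comp:
  assumes [measurable]: "Y \<in> measurable M L" "B \<in> sets L"
  shows "(\<integral>\<^sup>+\<omega>. indicator B (Y \<omega>) \<partial>M) = emeasure M {\<omega>\<in>space M. Y \<omega> \<in> B}"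
proof -
  have "(\<integral>\<^sup>+\<omega>. indicator B (Y \<omega>) \<partial>M) = emeasure (distr M L Y) B"
    using nn_integral_distr[of Y M L "indicator B"] by simp
  then show ?thesis by (simp add: emeasure_distr vimage_def Int_def conj_commute)
qed

text \<open>Freezing lemma: a variable that is independent of \<open>F\<close> can be integrated out while everything
measurable with respect to \<open>F\<close> is held fixed. It replaces conditional expectations below.\<close>

lemma (in prob_space) nn_integral_freeze:
  assumes sub: "subalgebra M F" and G[measurable]: "G \<in> borel_measurable M"
    and \<nu>: "prob_space \<nu>" "sets \<nu> = sets borel"
    and ind: "\<And>A B. A \<in> sets F \<Longrightarrow> B \<in> sets borel \<Longrightarrow> prob (A \<inter> (G -` B \<inter> space M)) = prob A * measure \<nu> B"
    and \<psi>: "\<psi> \<in> borel_measurable (F \<Otimes>\<^sub>M (borel :: real measure))"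
  shows "(\<integral>\<^sup>+\<omega>. \<psi> (\<omega>, G \<omega>) \<partial>M) = (\<integral>\<^sup>+\<omega>. \<integral>\<^sup>+y. \<psi> (\<omega>, y) \<partial>\<nu> \<partial>M)"
proof -
  interpret \<nu>: prob_space \<nu> by fact
  let ?R = "restr_to_subalg M F"
  interpret R: prob_space ?R using prob_space_restr_to_subalg[OF sub prob_space_axioms] .
  have setsR: "sets ?R = sets F" and spaceF: "space F = space M" "sets F \<subseteq> sets M"
    using sub by (auto simp: sets_restr_to_subalg subalgebra_def)
  have id[measurable]: "(\<lambda>\<omega>. \<omega>) \<in> measurable M F"
    using spaceF by (intro measurableI) auto
  let ?J = "distr M (F \<Otimes>\<^sub>M (borel :: real measure)) (\<lambda>\<omega>. (\<omega>, G \<omega>))"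
  have "?R \<Otimes>\<^sub>M \<nu> = ?J"
  proof (rule pair_measure_eqI)
    show "sigma_finite_measure ?R" "sigma_finite_measure \<nu>" by unfold_locales
    show "sets (?R \<Otimes>\<^sub>M \<nu>) = sets ?J" using setsR \<nu>(2) by (simp cong: sets_pair_measure_cong)
    fix A B assume A: "A \<in> sets ?R" and B: "B \<in> sets \<nu>"
    have AF: "A \<in> sets F" and Bb: "B \<in> sets borel" using A B setsR \<nu>(2) by auto
    have "emeasure ?J (A \<times> B) = emeasure M (A \<inter> (G -` B \<inter> space M))"
      using AF Bb spaceF by (subst emeasure_distr) (auto intro!: arg_cong2[where f=emeasure] dest: sets.sets_into_space)
    also have "\<dots> = ennreal (prob A * measure \<nu> B)" by (simp add: emeasure_eq_measure ind[OF AF Bb])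
    also have "\<dots> = emeasure M A * emeasure \<nu> B"
      by (simp add: emeasure_eq_measure \<nu>.emeasure_eq_measure ennreal_mult)
    also have "emeasure M A = emeasure ?R A" using AF by (simp add: emeasure_restr_to_subalg[OF sub])
    finally show "emeasure ?R A * emeasure \<nu> B = emeasure ?J (A \<times> B)" by simp
  qed
  note J = this
  have \<psi>': "\<psi> \<in> borel_measurable (?R \<Otimes>\<^sub>M \<nu>)"
    using \<psi> setsR \<nu>(2) by (simp cong: measurable_cong_sets sets_pair_measure_cong)
  have "(\<integral>\<^sup>+\<omega>. \<psi> (\<omega>, G \<omega>) \<partial>M) = (\<integral>\<^sup>+x. \<psi> x \<partial>?J)"
    using \<psi> by (subst nn_integral_distr) auto
  also have "\<dots> = (\<integral>\<^sup>+\<omega>. \<integral>\<^sup>+y. \<psi> (\<omega>, y) \<partial>\<nu> \<partial>?R)"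
    unfolding J[symmetric] by (rule \<nu>.nn_integral_fst[OF \<psi>', symmetric])
  also have "\<dots> = (\<integral>\<^sup>+\<omega>. \<integral>\<^sup>+y. \<psi> (\<omega>, y) \<partial>\<nu> \<partial>M)"
  proof (rule nn_integral_subalgebra2[OF sub])
    have "(\<lambda>\<omega>. \<integral>\<^sup>+y. \<psi> (\<omega>, y) \<partial>\<nu>) \<in> borel_measurable ?R"
      using \<psi>' by (rule \<nu>.borel_measurable_nn_integral_fst)
    then show "(\<lambda>\<omega>. \<integral>\<^sup>+y. \<psi> (\<omega>, y) \<partial>\<nu>) \<in> borel_measurable F"
      using setsR by (simp cong: measurable_cong_sets)
  qed
  finally show ?thesis .
qed

abbreviation gaussian :: "real \<Rightarrow> real measure" where
  "gaussian \<sigma> \<equiv> density lborel (\<lambda>x. ennreal (normal_density 0 \<sigma> x))"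

text \<open>The likelihood ratio, at the point \<open>d + y\<close>, of the centred Gaussian law to the Gaussian law with
mean \<open>d\<close>, written in terms of the noise \<open>y\<close>.\<close>

definition shift_density :: "real \<Rightarrow> real \<Rightarrow> real \<Rightarrow> real" where
  "shift_density \<sigma> d y = exp (- (d * y / \<sigma>\<^sup>2) - d\<^sup>2 / (2 * \<sigma>\<^sup>2))"

lemma shift_density_pos: "0 < shift_density \<sigma> d y"
  by (simp add: shift_density_def)

lemma normal_density_shift:
  assumes "0 < \<sigma>"
  shows "normal_density 0 \<sigma> y * shift_density \<sigma> d y = normal_density 0 \<sigma> (d + y)"
proof -
  have "- (y\<^sup>2 / (2 * \<sigma>\<^sup>2)) + (- (d * y / \<sigma>\<^sup>2) - d\<^sup>2 / (2 * \<sigma>\<^sup>2)) = - ((d + y)\<^sup>2 / (2 * \<sigma>\<^sup>2))"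
    using assms by (simp add: power2_sum field_simps)
  then show ?thesis by (simp add: normal_density_def shift_density_def mult.assoc exp_add[symmetric])
qed

lemma nn_integral_gaussian_shift:
  assumes "0 < \<sigma>" and [measurable]: "h \<in> borel_measurable borel"
  shows "(\<integral>\<^sup>+y. ennreal (shift_density \<sigma> d y) * h (d + y) \<partial>gaussian \<sigma>) = (\<integral>\<^sup>+y. h y \<partial>gaussian \<sigma>)"
proof -
  have [measurable]: "shift_density \<sigma> d \<in> borel_measurable borel" unfolding shift_density_def by measurable
  have "(\<integral>\<^sup>+y. ennreal (shift_density \<sigma> d y) * h (d + y) \<partial>gaussian \<sigma>)
    = (\<integral>\<^sup>+y. ennreal (normal_density 0 \<sigma> (d + y)) * h (d + y) \<partial>lborel)"
    by (subst nn_integral_density) (auto simp: normal_density_shift[OF assms(1), symmetric] ennreal_mult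
        normal_density_nonneg less_imp_le[OF shift_density_pos] mult.assoc)
  also have "\<dots> = (\<integral>\<^sup>+y. ennreal (normal_density 0 \<sigma> y) * h y \<partial>lborel)"
    using nn_integral_real_affine[of "\<lambda>y. ennreal (normal_density 0 \<sigma> y) * h y" 1 d] by simp
  also have "\<dots> = (\<integral>\<^sup>+y. h y \<partial>gaussian \<sigma>)" by (subst nn_integral_density) auto
  finally show ?thesis .
qed

lemma nn_integral_inverse_shift_density:
  assumes "0 < \<sigma>"
  shows "(\<integral>\<^sup>+y. ennreal (1 / shift_density \<sigma> d y) \<partial>gaussian \<sigma>) = ennreal (exp (d\<^sup>2 / \<sigma>\<^sup>2))"
proof -
  have [measurable]: "shift_density \<sigma> d' \<in> borel_measurable borel" for d' unfolding shift_density_def by measurable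
  have "exp (d\<^sup>2 / \<sigma>\<^sup>2) * shift_density \<sigma> (- d) y * shift_density \<sigma> d y = 1" for y
    unfolding shift_density_def exp_add[symmetric] by simp
  then have "1 / shift_density \<sigma> d y = exp (d\<^sup>2 / \<sigma>\<^sup>2) * shift_density \<sigma> (- d) y" for y
    using shift_density_pos[of \<sigma> d y] by (simp add: divide_eq_eq)
  then have "(\<integral>\<^sup>+y. ennreal (1 / shift_density \<sigma> d y) \<partial>gaussian \<sigma>)
    = ennreal (exp (d\<^sup>2 / \<sigma>\<^sup>2)) * (\<integral>\<^sup>+y. ennreal (shift_density \<sigma> (- d) y) * 1 \<partial>gaussian \<sigma>)"
    by (simp add: ennreal_mult less_imp_le[OF shift_density_pos] nn_integral_cmult)
  also have "(\<integral>\<^sup>+y. ennreal (shift_density \<sigma> (- d) y) * 1 \<partial>gaussian \<sigma>) = 1"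
    using prob_space.emeasure_space_1[OF prob_space_normal_density[OF assms]]
    by (subst nn_integral_gaussian_shift[OF assms]) auto
  finally show ?thesis by simp
qed

text \<open>A discrete filtration with Gaussian innovations: the step \<open>G j\<close> is known at time \<open>j + 1\<close> and
independent of everything known at time \<open>j\<close>. Only the first \<open>N\<close> steps are specified; the standard
deviations are positive at every index, so that all products of the Gaussian laws are
probability measures.\<close>

locale gaussian_steps = prob_space M for M :: "'a measure" +
  fixes F :: "nat \<Rightarrow> 'a measure" and G :: "nat \<Rightarrow> 'a \<Rightarrow> real" and \<sigma> :: "nat \<Rightarrow> real" and N :: nat
  assumes sub: "\<And>j. j \<le> N \<Longrightarrow> subalgebra M (F j)"
    and F_mono: "\<And>i j. i \<le> j \<Longrightarrow> j \<le> N \<Longrightarrow> subalgebra (F j) (F i)"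
    and G_adapted: "\<And>j. j < N \<Longrightarrow> G j \<in> borel_measurable (F (Suc j))"
    and \<sigma>_pos: "\<And>j. 0 < \<sigma> j"
    and G_indep: "\<And>j A B. j < N \<Longrightarrow> A \<in> sets (F j) \<Longrightarrow> B \<in> sets borel \<Longrightarrow>
        prob (A \<inter> (G j -` B \<inter> space M)) = prob A * measure (gaussian (\<sigma> j)) B"
begin

abbreviation Path :: "nat \<Rightarrow> (nat \<Rightarrow> real) measure" where
  "Path n \<equiv> Pi\<^sub>M {..<n} (\<lambda>_. borel)"

abbreviation Gauss :: "nat \<Rightarrow> (nat \<Rightarrow> real) measure" where
  "Gauss n \<equiv> Pi\<^sub>M {..<n} (\<lambda>j. gaussian (\<sigma> j))"

sublocale gauss: product_prob_space "\<lambda>j. gaussian (\<sigma> j)" UNIV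
proof -
  have "prob_space (gaussian (\<sigma> j))" for j by (rule prob_space_normal_density[OF \<sigma>_pos])
  then show "product_prob_space (\<lambda>j. gaussian (\<sigma> j))"
    by (intro product_prob_spaceI)
qed

lemma sets_Gauss [measurable_cong]: "sets (Gauss n) = sets (Path n)"
  by (intro sets_PiM_cong) auto

lemma measurable_F_mono:
  "f \<in> measurable (F i) L \<Longrightarrow> i \<le> j \<Longrightarrow> j \<le> N \<Longrightarrow> f \<in> measurable (F j) L"
  using measurable_from_subalg[OF F_mono] by blast

lemma G_measurable_M: "j < N \<Longrightarrow> G j \<in> borel_measurable M"
  using measurable_from_subalg[OF sub G_adapted] by simp

context
  fixes D :: "nat \<Rightarrow> 'a \<Rightarrow> real"
  assumes D_adapted: "\<And>j. j < N \<Longrightarrow> D j \<in> borel_measurable (F j)"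
begin

definition weight :: "nat \<Rightarrow> 'a \<Rightarrow> real" where
  "weight n \<omega> = (\<Prod>j<n. shift_density (\<sigma> j) (D j \<omega>) (G j \<omega>))"

definition drifted :: "nat \<Rightarrow> 'a \<Rightarrow> nat \<Rightarrow> real" where
  "drifted n \<omega> = (\<lambda>j\<in>{..<n}. D j \<omega> + G j \<omega>)"

lemma weight_pos: "0 < weight n \<omega>"
  unfolding weight_def by (intro prod_pos) (simp add: shift_density_pos)

lemma DG_measurable:
  assumes "j < n" "n \<le> N"
  shows "D j \<in> borel_measurable (F n)" "G j \<in> borel_measurable (F n)"
  using assms by (auto intro: measurable_F_mono[OF D_adapted] measurable_F_mono[OF G_adapted])

lemma weight_measurable: "n \<le> N \<Longrightarrow> weight n \<in> borel_measurable (F n)"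
  unfolding weight_def
proof (rule borel_measurable_prod)
  fix j assume j: "n \<le> N" "j \<in> {..<n}"
  have [measurable]: "D j \<in> borel_measurable (F n)" "G j \<in> borel_measurable (F n)"
    using DG_measurable[of j n] j by auto
  show "(\<lambda>\<omega>. shift_density (\<sigma> j) (D j \<omega>) (G j \<omega>)) \<in> borel_measurable (F n)"
    unfolding shift_density_def by measurable
qed

lemma drifted_measurable: "n \<le> N \<Longrightarrow> drifted n \<in> measurable (F n) (Path n)"
  unfolding drifted_def by (intro measurable_restrict borel_measurable_add DG_measurable) auto

lemma drifted_measurable_M: "n \<le> N \<Longrightarrow> drifted n \<in> measurable M (Path n)"
  using measurable_from_subalg[OF sub drifted_measurable] by simp

lemma weight_measurable_M: "n \<le> N \<Longrightarrow> weight n \<in> borel_measurable M"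
  using measurable_from_subalg[OF sub weight_measurable] by simp

text \<open>Reweighting removes the drift. The last step is integrated out first: with the past frozen, the drift of that step
is a constant, and the weight undoes the translation by it. The induction hypothesis then applies
to a function of the remaining steps.\<close>

lemma discrete_girsanov:
  assumes "n \<le> N" "h \<in> borel_measurable (Path n)"
  shows "(\<integral>\<^sup>+\<omega>. ennreal (weight n \<omega>) * h (drifted n \<omega>) \<partial>M) = (\<integral>\<^sup>+y. h y \<partial>Gauss n)"
  using assms
proof (induction n arbitrary: h)
  case 0
  then show ?case by (simp add: weight_def drifted_def PiM_empty nn_integral_count_space_finite emeasure_space_1 space_PiM_empty nn_integral_return)
next
  case (Suc n)
  then have n: "n < N" "n \<le> N" by auto
  note [measurable] = weight_measurable[OF n(2)] drifted_measurable[OF n(2)] D_adapted[OF n(1)] Suc.prems(2)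
  have ins: "{..<Suc n} = insert n {..<n}" by auto
  have upd: "(\<lambda>(x, y). x(n := y)) \<in> measurable (Path n \<Otimes>\<^sub>M borel) (Path (Suc n))"
    unfolding ins by (rule measurable_add_dim)
  define \<psi> where "\<psi> = (\<lambda>(\<omega>, y). ennreal (weight n \<omega>) *
     (ennreal (shift_density (\<sigma> n) (D n \<omega>) y) * h ((drifted n \<omega>)(n := D n \<omega> + y))))"
  have upd1: "(\<lambda>z. (drifted n (fst z))(n := D n (fst z) + snd z)) \<in> measurable (F n \<Otimes>\<^sub>M borel) (Path (Suc n))"
    using measurable_compose[OF _ upd, of "\<lambda>z. (drifted n (fst z), D n (fst z) + snd z)" "F n \<Otimes>\<^sub>M borel"]
    by simp
  have \<psi>: "\<psi> \<in> borel_measurable (F n \<Otimes>\<^sub>M borel)"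
    unfolding \<psi>_def case_prod_beta shift_density_def
    using measurable_compose[OF upd1 Suc.prems(2)] by measurable
  have upd2: "(\<lambda>y. x(n := y)) \<in> measurable borel (Path (Suc n))" if "x \<in> space (Path n)" for x
    using measurable_compose[OF _ upd, of "\<lambda>y. (x, y)" borel] that by simp
  have YS: "drifted (Suc n) \<omega> = (drifted n \<omega>)(n := D n \<omega> + G n \<omega>)" for \<omega>
    by (auto simp: drifted_def fun_eq_iff restrict_def)
  have "(\<integral>\<^sup>+\<omega>. ennreal (weight (Suc n) \<omega>) * h (drifted (Suc n) \<omega>) \<partial>M) = (\<integral>\<^sup>+\<omega>. \<psi> (\<omega>, G n \<omega>) \<partial>M)"
    unfolding \<psi>_def YS weight_def
    by (intro nn_integral_cong) (simp add: ennreal_mult prod_nonneg less_imp_le[OF shift_density_pos] mult.assoc)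
  also have "\<dots> = (\<integral>\<^sup>+\<omega>. \<integral>\<^sup>+y. \<psi> (\<omega>, y) \<partial>gaussian (\<sigma> n) \<partial>M)"
    by (rule nn_integral_freeze[OF sub[OF n(2)] G_measurable_M[OF n(1)] _ _ _ \<psi>])
      (auto intro: prob_space_normal_density \<sigma>_pos G_indep[OF n(1)])
  also have "\<dots> = (\<integral>\<^sup>+\<omega>. ennreal (weight n \<omega>) * (\<integral>\<^sup>+y. h ((drifted n \<omega>)(n := y)) \<partial>gaussian (\<sigma> n)) \<partial>M)"
  proof (rule nn_integral_cong)
    fix \<omega> assume "\<omega> \<in> space M"
    then have sp: "drifted n \<omega> \<in> space (Path n)"
      using measurable_space[OF drifted_measurable_M[OF n(2)]] by blast
    have hm[measurable]: "(\<lambda>y. h ((drifted n \<omega>)(n := y))) \<in> borel_measurable borel"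
      using measurable_compose[OF upd2[OF sp] Suc.prems(2)] .
    have [measurable]: "shift_density (\<sigma> n) (D n \<omega>) \<in> borel_measurable borel" unfolding shift_density_def by measurable
    have "(\<integral>\<^sup>+y. \<psi> (\<omega>, y) \<partial>gaussian (\<sigma> n)) = ennreal (weight n \<omega>) *
      (\<integral>\<^sup>+y. ennreal (shift_density (\<sigma> n) (D n \<omega>) y) * h ((drifted n \<omega>)(n := D n \<omega> + y)) \<partial>gaussian (\<sigma> n))"
      unfolding \<psi>_def
      using measurable_compose[of "\<lambda>y. D n \<omega> + y" borel borel, OF _ hm]
      by (simp add: nn_integral_cmult)
    also have "\<dots> = ennreal (weight n \<omega>) * (\<integral>\<^sup>+y. h ((drifted n \<omega>)(n := y)) \<partial>gaussian (\<sigma> n))"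
      by (subst nn_integral_gaussian_shift[OF \<sigma>_pos hm]) simp
    finally show "(\<integral>\<^sup>+y. \<psi> (\<omega>, y) \<partial>gaussian (\<sigma> n)) =
      ennreal (weight n \<omega>) * (\<integral>\<^sup>+y. h ((drifted n \<omega>)(n := y)) \<partial>gaussian (\<sigma> n))" .
  qed
  also have "\<dots> = (\<integral>\<^sup>+x. \<integral>\<^sup>+y. h (x(n := y)) \<partial>gaussian (\<sigma> n) \<partial>Gauss n)"
  proof (rule Suc.IH[OF n(2)])
    have "(\<lambda>z. h ((fst z)(n := snd z))) \<in> borel_measurable (Path n \<Otimes>\<^sub>M gaussian (\<sigma> n))"
      using measurable_compose[OF upd Suc.prems(2)]
      by (simp add: case_prod_beta fun_upd_def cong: measurable_cong_sets sets_pair_measure_cong)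
    from sigma_finite_measure.borel_measurable_nn_integral_fst[OF _ this]
    show "(\<lambda>x. \<integral>\<^sup>+y. h (x(n := y)) \<partial>gaussian (\<sigma> n)) \<in> borel_measurable (Path n)"
      using gauss.sigma_finite_measures by simp
  qed
  also have "\<dots> = (\<integral>\<^sup>+y. h y \<partial>Gauss (Suc n))"
    unfolding ins
    by (rule gauss.product_nn_integral_insert[symmetric])
      (use Suc.prems(2) in \<open>auto simp: ins[symmetric] cong: measurable_cong_sets sets_Gauss\<close>)
  finally show ?case .
qed

text \<open>Each step contributes the exponential moment \<open>exp (D\<^sup>2 / \<sigma>\<^sup>2)\<close>, which is at most a constant because
the drift is bounded by a constant.\<close>

lemma inverse_density_bound:
  assumes "n \<le> N" and \<delta>: "\<And>j \<omega>. j < N \<Longrightarrow> \<bar>D j \<omega>\<bar> \<le> \<delta> j"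
  shows "(\<integral>\<^sup>+\<omega>. ennreal (1 / weight n \<omega>) \<partial>M) \<le> ennreal (exp (\<Sum>j<n. (\<delta> j)\<^sup>2 / (\<sigma> j)\<^sup>2))"
  using assms(1)
proof (induction n)
  case 0
  then show ?case by (simp add: weight_def emeasure_space_1)
next
  case (Suc n)
  then have n: "n < N" "n \<le> N" by auto
  note [measurable] = weight_measurable[OF n(2)] D_adapted[OF n(1)] weight_measurable_M[OF n(2)]
  define \<psi> where "\<psi> = (\<lambda>(\<omega>, y). ennreal (1 / weight n \<omega>) * ennreal (1 / shift_density (\<sigma> n) (D n \<omega>) y))"
  have \<psi>: "\<psi> \<in> borel_measurable (F n \<Otimes>\<^sub>M borel)"
    unfolding \<psi>_def case_prod_beta shift_density_def by measurable
  have "(\<integral>\<^sup>+\<omega>. ennreal (1 / weight (Suc n) \<omega>) \<partial>M) = (\<integral>\<^sup>+\<omega>. \<psi> (\<omega>, G n \<omega>) \<partial>M)"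
    by (intro nn_integral_cong)
      (simp add: \<psi>_def weight_def ennreal_mult[symmetric] prod_nonneg less_imp_le[OF shift_density_pos])
  also have "\<dots> = (\<integral>\<^sup>+\<omega>. \<integral>\<^sup>+y. \<psi> (\<omega>, y) \<partial>gaussian (\<sigma> n) \<partial>M)"
    by (rule nn_integral_freeze[OF sub[OF n(2)] G_measurable_M[OF n(1)] _ _ _ \<psi>])
      (auto intro: prob_space_normal_density \<sigma>_pos G_indep[OF n(1)])
  also have "\<dots> = (\<integral>\<^sup>+\<omega>. ennreal (1 / weight n \<omega>) * ennreal (exp ((D n \<omega>)\<^sup>2 / (\<sigma> n)\<^sup>2)) \<partial>M)"
  proof (rule nn_integral_cong)
    fix \<omega>
    have [measurable]: "shift_density (\<sigma> n) (D n \<omega>) \<in> borel_measurable borel" unfolding shift_density_def by measurable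
    show "(\<integral>\<^sup>+y. \<psi> (\<omega>, y) \<partial>gaussian (\<sigma> n)) = ennreal (1 / weight n \<omega>) * ennreal (exp ((D n \<omega>)\<^sup>2 / (\<sigma> n)\<^sup>2))"
      using nn_integral_inverse_shift_density[OF \<sigma>_pos, of n "D n \<omega>"]
      by (simp add: \<psi>_def nn_integral_cmult)
  qed
  also have "\<dots> \<le> (\<integral>\<^sup>+\<omega>. ennreal (1 / weight n \<omega>) * ennreal (exp ((\<delta> n)\<^sup>2 / (\<sigma> n)\<^sup>2)) \<partial>M)"
  proof (intro nn_integral_mono mult_left_mono ennreal_leI)
    fix \<omega>
    have "(D n \<omega>)\<^sup>2 \<le> (\<delta> n)\<^sup>2" using \<delta>[OF n(1), of \<omega>] by (subst abs_le_square_iff[symmetric]) auto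
    then show "exp ((D n \<omega>)\<^sup>2 / (\<sigma> n)\<^sup>2) \<le> exp ((\<delta> n)\<^sup>2 / (\<sigma> n)\<^sup>2)" by (simp add: divide_right_mono)
  qed auto
  also have "\<dots> = (\<integral>\<^sup>+\<omega>. ennreal (1 / weight n \<omega>) \<partial>M) * ennreal (exp ((\<delta> n)\<^sup>2 / (\<sigma> n)\<^sup>2))"
    by (simp add: nn_integral_multc)
  also have "\<dots> \<le> ennreal (exp (\<Sum>j<n. (\<delta> j)\<^sup>2 / (\<sigma> j)\<^sup>2)) * ennreal (exp ((\<delta> n)\<^sup>2 / (\<sigma> n)\<^sup>2))"
    using Suc n by (intro mult_right_mono) auto
  also have "\<dots> = ennreal (exp (\<Sum>j<Suc n. (\<delta> j)\<^sup>2 / (\<sigma> j)\<^sup>2))"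
    by (simp add: ennreal_mult[symmetric] exp_add)
  finally show ?case .
qed

text \<open>Where the weight is not small, it compares the two laws; where it is small, its inverse is large,
which is improbable by \<open>inverse_density_bound\<close>. Both cases are covered by
\<open>1 \<le> a Z + 1 / (a Z)\<close>.\<close>

lemma drift_cost:
  assumes \<delta>: "\<And>j \<omega>. j < N \<Longrightarrow> \<bar>D j \<omega>\<bar> \<le> \<delta> j" and a: "0 < a" and B: "B \<in> sets (Path N)"
  shows "prob {\<omega>\<in>space M. drifted N \<omega> \<in> B} \<le> a * measure (Gauss N) B + exp (\<Sum>j<N. (\<delta> j)\<^sup>2 / (\<sigma> j)\<^sup>2) / a"
proof -
  note [measurable] = weight_measurable_M[of N, simplified] drifted_measurable_M[of N, simplified] B
  interpret gN: prob_space "Gauss N" by (intro prob_space_PiM) (rule prob_space_normal_density[OF \<sigma>_pos])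
  have "ennreal (prob {\<omega>\<in>space M. drifted N \<omega> \<in> B}) = (\<integral>\<^sup>+\<omega>. indicator B (drifted N \<omega>) \<partial>M)"
    by (subst nn_integral_indicator_comp[where L="Path N"]) (auto simp: emeasure_eq_measure)
  also have "\<dots> \<le> (\<integral>\<^sup>+\<omega>. ennreal a * (ennreal (weight N \<omega>) * indicator B (drifted N \<omega>)) + ennreal (1 / a) * ennreal (1 / weight N \<omega>) \<partial>M)"
  proof (rule nn_integral_mono)
    fix \<omega>
    have "1 \<le> a * weight N \<omega> \<or> 1 \<le> (1 / a) * (1 / weight N \<omega>)"
      using a weight_pos[of N \<omega>] by (auto simp: field_simps)
    then have "(1::real) \<le> a * weight N \<omega> + (1 / a) * (1 / weight N \<omega>)"
      using a weight_pos[of N \<omega>] by (auto intro: add_increasing add_increasing2 simp: less_imp_le)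
    then have "(1::ennreal) \<le> ennreal (a * weight N \<omega> + (1 / a) * (1 / weight N \<omega>))" by simp
    also have "\<dots> = ennreal a * ennreal (weight N \<omega>) + ennreal (1 / a) * ennreal (1 / weight N \<omega>)"
      using a weight_pos[of N \<omega>] by (simp add: ennreal_mult[symmetric] less_imp_le flip: ennreal_plus)
    finally show "indicator B (drifted N \<omega>) \<le> ennreal a * (ennreal (weight N \<omega>) * indicator B (drifted N \<omega>)) + ennreal (1 / a) * ennreal (1 / weight N \<omega>)"
      by (auto simp: indicator_def)
  qed
  also have "\<dots> = ennreal a * (\<integral>\<^sup>+\<omega>. ennreal (weight N \<omega>) * indicator B (drifted N \<omega>) \<partial>M) + ennreal (1 / a) * (\<integral>\<^sup>+\<omega>. ennreal (1 / weight N \<omega>) \<partial>M)"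
    by (simp add: nn_integral_add nn_integral_cmult)
  also have "(\<integral>\<^sup>+\<omega>. ennreal (weight N \<omega>) * indicator B (drifted N \<omega>) \<partial>M) = (\<integral>\<^sup>+y. indicator B y \<partial>Gauss N)"
    by (rule discrete_girsanov) auto
  also have "\<dots> = ennreal (measure (Gauss N) B)"
    using B by (simp add: sets_Gauss gN.emeasure_eq_measure)
  also have "ennreal a * ennreal (measure (Gauss N) B) + ennreal (1 / a) * (\<integral>\<^sup>+\<omega>. ennreal (1 / weight N \<omega>) \<partial>M)
     \<le> ennreal a * ennreal (measure (Gauss N) B) + ennreal (1 / a) * ennreal (exp (\<Sum>j<N. (\<delta> j)\<^sup>2 / (\<sigma> j)\<^sup>2))"
    using inverse_density_bound[OF order_refl \<delta>] by (intro add_left_mono mult_left_mono) auto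
  also have "\<dots> = ennreal (a * measure (Gauss N) B + exp (\<Sum>j<N. (\<delta> j)\<^sup>2 / (\<sigma> j)\<^sup>2) / a)"
    using a by (simp add: ennreal_mult[symmetric] flip: ennreal_plus)
  finally show ?thesis
    using a by (subst (asm) ennreal_le_iff) (auto intro!: add_nonneg_nonneg)
qed

end

lemma law_of_steps:
  assumes B: "B \<in> sets (Path N)"
  shows "prob {\<omega>\<in>space M. (\<lambda>j\<in>{..<N}. G j \<omega>) \<in> B} = measure (Gauss N) B"
proof -
  interpret gN: prob_space "Gauss N" by (intro prob_space_PiM) (rule prob_space_normal_density[OF \<sigma>_pos])
  have D0: "\<And>j. j < N \<Longrightarrow> (\<lambda>_. 0 :: real) \<in> borel_measurable (F j)" by simp
  note [measurable] = drifted_measurable_M[OF D0, of N, simplified] B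
  have "ennreal (prob {\<omega>\<in>space M. drifted (\<lambda>_ _. 0) N \<omega> \<in> B}) = (\<integral>\<^sup>+\<omega>. indicator B (drifted (\<lambda>_ _. 0) N \<omega>) \<partial>M)"
    by (subst nn_integral_indicator_comp[where L="Path N"]) (auto simp: emeasure_eq_measure)
  also have "\<dots> = (\<integral>\<^sup>+\<omega>. ennreal (weight (\<lambda>_ _. 0) N \<omega>) * indicator B (drifted (\<lambda>_ _. 0) N \<omega>) \<partial>M)"
    by (simp add: weight_def shift_density_def)
  also have "\<dots> = (\<integral>\<^sup>+y. indicator B y \<partial>Gauss N)"
    by (rule discrete_girsanov[OF D0]) auto
  also have "\<dots> = ennreal (measure (Gauss N) B)"
    using B by (simp add: sets_Gauss gN.emeasure_eq_measure)
  finally show ?thesis by (simp add: drifted_def)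
qed

end

section \<open>The dispersion coefficient on a grid\<close>

lemma dispersion_continuous:
  assumes "dispersion_conditions s"
  shows "continuous_on {0..1} s"
proof -
  obtain L \<alpha> where L: "L > 0" "0 < \<alpha>"
    and H: "\<And>u v. u \<in> {0..1} \<Longrightarrow> v \<in> {0..1} \<Longrightarrow> \<bar>s u - s v\<bar> \<le> L * \<bar>u - v\<bar> powr \<alpha>"
    using assms unfolding dispersion_conditions_def by (auto simp: Bex_def)
  show ?thesis unfolding continuous_on_iff
  proof (intro ballI allI impI)
    fix x e :: real assume x: "x \<in> {0..1}" and e: "0 < e"
    define d where "d = (e / L) powr (1 / \<alpha>)"
    have "0 < d" using e L by (simp add: d_def)
    moreover have "dist (s y) (s x) < e" if y: "y \<in> {0..1}" "dist y x < d" for y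
    proof -
      have "\<bar>y - x\<bar> powr \<alpha> < d powr \<alpha>"
        using y L by (intro powr_less_mono2) (auto simp: dist_real_def)
      also have "\<dots> = e / L" using e L by (simp add: d_def powr_powr)
      finally have "L * \<bar>y - x\<bar> powr \<alpha> < e" using L by (simp add: field_simps)
      with H[OF y(1) x] show ?thesis by (simp add: dist_real_def)
    qed
    ultimately show "\<exists>d>0. \<forall>x'\<in>{0..1}. dist x' x < d \<longrightarrow> dist (s x') (s x) < e" by blast
  qed
qed

text \<open>Outside \<open>[0,1]\<close> the dispersion coefficient is arbitrary; it is set to zero there to obtain a
bounded Borel function on the line.\<close>

lemma dispersion_truncation:
  assumes "dispersion_conditions s"
  defines "f \<equiv> \<lambda>u. indicator {0..1} u * s u"
  obtains \<kappa> C where "0 < \<kappa>" "\<And>u. u \<in> {0..1} \<Longrightarrow> \<kappa> \<le> f u" "\<And>u. \<bar>f u\<bar> \<le> C" "f \<in> borel_measurable borel"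
proof -
  obtain \<kappa> where \<kappa>: "0 < \<kappa>" "\<And>u. u \<in> {0..1} \<Longrightarrow> \<kappa> \<le> s u"
    using assms(1) unfolding dispersion_conditions_def by auto
  have "compact (s ` {0..1})"
    by (intro compact_continuous_image dispersion_continuous assms compact_Icc)
  then have "bounded (s ` {0..1})" by (rule compact_imp_bounded)
  then obtain C where "\<forall>y\<in>s ` {0..1}. norm y \<le> C" unfolding bounded_iff by blast
  then have C: "\<bar>s u\<bar> \<le> C" if "u \<in> {0..1}" for u using that by auto
  have "0 \<le> C" using C[of 0] by auto
  show ?thesis
  proof (rule that[of \<kappa> C])
    show "\<bar>f u\<bar> \<le> C" for u using C[of u] \<open>0 \<le> C\<close> by (auto simp: f_def indicator_def)
    show "f \<in> borel_measurable borel"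
      using borel_measurable_continuous_on_indicator[OF _ dispersion_continuous[OF assms(1)]]
      by (simp add: f_def)
  qed (use \<kappa> in \<open>auto simp: f_def\<close>)
qed

lemma is_wiener_integral_cong:
  assumes "\<And>u. u \<in> {0..t} \<Longrightarrow> f u = g u"
  shows "is_wiener_integral M W f t Z \<longleftrightarrow> is_wiener_integral M W g t Z"
proof -
  have "(\<integral>\<^sup>+u\<in>{0..t}. ennreal ((f u - h u)\<^sup>2) \<partial>lborel) = (\<integral>\<^sup>+u\<in>{0..t}. ennreal ((g u - h u)\<^sup>2) \<partial>lborel)" for h
    using assms by (intro nn_integral_cong) (auto simp: indicator_def)
  then show ?thesis unfolding is_wiener_integral_def by simp
qed

text \<open>The standard deviation of the noise in cell \<open>j\<close>. The value \<open>1\<close> past the last cell is a default that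
keeps it positive.\<close>

definition grid_sd :: "(real \<Rightarrow> real) \<Rightarrow> nat \<Rightarrow> nat \<Rightarrow> real" where
  "grid_sd f N j = (if j < N then sqrt (LINT u:{grid N j<..grid N (Suc j)}|lborel. (f u)\<^sup>2) else 1)"

lemma grid_mem: "0 < N \<Longrightarrow> j \<le> N \<Longrightarrow> grid N j \<in> {0..1}"
  by (auto simp: grid_def)

lemma grid_mono: "i \<le> j \<Longrightarrow> grid N i \<le> grid N j"
  by (auto simp: grid_def divide_right_mono)

lemma grid_Suc: "grid N (Suc j) = grid N j + 1 / N"
  by (simp add: grid_def add_divide_distrib)

lemma grid_mult: "0 < k \<Longrightarrow> grid (n * k) (i * k) = grid n i"
  by (simp add: grid_def)

lemma grid_variance_ge:
  assumes f[measurable]: "f \<in> borel_measurable borel" and bound: "\<And>u. \<bar>f u\<bar> \<le> C"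
    and \<kappa>: "0 < \<kappa>" "\<And>u. u \<in> {0..1} \<Longrightarrow> \<kappa> \<le> f u" and j: "j < N"
  shows "\<kappa>\<^sup>2 / N \<le> (LINT u:{grid N j<..grid N (Suc j)}|lborel. (f u)\<^sup>2)"
proof -
  let ?S = "{grid N j<..grid N (Suc j)}"
  have S01: "u \<in> {0..1}" if "u \<in> ?S" for u
    using that grid_mem[of N j] grid_mem[of N "Suc j"] j by auto
  have le: "grid N j \<le> grid N (Suc j)" by (rule grid_mono) simp
  have int: "integrable lborel (\<lambda>u. indicator ?S u * c)" for c :: real
    using le by (intro integrable_mult_left) auto
  have "\<kappa>\<^sup>2 / N = (\<integral>u. indicator ?S u * \<kappa>\<^sup>2 \<partial>lborel)"
    using le by (simp add: grid_Suc)
  also have "\<dots> \<le> (\<integral>u. indicator ?S u * (f u)\<^sup>2 \<partial>lborel)"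
  proof (rule integral_mono[OF int])
    show "integrable lborel (\<lambda>u. indicator ?S u * (f u)\<^sup>2)"
    proof (rule Bochner_Integration.integrable_bound[OF int[of "C\<^sup>2"]])
      show "AE u in lborel. norm (indicator ?S u * (f u)\<^sup>2) \<le> norm (indicator ?S u * C\<^sup>2)"
        using order_trans[OF bound abs_ge_self] by (intro AE_I2) (auto simp: indicator_def abs_le_square_iff[symmetric])
    qed simp
    show "indicator ?S u * \<kappa>\<^sup>2 \<le> indicator ?S u * (f u)\<^sup>2" for u
      using \<kappa> S01[of u] by (auto simp: indicator_def intro!: power_mono)
  qed
  finally show ?thesis by (simp add: set_lebesgue_integral_def)
qed

lemma (in wiener) wiener_gaussian_steps:
  assumes f: "f \<in> borel_measurable borel" "\<And>u. \<bar>f u\<bar> \<le> C"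
    and \<kappa>: "0 < \<kappa>" "\<And>u. u \<in> {0..1} \<Longrightarrow> \<kappa> \<le> f u"
    and I: "\<And>t. t \<in> {0..1} \<Longrightarrow> is_wiener_integral M W f t (I t)"
    and N: "0 < N"
  shows "gaussian_steps M (\<lambda>j. \<F> (grid N j)) (\<lambda>j \<omega>. I (grid N (Suc j)) \<omega> - I (grid N j) \<omega>) (grid_sd f N) N"
proof unfold_locales
  note mem = grid_mem[OF N]
  show "subalgebra M (\<F> (grid N j))" if "j \<le> N" for j
    using that by (intro filtration_subalgebra mem)
  show "subalgebra (\<F> (grid N j)) (\<F> (grid N i))" if "i \<le> j" for i j
    using that by (intro filtration_mono grid_mono)
  show "(\<lambda>\<omega>. I (grid N (Suc j)) \<omega> - I (grid N j) \<omega>) \<in> borel_measurable (\<F> (grid N (Suc j)))" if "j < N" for j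
  proof (rule borel_measurable_diff)
    show "I (grid N (Suc j)) \<in> borel_measurable (\<F> (grid N (Suc j)))"
      using that by (intro wiener_integral_adapted[OF _ I] mem) auto
    have "I (grid N j) \<in> borel_measurable (\<F> (grid N j))"
      using that by (intro wiener_integral_adapted[OF _ I] mem) auto
    then show "I (grid N j) \<in> borel_measurable (\<F> (grid N (Suc j)))"
      by (rule measurable_from_subalg[OF filtration_mono[OF grid_mono], rotated]) simp
  qed
  have var: "0 < (LINT u:{grid N j<..grid N (Suc j)}|lborel. (f u)\<^sup>2)" if "j < N" for j
    using grid_variance_ge[OF f \<kappa> that] N \<kappa> by (smt (verit) divide_pos_pos of_nat_0_less_iff zero_less_power)
  then show "0 < grid_sd f N j" for j by (simp add: grid_sd_def)
  fix j A B assume j: "j < N" and A: "A \<in> sets (\<F> (grid N j))" and B: "B \<in> sets (borel :: real measure)"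
  have m: "grid N j \<in> {0..1}" "grid N (Suc j) \<in> {0..1}" using mem[of j] mem[of "Suc j"] j by auto
  show "prob (A \<inter> ((\<lambda>\<omega>. I (grid N (Suc j)) \<omega> - I (grid N j) \<omega>) -` B \<inter> space M)) =
      prob A * measure (gaussian (grid_sd f N j)) B"
    using wiener_increment_indep_normal[OF _ _ _ f I[OF m(1)] I[OF m(2)] var[OF j] A B] m j
    by (simp add: grid_sd_def grid_mono)
qed

section \<open>Freezing the drift\<close>

text \<open>Clipping the state, rather than the drift, keeps the drift Lipschitz and makes it bounded at once.\<close>

definition clip :: "real \<Rightarrow> real \<Rightarrow> real" where "clip r x = max (- r) (min r x)"

text \<open>The drift accumulated in cell \<open>j\<close> by a path that rests at the clipped value of \<open>x\<close>: evaluated at the value of the process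
at the left end of the cell, it is known when the cell begins. The integral over time
is kept because the drift is merely measurable in time.\<close>

definition frozen_drift :: "(real \<Rightarrow> real \<Rightarrow> real) \<Rightarrow> real \<Rightarrow> nat \<Rightarrow> nat \<Rightarrow> real \<Rightarrow> real" where
  "frozen_drift b r N j x = (LINT u:{grid N j<..grid N (Suc j)}|lborel. b u (clip r x))"

lemma clip_lipschitz: "\<bar>clip r x - clip r y\<bar> \<le> \<bar>x - y\<bar>"
  by (auto simp: clip_def max_def min_def)

lemma clip_bound: "0 \<le> r \<Longrightarrow> \<bar>clip r x\<bar> \<le> r"
  by (auto simp: clip_def max_def min_def)

lemma clip_id: "\<bar>x\<bar> \<le> r \<Longrightarrow> clip r x = x"
  by (auto simp: clip_def max_def min_def)

lemma set_integral_abs_le: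
  fixes h :: "real \<Rightarrow> real"
  assumes "set_integrable lborel {a<..b} h" "a \<le> b" "\<And>u. u \<in> {a<..b} \<Longrightarrow> \<bar>h u\<bar> \<le> c"
  shows "\<bar>LINT u:{a<..b}|lborel. h u\<bar> \<le> c * (b - a)"
proof -
  have "\<bar>LINT u:{a<..b}|lborel. h u\<bar> \<le> (\<integral>u. indicator {a<..b} u * c \<partial>lborel)"
    unfolding set_lebesgue_integral_def
  proof (rule integral_abs_bound_integral)
    show "integrable lborel (\<lambda>u. indicator {a<..b} u *\<^sub>R h u)" using assms(1) by (simp add: set_integrable_def)
    show "integrable lborel (\<lambda>u. indicator {a<..b} u * c)" using assms(2) by (intro integrable_mult_left) auto
    show "\<bar>indicator {a<..b} u *\<^sub>R h u\<bar> \<le> indicator {a<..b} u * c" for u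
      using assms(3)[of u] by (auto simp: indicator_def)
  qed
  then show ?thesis using assms(2) by (simp add: mult.commute)
qed

locale drift =
  fixes b :: "real \<Rightarrow> real \<Rightarrow> real" and K :: real
  assumes b_measurable: "(\<lambda>(t, x). b t x) \<in> borel_measurable (restrict_space borel {0..1} \<Otimes>\<^sub>M borel)"
    and K: "0 < K"
    and growth: "\<And>t x. t \<in> {0..1} \<Longrightarrow> \<bar>b t x\<bar>\<^sup>2 \<le> K * (1 + x\<^sup>2)"
    and lipschitz: "\<And>t x y. t \<in> {0..1} \<Longrightarrow> \<bar>b t x - b t y\<bar> \<le> K * \<bar>x - y\<bar>"
begin

definition bmax :: "real \<Rightarrow> real" where "bmax r = sqrt (K * (1 + r\<^sup>2))"

lemma bmax_bound:
  assumes "t \<in> {0..1}" "\<bar>x\<bar> \<le> r"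
  shows "\<bar>b t x\<bar> \<le> bmax r"
proof -
  have "x\<^sup>2 \<le> r\<^sup>2" using assms(2) by (subst abs_le_square_iff[symmetric]) auto
  then have "K * (1 + x\<^sup>2) \<le> K * (1 + r\<^sup>2)" using K by (intro mult_left_mono) auto
  with growth[OF assms(1), of x] have "\<bar>b t x\<bar>\<^sup>2 \<le> K * (1 + r\<^sup>2)" by simp
  then show ?thesis unfolding bmax_def by (rule real_le_rsqrt)
qed

lemma b_integrable:
  assumes S: "{p<..q} \<subseteq> {0..1}"
  shows "set_integrable lborel {p<..q} (\<lambda>u. b u c)"
proof -
  have "(\<lambda>u. b u c) \<in> borel_measurable (restrict_space borel {0..1})"
    using measurable_compose[OF measurable_Pair2'[of c borel "restrict_space borel {0..1}"] b_measurable]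
    by simp
  then have m: "(\<lambda>u. indicator {0..1} u *\<^sub>R b u c) \<in> borel_measurable borel"
    by (simp add: borel_measurable_restrict_space_iff)
  have "set_integrable lborel {0..1} (\<lambda>u. b u c)"
    unfolding set_integrable_def
  proof (rule Bochner_Integration.integrable_bound)
    show "integrable lborel (\<lambda>u. indicator {0..1::real} u * bmax \<bar>c\<bar>)"
      by (intro integrable_mult_left) auto
    show "(\<lambda>u. indicator {0..1} u *\<^sub>R b u c) \<in> borel_measurable lborel" using m by simp
    show "AE u in lborel. norm (indicator {0..1} u *\<^sub>R b u c) \<le> norm (indicator {0..1} u * bmax \<bar>c\<bar>)"
      using order_trans[OF bmax_bound[of _ c "\<bar>c\<bar>"] abs_ge_self]
      by (intro AE_I2) (auto simp: indicator_def)
  qed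
  then show ?thesis by (rule set_integrable_subset) (use S in auto)
qed

lemma grid_cell: "j < N \<Longrightarrow> {grid N j<..grid N (Suc j)} \<subseteq> {0..1}"
  using grid_mem[of N j] grid_mem[of N "Suc j"] by auto

lemma frozen_drift_bound:
  assumes "j < N" "0 \<le> r"
  shows "\<bar>frozen_drift b r N j x\<bar> \<le> bmax r / N"
proof -
  have "\<bar>frozen_drift b r N j x\<bar> \<le> bmax r * (grid N (Suc j) - grid N j)"
    unfolding frozen_drift_def using grid_cell[OF assms(1)] clip_bound[OF assms(2)]
    by (intro set_integral_abs_le b_integrable grid_mono bmax_bound) auto
  then show ?thesis by (simp add: grid_Suc)
qed

lemma frozen_drift_measurable:
  assumes "j < N"
  shows "frozen_drift b r N j \<in> borel_measurable borel"
proof (rule borel_measurable_continuous_onI)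
  have "\<bar>frozen_drift b r N j x - frozen_drift b r N j y\<bar> \<le> K / N * \<bar>x - y\<bar>" for x y
  proof -
    have "frozen_drift b r N j x - frozen_drift b r N j y =
      (LINT u:{grid N j<..grid N (Suc j)}|lborel. b u (clip r x) - b u (clip r y))"
      unfolding frozen_drift_def using b_integrable[OF grid_cell[OF assms]]
      by (intro set_integral_diff(2)[symmetric])
    also have "\<bar>\<dots>\<bar> \<le> (K * \<bar>x - y\<bar>) * (grid N (Suc j) - grid N j)"
    proof (rule set_integral_abs_le)
      fix u assume "u \<in> {grid N j<..grid N (Suc j)}"
      then have u: "u \<in> {0..1}" using grid_cell[OF assms] by auto
      show "\<bar>b u (clip r x) - b u (clip r y)\<bar> \<le> K * \<bar>x - y\<bar>"
        using lipschitz[OF u, of "clip r x" "clip r y"] mult_left_mono[OF clip_lipschitz[of r x y], of K] K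
        by linarith
    qed (use b_integrable[OF grid_cell[OF assms]] in \<open>auto simp: grid_Suc\<close>)
    finally show ?thesis by (simp add: grid_Suc)
  qed
  then have "(K / N)-lipschitz_on UNIV (frozen_drift b r N j)"
    using K by (intro lipschitz_onI) (auto simp: dist_real_def)
  then show "continuous_on UNIV (frozen_drift b r N j)" by (rule lipschitz_on_continuous_on)
qed

text \<open>In each cell the integrands differ by at most \<open>K\<close> times the oscillation of the path over the cell.\<close>

lemma frozen_drift_sum_error:
  assumes N: "0 < N" and int: "set_integrable lborel {0..1} (\<lambda>u. b u (x u))"
    and bd: "\<And>j. j \<le> N \<Longrightarrow> \<bar>x (grid N j)\<bar> \<le> r"
    and osc: "\<And>u v. u \<in> {0..1} \<Longrightarrow> v \<in> {0..1} \<Longrightarrow> \<bar>u - v\<bar> \<le> 1 / N \<Longrightarrow> \<bar>x u - x v\<bar> \<le> \<eta>"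
    and J: "J \<le> N"
  shows "\<bar>(\<Sum>j<J. frozen_drift b r N j (x (grid N j))) - (LINT u:{0..grid N J}|lborel. b u (x u))\<bar> \<le> K * \<eta> * grid N J"
  using J
proof (induction J)
  case 0
  have "(LINT u:{0}|lborel. b u (x u)) = 0"
    unfolding set_lebesgue_integral_def
    by (rule integral_eq_zero_AE) (use AE_lborel_singleton[of 0] in \<open>auto elim!: eventually_mono\<close>)
  then show ?case by (simp add: grid_def)
next
  case (Suc J)
  let ?c = "{grid N J<..grid N (Suc J)}"
  have J: "J < N" using Suc by simp
  have sub: "?c \<subseteq> {0..1}" by (rule grid_cell[OF J])
  have g: "grid N J \<in> {0..1}" using J by (intro grid_mem) auto
  have le: "grid N J \<le> grid N (Suc J)" by (rule grid_mono) simp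
  have ic: "set_integrable lborel ?c (\<lambda>u. b u (x u))"
    using int by (rule set_integrable_subset) (use sub in auto)
  have i0: "set_integrable lborel {0..grid N J} (\<lambda>u. b u (x u))"
    using int by (rule set_integrable_subset) (use g in auto)
  have "{0..grid N (Suc J)} = {0..grid N J} \<union> ?c" using g le by auto
  then have split: "(LINT u:{0..grid N (Suc J)}|lborel. b u (x u)) =
      (LINT u:{0..grid N J}|lborel. b u (x u)) + (LINT u:?c|lborel. b u (x u))"
    by (simp only:) (rule set_integral_Un[OF ivl_disj_int_two(8) i0 ic])
  have "frozen_drift b r N J (x (grid N J)) = (LINT u:?c|lborel. b u (x (grid N J)))"
    unfolding frozen_drift_def using bd[of J] J by (simp add: clip_id)
  then have "frozen_drift b r N J (x (grid N J)) - (LINT u:?c|lborel. b u (x u))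
     = (LINT u:?c|lborel. b u (x (grid N J)) - b u (x u))"
    unfolding set_integral_diff(2)[OF b_integrable[OF sub] ic] by simp
  also have "\<bar>\<dots>\<bar> \<le> (K * \<eta>) * (grid N (Suc J) - grid N J)"
  proof (rule set_integral_abs_le)
    fix u assume u: "u \<in> ?c"
    then have u01: "u \<in> {0..1}" using sub by auto
    have "\<bar>x (grid N J) - x u\<bar> \<le> \<eta>" using u by (intro osc[OF g u01]) (auto simp: grid_Suc)
    then have "K * \<bar>x (grid N J) - x u\<bar> \<le> K * \<eta>" using K by (intro mult_left_mono) auto
    with lipschitz[OF u01] show "\<bar>b u (x (grid N J)) - b u (x u)\<bar> \<le> K * \<eta>" by (rule order_trans)
  qed (use b_integrable[OF sub] ic le in auto)
  finally have "\<bar>frozen_drift b r N J (x (grid N J)) - (LINT u:?c|lborel. b u (x u))\<bar> \<le> K * \<eta> * (grid N (Suc J) - grid N J)" .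
  with Suc.IH J have "\<bar>(\<Sum>j<Suc J. frozen_drift b r N j (x (grid N j))) - (LINT u:{0..grid N (Suc J)}|lborel. b u (x u))\<bar>
     \<le> K * \<eta> * grid N J + K * \<eta> * (grid N (Suc J) - grid N J)"
    unfolding split by simp
  also have "\<dots> = K * \<eta> * grid N (Suc J)" by (simp add: algebra_simps)
  finally show ?case .
qed

lemma frozen_drift_sum_tendsto:
  assumes n: "0 < n" and i: "i \<le> n" and cont: "continuous_on {0..1} x"
    and int: "set_integrable lborel {0..1} (\<lambda>u. b u (x u))"
    and bd: "\<And>N j. 0 < N \<Longrightarrow> j \<le> N \<Longrightarrow> \<bar>x (grid N j)\<bar> \<le> r"
  shows "(\<lambda>k. \<Sum>j<i * Suc k. frozen_drift b r (n * Suc k) j (x (grid (n * Suc k) j)))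
     \<longlonglongrightarrow> (LINT u:{0..grid n i}|lborel. b u (x u))"
proof (rule tendstoI)
  fix e :: real assume e: "0 < e"
  define \<eta> where "\<eta> = e / (2 * K)"
  have \<eta>: "0 < \<eta>" using e K by (simp add: \<eta>_def)
  have "uniformly_continuous_on {0..1} x" using cont by (intro compact_uniformly_continuous) auto
  then obtain d where d: "0 < d" "\<And>u v. u \<in> {0..1} \<Longrightarrow> v \<in> {0..1} \<Longrightarrow> \<bar>u - v\<bar> < d \<Longrightarrow> \<bar>x u - x v\<bar> < \<eta>"
    using \<eta> unfolding uniformly_continuous_on_def dist_real_def by metis
  obtain k0 where k0: "1 / real (Suc k0) < d" using nat_approx_posE[OF d(1)] by blast
  show "\<forall>\<^sub>F k in sequentially. dist (\<Sum>j<i * Suc k. frozen_drift b r (n * Suc k) j (x (grid (n * Suc k) j)))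
     (LINT u:{0..grid n i}|lborel. b u (x u)) < e"
    using eventually_ge_at_top[of k0]
  proof eventually_elim
    case (elim k)
    let ?N = "n * Suc k"
    have N: "0 < ?N" using n by simp
    have "real (Suc k0) \<le> real ?N" using elim n by (metis Suc_le_mono le_trans mult_le_mono1 nat_mult_1 of_nat_le_iff Suc_leI One_nat_def)
    then have "1 / real ?N \<le> 1 / real (Suc k0)" by (intro divide_left_mono) (use N in auto)
    then have fine: "1 / real ?N < d" using k0 by linarith
    have iN: "i * Suc k \<le> ?N" using i by (rule mult_le_mono1)
    have "\<bar>(\<Sum>j<i * Suc k. frozen_drift b r ?N j (x (grid ?N j))) - (LINT u:{0..grid ?N (i * Suc k)}|lborel. b u (x u))\<bar>
       \<le> K * \<eta> * grid ?N (i * Suc k)"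
    proof (rule frozen_drift_sum_error[OF N int bd[OF N] _ iN])
      fix u v :: real assume "u \<in> {0..1}" "v \<in> {0..1}" "\<bar>u - v\<bar> \<le> 1 / real ?N"
      then show "\<bar>x u - x v\<bar> \<le> \<eta>" using fine by (intro less_imp_le d(2)) auto
    qed
    also have "\<dots> \<le> K * \<eta> * 1"
      using grid_mem[OF N iN] K \<eta> by (intro mult_left_mono) auto
    also have "\<dots> < e" using e K by (simp add: \<eta>_def)
    finally show ?case using grid_mult[of "Suc k" n i] by (simp only: dist_real_def zero_less_Suc)
  qed
qed

end

section \<open>Comparison of the laws of the observations\<close>

lemma open_coordinatewise_eventually:
  fixes x :: "nat \<Rightarrow> real" and y :: "nat \<Rightarrow> nat \<Rightarrow> real"
  assumes "\<And>i. (\<lambda>k. y k i) \<longlonglongrightarrow> x i" "open U" "x \<in> U"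
  shows "\<forall>\<^sub>F k in sequentially. y k \<in> U"
proof -
  have "limitin (product_topology (\<lambda>i. euclidean) UNIV) y x sequentially"
    using assms(1) by (subst limitin_componentwise) auto
  then have "(y \<longlongrightarrow> x) sequentially"
    unfolding euclidean_product_topology by simp
  then show ?thesis using assms(2,3) by (rule topological_tendstoD)
qed

text \<open>The observed vector, padded with zeros: all sample sizes then share the Polish space of real
sequences, where finite measures are outer regular.\<close>

definition sampled :: "nat \<Rightarrow> (real \<Rightarrow> 'a \<Rightarrow> real) \<Rightarrow> 'a \<Rightarrow> nat \<Rightarrow> real" where
  "sampled n X \<omega> i = (if i \<le> n then X (grid n i) \<omega> else 0)"

text \<open>Positions at the observation times of a path with \<open>k\<close> steps between two observations.\<close>

definition partial_sums :: "nat \<Rightarrow> nat \<Rightarrow> (nat \<Rightarrow> real) \<Rightarrow> nat \<Rightarrow> real" where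
  "partial_sums n k y i = (if i \<le> n then \<Sum>j<i * k. y j else 0)"

lemma partial_sums_measurable:
  "partial_sums n k \<in> borel_measurable (Pi\<^sub>M {..<n * k} (\<lambda>_. borel))"
proof (rule measurable_coordinatewise_then_product)
  fix i
  have "(\<lambda>y. \<Sum>j<i * k. y j) \<in> borel_measurable (Pi\<^sub>M {..<n * k} (\<lambda>_. borel :: real measure))" if "i \<le> n"
    using mult_le_mono1[OF that, of k]
    by (intro borel_measurable_sum measurable_component_singleton) (auto intro: less_le_trans)
  then show "(\<lambda>y. partial_sums n k y i) \<in> borel_measurable (Pi\<^sub>M {..<n * k} (\<lambda>_. borel))"
    unfolding partial_sums_def by (cases "i \<le> n") simp_all
qed

lemma sampled_measurable:
  assumes "0 < n" "\<And>t. t \<in> {0..1} \<Longrightarrow> X t \<in> borel_measurable M"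
  shows "sampled n X \<in> borel_measurable M"
  unfolding sampled_def[abs_def]
proof (rule measurable_coordinatewise_then_product)
  show "(\<lambda>\<omega>. if i \<le> n then X (grid n i) \<omega> else 0) \<in> borel_measurable M" for i
    using assms(2)[OF grid_mem[OF assms(1)], of i] by (cases "i \<le> n") simp_all
qed

context wiener
begin

lemma strong_solution_measurable:
  assumes "strong_solution M W b s X" "t \<in> {0..1}"
  shows "X t \<in> borel_measurable (\<F> t)" "X t \<in> borel_measurable M"
proof -
  show *: "X t \<in> borel_measurable (\<F> t)"
    using assms by (auto simp: strong_solution_def \<F>_def)
  show "X t \<in> borel_measurable M"
    using measurable_from_subalg[OF filtration_subalgebra[OF assms(2)] *] .
qed

text \<open>Subtracting the integral over \<open>[0,0]\<close>, which vanishes almost surely, makes the noise term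
telescope over the cells of a grid.\<close>

lemma strong_solution_integral:
  assumes sol: "strong_solution M W b s X" and f: "\<And>u. u \<in> {0..1} \<Longrightarrow> f u = s u"
  shows "\<exists>I. (\<forall>t\<in>{0..1}. is_wiener_integral M W f t (I t)) \<and>
    (AE \<omega> in M. \<forall>t\<in>{0..1}. X t \<omega> = (LINT u:{0..t}|lborel. b u (X u \<omega>)) + (I t \<omega> - I 0 \<omega>))"
proof -
  obtain I where I: "\<And>t. t \<in> {0..1} \<Longrightarrow> is_wiener_integral M W s t (I t)"
    and ae: "AE \<omega> in M. \<forall>t\<in>{0..1}. X t \<omega> = (LINT u:{0..t}|lborel. b u (X u \<omega>)) + I t \<omega>"
    and X0: "AE \<omega> in M. X 0 \<omega> = 0"
    using sol unfolding strong_solution_def by blast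
  show ?thesis
  proof (intro exI[of _ I] conjI ballI)
    show "is_wiener_integral M W f t (I t)" if "t \<in> {0..1}" for t
      using I[OF that] f that by (subst is_wiener_integral_cong[of _ _ s]) auto
    show "AE \<omega> in M. \<forall>t\<in>{0..1}. X t \<omega> = (LINT u:{0..t}|lborel. b u (X u \<omega>)) + (I t \<omega> - I 0 \<omega>)"
      using ae X0
    proof eventually_elim
      case (elim \<omega>)
      have "(LINT u:{0..0}|lborel. b u (X u \<omega>)) = 0"
        unfolding set_lebesgue_integral_def
        by (rule integral_eq_zero_AE) (use AE_lborel_singleton[of 0] in \<open>auto elim!: eventually_mono\<close>)
      then have "I 0 \<omega> = 0" using elim by force
      with elim(1) show ?case by simp
    qed
  qed
qed

lemma driftless_law:
  assumes f: "f \<in> borel_measurable borel" "\<And>u. \<bar>f u\<bar> \<le> C"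
    and \<kappa>: "0 < \<kappa>" "\<And>u. u \<in> {0..1} \<Longrightarrow> \<kappa> \<le> f u"
    and sol: "strong_solution M W (\<lambda>_ _. 0) s X" and fs: "\<And>u. u \<in> {0..1} \<Longrightarrow> f u = s u"
    and n: "0 < n" and k: "0 < k" and B: "B \<in> sets borel"
  shows "prob {\<omega>\<in>space M. sampled n X \<omega> \<in> B} =
    measure (Pi\<^sub>M {..<n * k} (\<lambda>j. gaussian (grid_sd f (n * k) j)))
      (partial_sums n k -` B \<inter> space (Pi\<^sub>M {..<n * k} (\<lambda>_. borel)))"
proof -
  obtain I where I: "\<And>t. t \<in> {0..1} \<Longrightarrow> is_wiener_integral M W f t (I t)"
    and ae: "AE \<omega> in M. \<forall>t\<in>{0..1}. X t \<omega> = (LINT u:{0..t}|lborel. 0) + (I t \<omega> - I 0 \<omega>)"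
    using strong_solution_integral[OF sol, of f] fs by blast
  let ?N = "n * k"
  have N: "0 < ?N" using n k by simp
  interpret S: gaussian_steps M "\<lambda>j. \<F> (grid ?N j)" "\<lambda>j \<omega>. I (grid ?N (Suc j)) \<omega> - I (grid ?N j) \<omega>" "grid_sd f ?N" ?N
    by (rule wiener_gaussian_steps[OF f \<kappa> I N])
  let ?B = "partial_sums n k -` B \<inter> space (Pi\<^sub>M {..<?N} (\<lambda>_. borel))"
  let ?G = "\<lambda>\<omega>. \<lambda>j\<in>{..<?N}. I (grid ?N (Suc j)) \<omega> - I (grid ?N j) \<omega>"
  have Bm: "?B \<in> sets (Pi\<^sub>M {..<?N} (\<lambda>_. borel))"
    using partial_sums_measurable B by (rule measurable_sets)
  have Gm: "?G \<in> measurable M (Pi\<^sub>M {..<?N} (\<lambda>_. borel))"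
    using S.G_measurable_M by (intro measurable_restrict) auto
  have "AE \<omega> in M. sampled n X \<omega> = partial_sums n k (?G \<omega>)"
    using ae
  proof eventually_elim
    case (elim \<omega>)
    have "(\<Sum>j<i * k. ?G \<omega> j) = X (grid n i) \<omega>" if "i \<le> n" for i
    proof -
      have "(\<Sum>j<i * k. ?G \<omega> j) = (\<Sum>j<i * k. I (grid ?N (Suc j)) \<omega> - I (grid ?N j) \<omega>)"
        using mult_le_mono1[OF that, of k] by (intro sum.cong refl) (simp add: less_le_trans)
      also have "\<dots> = I (grid n i) \<omega> - I 0 \<omega>"
        by (subst sum_lessThan_telescope) (simp add: grid_mult[OF k], simp add: grid_def)
      also have "\<dots> = X (grid n i) \<omega>" using elim grid_mem[OF n that] by simp
      finally show ?thesis .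
    qed
    then show ?case by (auto simp: fun_eq_iff sampled_def partial_sums_def)
  qed
  moreover have "sampled n X \<in> borel_measurable M"
    using n strong_solution_measurable(2)[OF sol] by (rule sampled_measurable)
  ultimately have "prob {\<omega>\<in>space M. sampled n X \<omega> \<in> B} = prob {\<omega>\<in>space M. ?G \<omega> \<in> ?B}"
    using B measurable_sets[OF Gm Bm] measurable_space[OF Gm]
    by (intro finite_measure_eq_AE)
      (auto elim!: eventually_mono simp: vimage_def Int_def conj_commute intro: measurable_sets_borel)
  also have "\<dots> = measure (Pi\<^sub>M {..<?N} (\<lambda>j. gaussian (grid_sd f ?N j))) ?B"
    by (rule S.law_of_steps[OF Bm])
  finally show ?thesis .
qed

text \<open>The bound is free of \<open>N\<close>: each of the \<open>N\<close> cells costs \<open>(c / N)\<^sup>2\<close> divided by a variance of at least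
\<open>\<kappa>\<^sup>2 / N\<close>, where \<open>c\<close> bounds the clipped drift.\<close>

lemma frozen_law_bound:
  assumes f: "f \<in> borel_measurable borel" "\<And>u. \<bar>f u\<bar> \<le> C"
    and \<kappa>: "0 < \<kappa>" "\<And>u. u \<in> {0..1} \<Longrightarrow> \<kappa> \<le> f u"
    and I: "\<And>t. t \<in> {0..1} \<Longrightarrow> is_wiener_integral M W f t (I t)"
    and X: "\<And>t. t \<in> {0..1} \<Longrightarrow> X t \<in> borel_measurable (\<F> t)"
    and b: "drift b K" and r: "0 \<le> r"
    and N: "0 < N" and a: "0 < a" and B: "B \<in> sets (Pi\<^sub>M {..<N} (\<lambda>_. borel))"
  defines "Y \<equiv> \<lambda>\<omega>. \<lambda>j\<in>{..<N}. frozen_drift b r N j (X (grid N j) \<omega>) + (I (grid N (Suc j)) \<omega> - I (grid N j) \<omega>)"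
  shows "Y \<in> measurable M (Pi\<^sub>M {..<N} (\<lambda>_. borel))"
    and "prob {\<omega>\<in>space M. Y \<omega> \<in> B} \<le> a * measure (Pi\<^sub>M {..<N} (\<lambda>j. gaussian (grid_sd f N j))) B
       + exp ((drift.bmax K r)\<^sup>2 / \<kappa>\<^sup>2) / a"
proof -
  interpret drift b K by fact
  interpret S: gaussian_steps M "\<lambda>j. \<F> (grid N j)" "\<lambda>j \<omega>. I (grid N (Suc j)) \<omega> - I (grid N j) \<omega>" "grid_sd f N" N
    by (rule wiener_gaussian_steps[OF f \<kappa> I N])
  define D where "D j \<omega> = frozen_drift b r N j (X (grid N j) \<omega>)" for j \<omega>
  have D: "D j \<in> borel_measurable (\<F> (grid N j))" if "j < N" for j
    unfolding D_def using that
    by (intro measurable_compose[OF X[OF grid_mem] frozen_drift_measurable] N) auto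
  have D_bound: "\<bar>D j \<omega>\<bar> \<le> bmax r / N" if "j < N" for j \<omega>
    unfolding D_def using frozen_drift_bound[OF that r] .
  have Y: "Y = S.drifted D N"
    using S.drifted_def[OF D] by (auto simp: Y_def D_def fun_eq_iff)
  show "Y \<in> measurable M (Pi\<^sub>M {..<N} (\<lambda>_. borel))"
    unfolding Y by (rule S.drifted_measurable_M[OF D]) auto
  have "prob {\<omega>\<in>space M. Y \<omega> \<in> B} \<le> a * measure (Pi\<^sub>M {..<N} (\<lambda>j. gaussian (grid_sd f N j))) B
     + exp (\<Sum>j<N. (bmax r / N)\<^sup>2 / (grid_sd f N j)\<^sup>2) / a"
    unfolding Y by (rule S.drift_cost[OF D D_bound a B])
  also have "(\<Sum>j<N. (bmax r / N)\<^sup>2 / (grid_sd f N j)\<^sup>2) \<le> (\<Sum>j<N. (bmax r)\<^sup>2 / \<kappa>\<^sup>2 / N)"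
  proof (rule sum_mono)
    fix j assume "j \<in> {..<N}"
    then have j: "j < N" by simp
    have "\<kappa>\<^sup>2 / N \<le> (grid_sd f N j)\<^sup>2"
    proof -
      note ge = grid_variance_ge[OF f \<kappa> j]
      have "0 \<le> \<kappa>\<^sup>2 / N" by simp
      with ge have "0 \<le> (LINT u:{grid N j<..grid N (Suc j)}|lborel. (f u)\<^sup>2)" by (rule order_trans[rotated])
      with ge show ?thesis using j by (simp add: grid_sd_def)
    qed
    then have "(bmax r / N)\<^sup>2 / (grid_sd f N j)\<^sup>2 \<le> (bmax r / N)\<^sup>2 / (\<kappa>\<^sup>2 / N)"
      using \<kappa> N by (intro divide_left_mono mult_pos_pos) (use S.\<sigma>_pos[of j] in auto)
    also have "\<dots> = (bmax r)\<^sup>2 / \<kappa>\<^sup>2 / N"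
      using N by (simp add: power_divide power2_eq_square)
    finally show "(bmax r / N)\<^sup>2 / (grid_sd f N j)\<^sup>2 \<le> (bmax r)\<^sup>2 / \<kappa>\<^sup>2 / N" .
  qed
  also have "(\<Sum>j<N. (bmax r)\<^sup>2 / \<kappa>\<^sup>2 / N) = (bmax r)\<^sup>2 / \<kappa>\<^sup>2" using N by simp
  finally show "prob {\<omega>\<in>space M. Y \<omega> \<in> B} \<le> a * measure (Pi\<^sub>M {..<N} (\<lambda>j. gaussian (grid_sd f N j))) B
       + exp ((bmax r)\<^sup>2 / \<kappa>\<^sup>2) / a"
    using a by (simp add: divide_right_mono)
qed

text \<open>The event on which clipping at \<open>r\<close> is inactive at all grid points. Grid points
suffice, as the frozen drift reads the path nowhere else, and keep the event measurable.\<close>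

definition grid_bounded :: "(real \<Rightarrow> 'a \<Rightarrow> real) \<Rightarrow> real \<Rightarrow> 'a set" where
  "grid_bounded X r = {\<omega>\<in>space M. \<forall>N j. 0 < N \<longrightarrow> j \<le> N \<longrightarrow> \<bar>X (grid N j) \<omega>\<bar> \<le> r}"

lemma grid_bounded_events:
  assumes "\<And>t. t \<in> {0..1} \<Longrightarrow> X t \<in> borel_measurable M"
  shows "grid_bounded X r \<in> events"
proof -
  have "{\<omega>\<in>space M. 0 < N \<longrightarrow> j \<le> N \<longrightarrow> \<bar>X (grid N j) \<omega>\<bar> \<le> r} \<in> events" for N j
  proof (cases "0 < N \<and> j \<le> N")
    case True
    then have [measurable]: "X (grid N j) \<in> borel_measurable M" by (intro assms grid_mem) auto
    show ?thesis using True by simp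
  next
    case False then show ?thesis by (cases "0 < N") auto
  qed
  then have "{\<omega>\<in>space M. \<forall>N j. 0 < N \<longrightarrow> j \<le> N \<longrightarrow> \<bar>X (grid N j) \<omega>\<bar> \<le> r} \<in> events"
    by (intro sets.sets_Collect_countable_All)
  then show ?thesis unfolding grid_bounded_def .
qed

lemma grid_bounded_prob:
  assumes X: "\<And>t. t \<in> {0..1} \<Longrightarrow> X t \<in> borel_measurable M"
    and cont: "AE \<omega> in M. continuous_on {0..1} (\<lambda>t. X t \<omega>)"
  shows "(\<lambda>r. prob (grid_bounded X (real r))) \<longlonglongrightarrow> 1"
proof -
  have ev: "grid_bounded X r \<in> events" for r by (rule grid_bounded_events[OF X])
  have "(\<lambda>r. prob (grid_bounded X (real r))) \<longlonglongrightarrow> prob (\<Union>r. grid_bounded X (real r))"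
  proof (rule finite_Lim_measure_incseq)
    show "incseq (\<lambda>r. grid_bounded X (real r))"
    proof (rule monoI, rule subsetI)
      fix i j :: nat and \<omega> assume "i \<le> j" and \<omega>: "\<omega> \<in> grid_bounded X (real i)"
      then have "real i \<le> real j" by simp
      with \<omega> show "\<omega> \<in> grid_bounded X (real j)"
        unfolding grid_bounded_def by (blast intro: order_trans)
    qed
  qed (use ev in auto)
  moreover have "prob (\<Union>r. grid_bounded X (real r)) = 1"
  proof (subst prob_eq_1)
    show "(\<Union>r. grid_bounded X (real r)) \<in> events" using ev by auto
    show "AE \<omega> in M. \<omega> \<in> (\<Union>r. grid_bounded X (real r))"
      using cont AE_space
    proof eventually_elim
      case (elim \<omega>)
      have "bounded ((\<lambda>t. X t \<omega>) ` {0..1})"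
        by (intro compact_imp_bounded compact_continuous_image elim compact_Icc)
      then obtain c where c: "\<forall>y\<in>(\<lambda>t. X t \<omega>) ` {0..1}. norm y \<le> c" unfolding bounded_iff by blast
      obtain r :: nat where r: "c \<le> real r" using real_arch_simple by blast
      have "\<bar>X (grid N j) \<omega>\<bar> \<le> real r" if "0 < N" "j \<le> N" for N j
        using c[rule_format, OF imageI[OF grid_mem[OF that]]] r by simp
      then show ?case using elim by (auto simp: grid_bounded_def)
    qed
  qed
  ultimately show ?thesis by simp
qed

text \<open>Where clipping is inactive, the observations of the frozen processes converge to those of \<open>X\<close>, so
that they eventually lie in an open set that contains the limit; Fatou's lemma transfers the bound
of \<open>frozen_law_bound\<close>. By \<open>driftless_law\<close>, the Gaussian probability \<open>q\<close> is the same on every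
refinement of the grid.\<close>

lemma sampled_law_bound_open:
  assumes f: "f \<in> borel_measurable borel" "\<And>u. \<bar>f u\<bar> \<le> C"
    and \<kappa>: "0 < \<kappa>" "\<And>u. u \<in> {0..1} \<Longrightarrow> \<kappa> \<le> f u"
    and sol: "strong_solution M W b s X" and fs: "\<And>u. u \<in> {0..1} \<Longrightarrow> f u = s u"
    and b: "drift b K" and r: "0 \<le> r" and n: "0 < n" and a: "0 < a" and U: "open U"
    and law: "\<And>k. 0 < k \<Longrightarrow> measure (Pi\<^sub>M {..<n * k} (\<lambda>j. gaussian (grid_sd f (n * k) j)))
      (partial_sums n k -` U \<inter> space (Pi\<^sub>M {..<n * k} (\<lambda>_. borel))) = q"
  shows "prob {\<omega>\<in>space M. sampled n X \<omega> \<in> U} \<le>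
    a * q + exp ((drift.bmax K r)\<^sup>2 / \<kappa>\<^sup>2) / a + (1 - prob (grid_bounded X r))"
proof -
  interpret drift b K by fact
  obtain I where I: "\<And>t. t \<in> {0..1} \<Longrightarrow> is_wiener_integral M W f t (I t)"
    and ae: "AE \<omega> in M. \<forall>t\<in>{0..1}. X t \<omega> = (LINT u:{0..t}|lborel. b u (X u \<omega>)) + (I t \<omega> - I 0 \<omega>)"
    using strong_solution_integral[OF sol, of f] fs by blast
  note Xm = strong_solution_measurable[OF sol]
  have cont: "AE \<omega> in M. continuous_on {0..1} (\<lambda>t. X t \<omega>)"
    and int: "AE \<omega> in M. set_integrable lborel {0..1} (\<lambda>u. b u (X u \<omega>))"
    using sol by (auto simp: strong_solution_def)
  define c where "c = a * q + exp ((bmax r)\<^sup>2 / \<kappa>\<^sup>2) / a"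
  define N where "N k = n * Suc k" for k
  have N: "0 < N k" for k using n by (simp add: N_def)
  define Y where "Y k \<omega> = (\<lambda>j\<in>{..<N k}. frozen_drift b r (N k) j (X (grid (N k) j) \<omega>) +
     (I (grid (N k) (Suc j)) \<omega> - I (grid (N k) j) \<omega>))" for k \<omega>
  define V where "V k = {\<omega>\<in>space M. partial_sums n (Suc k) (Y k \<omega>) \<in> U}" for k
  have Bm: "partial_sums n (Suc k) -` U \<inter> space (Pi\<^sub>M {..<N k} (\<lambda>_. borel)) \<in> sets (Pi\<^sub>M {..<N k} (\<lambda>_. borel))" for k
    unfolding N_def using partial_sums_measurable by (rule measurable_sets) (use U in auto)
  have Ym: "Y k \<in> measurable M (Pi\<^sub>M {..<N k} (\<lambda>_. borel))" for k
    using frozen_law_bound(1)[OF f \<kappa> I Xm(1) b r N a Bm[of k]]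
    by (simp add: Y_def[abs_def])
  have V_eq: "V k = {\<omega>\<in>space M. Y k \<omega> \<in> partial_sums n (Suc k) -` U \<inter> space (Pi\<^sub>M {..<N k} (\<lambda>_. borel))}" for k
    using measurable_space[OF Ym] by (auto simp: V_def)
  have V_ev: "V k \<in> events" for k
    using measurable_sets[OF Ym Bm[of k]] unfolding V_eq by (simp add: vimage_def Int_def conj_commute)
  have V_prob: "prob (V k) \<le> c" for k
    using frozen_law_bound(2)[OF f \<kappa> I Xm(1) b r N a Bm[of k]] law[of "Suc k"]
    unfolding V_eq c_def by (simp add: Y_def N_def)
  let ?A = "grid_bounded X r \<inter> {\<omega>\<in>space M. sampled n X \<omega> \<in> U}"
  have sm: "sampled n X \<in> borel_measurable M" using n Xm(2) by (rule sampled_measurable)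
  have sU: "{\<omega>\<in>space M. sampled n X \<omega> \<in> U} \<in> events"
    using measurable_sets[OF sm, of U] U by (simp add: vimage_def Int_def conj_commute)
  have gb: "grid_bounded X r \<in> events" by (rule grid_bounded_events[OF Xm(2)])
  have "AE \<omega> in M. (indicator ?A \<omega> :: ennreal) \<le> liminf (\<lambda>k. indicator (V k) \<omega>)"
    using ae cont int AE_space
  proof eventually_elim
    case (elim \<omega>)
    show ?case
    proof (cases "\<omega> \<in> ?A")
      case True
      have lim: "(\<lambda>k. partial_sums n (Suc k) (Y k \<omega>) i) \<longlonglongrightarrow> sampled n X \<omega> i" for i
      proof (cases "i \<le> n")
        case i: True
        have bd: "\<bar>X (grid N j) \<omega>\<bar> \<le> r" if "0 < N" "j \<le> N" for N j
          using True that by (auto simp: grid_bounded_def)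
        have "partial_sums n (Suc k) (Y k \<omega>) i =
           (\<Sum>j<i * Suc k. frozen_drift b r (n * Suc k) j (X (grid (n * Suc k) j) \<omega>)) + (I (grid n i) \<omega> - I 0 \<omega>)" for k
        proof -
          have "partial_sums n (Suc k) (Y k \<omega>) i = (\<Sum>j<i * Suc k. frozen_drift b r (n * Suc k) j (X (grid (n * Suc k) j) \<omega>) +
             (I (grid (n * Suc k) (Suc j)) \<omega> - I (grid (n * Suc k) j) \<omega>))"
            unfolding partial_sums_def Y_def N_def using i mult_le_mono1[OF i, of "Suc k"]
            by (simp only: if_True) (intro sum.cong, auto)
          also have "\<dots> = (\<Sum>j<i * Suc k. frozen_drift b r (n * Suc k) j (X (grid (n * Suc k) j) \<omega>)) +
             (I (grid (n * Suc k) (i * Suc k)) \<omega> - I (grid (n * Suc k) 0) \<omega>)"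
            by (simp only: sum.distrib sum_lessThan_telescope[of "\<lambda>j. I (grid (n * Suc k) j) \<omega>" "i * Suc k"])
          finally show ?thesis by (simp only: grid_mult[OF zero_less_Suc]) (simp add: grid_def)
        qed
        moreover have "(\<lambda>k. (\<Sum>j<i * Suc k. frozen_drift b r (n * Suc k) j (X (grid (n * Suc k) j) \<omega>)) + (I (grid n i) \<omega> - I 0 \<omega>))
            \<longlonglongrightarrow> (LINT u:{0..grid n i}|lborel. b u (X u \<omega>)) + (I (grid n i) \<omega> - I 0 \<omega>)"
          by (intro tendsto_add tendsto_const frozen_drift_sum_tendsto[OF n i elim(2,3) bd])
        moreover have "sampled n X \<omega> i = (LINT u:{0..grid n i}|lborel. b u (X u \<omega>)) + (I (grid n i) \<omega> - I 0 \<omega>)"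
          using elim(1) grid_mem[OF n i] i by (simp add: sampled_def)
        ultimately show ?thesis by simp
      qed (simp add: sampled_def partial_sums_def)
      have "\<forall>\<^sub>F k in sequentially. partial_sums n (Suc k) (Y k \<omega>) \<in> U"
        using lim U by (rule open_coordinatewise_eventually) (use True in auto)
      then have "\<forall>\<^sub>F k in sequentially. (1::ennreal) \<le> indicator (V k) \<omega>"
        by eventually_elim (use elim in \<open>auto simp: V_def\<close>)
      then show ?thesis using True by (auto intro!: Liminf_bounded)
    qed simp
  qed
  note le = nn_integral_mono_AE[OF this]
  have "emeasure M ?A = (\<integral>\<^sup>+\<omega>. indicator ?A \<omega> \<partial>M)"
    using sets.Int[OF gb sU] by (rule nn_integral_indicator[symmetric])
  also have "\<dots> \<le> (\<integral>\<^sup>+\<omega>. liminf (\<lambda>k. indicator (V k) \<omega>) \<partial>M)" by (rule le)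
  also have "\<dots> \<le> liminf (\<lambda>k. \<integral>\<^sup>+\<omega>. indicator (V k) \<omega> \<partial>M)"
    using V_ev by (intro nn_integral_liminf) auto
  also have "\<dots> \<le> ennreal c"
    using V_ev V_prob by (intro Liminf_le always_eventually) (auto simp: emeasure_eq_measure ennreal_leI)
  finally have A: "prob ?A \<le> c"
    using V_prob[of 0] order_trans[OF measure_nonneg V_prob] by (simp add: emeasure_eq_measure)
  have "prob {\<omega>\<in>space M. sampled n X \<omega> \<in> U} \<le> prob (?A \<union> (space M - grid_bounded X r))"
    using gb sU by (intro finite_measure_mono) auto
  also have "\<dots> \<le> prob ?A + prob (space M - grid_bounded X r)"
    using gb sU by (intro measure_subadditive) auto
  also have "prob (space M - grid_bounded X r) = 1 - prob (grid_bounded X r)"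
    using gb by (rule prob_compl)
  finally show ?thesis using A by (simp add: c_def)
qed

end

lemma drift_conditionsE:
  assumes "drift_conditions b"
  obtains K where "drift b K"
  using assms unfolding drift_conditions_def drift_def by blast

text \<open>First the clipping range \<open>r\<close> is taken so large that it is left with probability below \<open>e/2\<close>; then
\<open>a\<close> is chosen such that the remaining additive term \<open>E / a\<close> equals \<open>e/2\<close>. Neither choice
involves \<open>n\<close>.\<close>

lemma sampled_laws_uniformly_contiguous:
  assumes drift: "drift_conditions b" and dispersion: "dispersion_conditions s"
    and BM: "brownian_motion M W" and sol: "strong_solution M W b s X"
    and BM': "brownian_motion M' W'" and sol': "strong_solution M' W' (\<lambda>_ _. 0) s X'"
    and e: "0 < e"
  obtains a where "0 < a" "\<And>n B. 0 < n \<Longrightarrow> B \<in> sets borel \<Longrightarrow>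
    measure (distr M borel (sampled n X)) B \<le> a * measure (distr M' borel (sampled n X')) B + e"
proof -
  interpret P: wiener M W
    using BM by (intro wiener.intro wiener_axioms.intro) (auto simp: brownian_motion_def)
  interpret Q: wiener M' W'
    using BM' by (intro wiener.intro wiener_axioms.intro) (auto simp: brownian_motion_def)
  obtain K where b: "drift b K" using drift by (rule drift_conditionsE)
  define f where "f = (\<lambda>u. indicator {0..1} u * s u)"
  obtain \<kappa> C where \<kappa>: "0 < \<kappa>" "\<And>u. u \<in> {0..1} \<Longrightarrow> \<kappa> \<le> f u"
    and f: "f \<in> borel_measurable borel" "\<And>u. \<bar>f u\<bar> \<le> C"
    using dispersion_truncation[OF dispersion] unfolding f_def by metis
  have fs: "f u = s u" if "u \<in> {0..1}" for u using that by (simp add: f_def)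
  note Xm = P.strong_solution_measurable(2)[OF sol] and Xm' = Q.strong_solution_measurable(2)[OF sol']
  have "AE \<omega> in M. continuous_on {0..1} (\<lambda>t. X t \<omega>)" using sol by (simp add: strong_solution_def)
  from P.grid_bounded_prob[OF Xm this] e
  have "\<forall>\<^sub>F r in sequentially. 1 - e / 2 < measure M (P.grid_bounded X (real r))"
    by (intro order_tendstoD) auto
  then obtain r :: nat where r: "1 - e / 2 < measure M (P.grid_bounded X (real r))"
    by (auto simp: eventually_sequentially)
  define E where "E = exp ((drift.bmax K (real r))\<^sup>2 / \<kappa>\<^sup>2)"
  define a where "a = 2 * E / e"
  have E: "0 < E" by (simp add: E_def)
  have a: "0 < a" "E / a = e / 2" using E e by (auto simp: a_def)
  show ?thesis
  proof (rule that[OF a(1)])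
    fix n :: nat and B :: "(nat \<Rightarrow> real) set" assume n: "0 < n" and B: "B \<in> sets borel"
    note sm = sampled_measurable[OF n Xm] and sm' = sampled_measurable[OF n Xm']
    let ?\<mu> = "distr M borel (sampled n X)" and ?\<nu> = "distr M' borel (sampled n X')"
    interpret \<mu>: prob_space ?\<mu> by (rule P.prob_space_distr[OF sm])
    interpret \<nu>: prob_space ?\<nu> by (rule Q.prob_space_distr[OF sm'])
    have open_bound: "measure ?\<mu> U \<le> a * measure ?\<nu> U + e" if U: "open U" for U
    proof -
      have Ub: "U \<in> sets borel" using U by simp
      have \<nu>: "measure ?\<nu> U = measure M' {\<omega>\<in>space M'. sampled n X' \<omega> \<in> U}"
        using sm' Ub by (simp add: measure_distr vimage_def Int_def conj_commute)
      have "measure M {\<omega>\<in>space M. sampled n X \<omega> \<in> U} \<le>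
         a * measure ?\<nu> U + E / a + (1 - measure M (P.grid_bounded X (real r)))"
        unfolding E_def
      proof (rule P.sampled_law_bound_open[OF f \<kappa> sol fs b _ n a(1) U])
        fix k :: nat assume "0 < k"
        from Q.driftless_law[OF f \<kappa> sol' fs n this Ub]
        show "measure (Pi\<^sub>M {..<n * k} (\<lambda>j. gaussian (grid_sd f (n * k) j)))
          (partial_sums n k -` U \<inter> space (Pi\<^sub>M {..<n * k} (\<lambda>_. borel))) = measure ?\<nu> U"
          unfolding \<nu> by simp
      qed auto
      moreover have "measure ?\<mu> U = measure M {\<omega>\<in>space M. sampled n X \<omega> \<in> U}"
        using sm Ub by (simp add: measure_distr vimage_def Int_def conj_commute)
      ultimately show ?thesis using r a(2) by simp
    qed
    show "measure ?\<mu> B \<le> a * measure ?\<nu> B + e"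
    proof (rule field_le_epsilon)
      fix d :: real assume d: "0 < d"
      have "emeasure ?\<nu> B < ennreal (measure ?\<nu> B + d / a)"
        using d a(1) by (simp add: \<nu>.emeasure_eq_measure ennreal_less_iff)
      moreover have "emeasure ?\<nu> B = (INF U\<in>{U. B \<subseteq> U \<and> open U}. emeasure ?\<nu> U)"
        using B \<nu>.emeasure_finite by (intro outer_regular) auto
      ultimately obtain U where U: "B \<subseteq> U" "open U" "emeasure ?\<nu> U < ennreal (measure ?\<nu> B + d / a)"
        by (auto simp: INF_less_iff)
      have "measure ?\<nu> U \<le> measure ?\<nu> B + d / a"
        using U(3) by (simp add: \<nu>.emeasure_eq_measure ennreal_less_iff)
      then have "a * measure ?\<nu> U \<le> a * measure ?\<nu> B + d"
        using a(1) mult_left_mono[of "measure ?\<nu> U" "measure ?\<nu> B + d / a" a] by (simp add: distrib_left)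
      moreover have "measure ?\<mu> B \<le> measure ?\<mu> U"
        using U B by (intro \<mu>.finite_measure_mono) auto
      ultimately show "measure ?\<mu> B \<le> a * measure ?\<nu> B + e + d" using open_bound[OF U(2)] by simp
    qed
  qed
qed

section \<open>Transfer of posterior consistency\<close>

lemma contiguity_transfer:
  fixes \<mu> \<nu> :: "nat \<Rightarrow> 'x measure" and g :: "nat \<Rightarrow> 'x \<Rightarrow> real"
  assumes \<mu>: "\<And>n. n > 0 \<Longrightarrow> prob_space (\<mu> n)" and \<nu>: "\<And>n. n > 0 \<Longrightarrow> prob_space (\<nu> n)"
    and sets: "\<And>n. sets (\<mu> n) = sets (\<nu> n)"
    and cont: "\<And>e. 0 < e \<Longrightarrow> \<exists>a>0. \<forall>n>0. \<forall>B\<in>sets (\<nu> n). measure (\<mu> n) B \<le> a * measure (\<nu> n) B + e"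
    and g: "\<And>n. g n \<in> borel_measurable (\<nu> n)" "\<And>n x. 0 \<le> g n x" "\<And>n x. g n x \<le> 1"
    and lim: "(\<lambda>n. \<integral>x. g n x \<partial>\<nu> n) \<longlonglongrightarrow> 0"
  shows "(\<lambda>n. \<integral>x. g n x \<partial>\<mu> n) \<longlonglongrightarrow> 0"
proof (rule tendstoI)
  fix e :: real assume e: "0 < e"
  define \<eta> where "\<eta> = e / 4"
  have \<eta>: "0 < \<eta>" using e by (simp add: \<eta>_def)
  obtain a where a: "0 < a" "\<And>n B. 0 < n \<Longrightarrow> B \<in> sets (\<nu> n) \<Longrightarrow> measure (\<mu> n) B \<le> a * measure (\<nu> n) B + \<eta>"
    using cont[OF \<eta>] by blast
  have "\<forall>\<^sub>F n in sequentially. (\<integral>x. g n x \<partial>\<nu> n) < \<eta> * \<eta> / a"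
    using lim \<eta> a by (intro order_tendstoD) auto
  then show "\<forall>\<^sub>F n in sequentially. dist (\<integral>x. g n x \<partial>\<mu> n) 0 < e"
    using eventually_gt_at_top[of 0]
  proof eventually_elim
    case (elim n)
    interpret P: prob_space "\<mu> n" by (rule \<mu>) fact
    interpret Q: prob_space "\<nu> n" by (rule \<nu>) fact
    have gm: "g n \<in> borel_measurable (\<mu> n)" using g(1)[of n] sets[of n] by (simp cong: measurable_cong_sets)
    note [measurable] = g(1)[of n] gm
    define S where "S = {x\<in>space (\<nu> n). \<eta> \<le> g n x}"
    have S[measurable]: "S \<in> sets (\<nu> n)" unfolding S_def by measurable
    have S': "S \<in> sets (\<mu> n)" using S sets by simp
    have sp: "space (\<mu> n) = space (\<nu> n)" by (rule sets_eq_imp_space_eq[OF sets])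
    have iP: "integrable (\<mu> n) (g n)" using g by (intro P.integrable_const_bound[where B=1]) auto
    have iQ: "integrable (\<nu> n) (g n)" using g by (intro Q.integrable_const_bound[where B=1]) auto
    have "measure (\<nu> n) S \<le> (\<integral>x. g n x \<partial>\<nu> n) / \<eta>"
      unfolding S_def using integral_Markov_inequality_measure[OF iQ, of "{}" \<eta>] g \<eta> by simp
    also have "\<dots> < \<eta> / a" using elim \<eta> a by (simp add: field_simps)
    finally have "a * measure (\<nu> n) S < \<eta>" using a by (simp add: field_simps)
    then have SP: "measure (\<mu> n) S \<le> 2 * \<eta>" using a(2)[OF elim(2) S] by linarith
    have "(\<integral>x. g n x \<partial>\<mu> n) \<le> (\<integral>x. \<eta> + indicator S x \<partial>\<mu> n)"
    proof (rule integral_mono[OF iP])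
      show "integrable (\<mu> n) (\<lambda>x. \<eta> + indicator S x)" using S' \<eta>
        by (intro P.integrable_const_bound[where B="\<eta> + 1"]) (auto simp: indicator_def)
      show "g n x \<le> \<eta> + indicator S x" if "x \<in> space (\<mu> n)" for x
        using that g(3)[of n x] \<eta> sp by (auto simp: S_def indicator_def)
    qed
    also have "\<dots> = \<eta> + measure (\<mu> n) S" using S' P.prob_space
      by (subst Bochner_Integration.integral_add) (auto simp: less_top[symmetric])
    also have "\<dots> < e" using SP e by (simp add: \<eta>_def)
    finally show ?case using g(2) by (simp add: dist_real_def)
  qed
qed

text \<open>A path with prescribed values at the observation times, depending measurably on these values. It
turns functions of the path that depend on the observations only into functions on the space
of observations.\<close>

definition step_path :: "nat \<Rightarrow> (nat \<Rightarrow> real) \<Rightarrow> real \<Rightarrow> real" where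
  "step_path n d = (\<lambda>t\<in>{0..1}. d (nat \<lfloor>real n * t\<rfloor>))"

lemma step_path_measurable: "step_path n \<in> measurable borel (Pi\<^sub>M {0..1} (\<lambda>_. borel))"
  unfolding step_path_def by (intro measurable_restrict measurable_product_coordinates)

lemma observations_step_path:
  assumes "0 < n"
  shows "observations n (step_path n (sampled n X \<omega>)) = observations n (\<lambda>t\<in>{0..1}. X t \<omega>)"
proof -
  have "nat \<lfloor>real n * grid n i\<rfloor> = i" for i using assms by (simp add: grid_def)
  then have "step_path n (sampled n X \<omega>) (grid n i) = X (grid n i) \<omega>" if "i \<le> n" for i
    using grid_mem[OF assms that] that by (simp add: step_path_def sampled_def)
  then show ?thesis
    using grid_mem[OF assms] unfolding observations_def by (intro restrict_ext) simp
qed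

text \<open>The Bochner integral of a function that is not measurable is zero, whatever the path law. The second
branch reproduces this convention, which makes \<open>integral_path_law_observations\<close> hold for
every \<open>q\<close>.\<close>

definition observation_functional :: "nat \<Rightarrow> ((nat \<Rightarrow> real) \<Rightarrow> real) \<Rightarrow> (nat \<Rightarrow> real) \<Rightarrow> real" where
  "observation_functional n q d =
     (if (\<lambda>x. q (observations n x)) \<in> borel_measurable (Pi\<^sub>M {0..1} (\<lambda>_. borel))
      then q (observations n (step_path n d)) else 0)"

lemma observation_functional_measurable:
  "observation_functional n q \<in> borel_measurable borel"
proof (cases "(\<lambda>x. q (observations n x)) \<in> borel_measurable (Pi\<^sub>M {0..1} (\<lambda>_. borel))")
  case True
  then show ?thesis
    using measurable_compose[OF step_path_measurable True]
    by (simp add: observation_functional_def[abs_def])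
qed (simp add: observation_functional_def[abs_def])

lemma integral_path_law_observations:
  assumes n: "0 < n" and X: "\<And>t. t \<in> {0..1} \<Longrightarrow> X t \<in> borel_measurable M"
  shows "(\<integral>x. q (observations n x) \<partial>path_law M X) =
    (\<integral>d. observation_functional n q d \<partial>distr M borel (sampled n X))"
proof -
  let ?\<Omega> = "Pi\<^sub>M {0..1::real} (\<lambda>_. borel :: real measure)"
  have path: "(\<lambda>\<omega>. \<lambda>t\<in>{0..1}. X t \<omega>) \<in> measurable M ?\<Omega>"
    using X by (intro measurable_restrict) auto
  show ?thesis
  proof (cases "(\<lambda>x. q (observations n x)) \<in> borel_measurable ?\<Omega>")
    case True
    have "(\<integral>x. q (observations n x) \<partial>path_law M X) = (\<integral>\<omega>. q (observations n (\<lambda>t\<in>{0..1}. X t \<omega>)) \<partial>M)"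
      unfolding path_law_def by (rule integral_distr[OF path True])
    also have "\<dots> = (\<integral>\<omega>. observation_functional n q (sampled n X \<omega>) \<partial>M)"
      using True by (simp add: observation_functional_def observations_step_path[OF n])
    also have "\<dots> = (\<integral>d. observation_functional n q d \<partial>distr M borel (sampled n X))"
      by (rule integral_distr[OF sampled_measurable[OF n X] observation_functional_measurable, symmetric])
    finally show ?thesis .
  next
    case False
    have "\<not> integrable (path_law M X) (\<lambda>x. q (observations n x))"
    proof
      assume "integrable (path_law M X) (\<lambda>x. q (observations n x))"
      from borel_measurable_integrable[OF this] False show False
        by (simp add: path_law_def)
    qed
    then show ?thesis using False by (simp add: not_integrable_integral_eq observation_functional_def)
  qed
qed

text \<open>In \<open>ennreal\<close> the quotient \<open>b / b\<close> is zero for \<open>b = 0\<close> and \<open>b = \<infinity>\<close>, so that the bounds hold for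
all data.\<close>

lemma posterior_bounds: "0 \<le> posterior n prior d S" "posterior n prior d S \<le> 1"
proof -
  show "0 \<le> posterior n prior d S" by (simp add: posterior_def)
  let ?a = "\<integral>\<^sup>+s\<in>S. ennreal (pseudo_likelihood n d s) \<partial>prior"
  let ?b = "\<integral>\<^sup>+s. ennreal (pseudo_likelihood n d s) \<partial>prior"
  have "?a \<le> ?b" by (intro nn_integral_mono) (auto simp: indicator_def)
  then have "?a / ?b \<le> ?b / ?b" by (rule divide_right_mono_ennreal)
  also have "b / b \<le> 1" for b :: ennreal
    by (cases "b = 0"; cases "b = top") (auto simp: ennreal_divide_self less_top[symmetric])
  finally show "posterior n prior d S \<le> 1"
    using enn2real_mono[of "?a / ?b" 1] by (simp add: posterior_def)
qed

theorem proposition1: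
  fixes M :: "'a measure" and W X :: "real \<Rightarrow> 'a \<Rightarrow> real"
    and M' :: "'b measure" and W' X' :: "real \<Rightarrow> 'b \<Rightarrow> real"
    and b0 :: "real \<Rightarrow> real \<Rightarrow> real" and s0 :: "real \<Rightarrow> real"
    and m :: "nat \<Rightarrow> nat"
    and Q :: "nat \<Rightarrow> 'c measure" and \<xi> :: "nat \<Rightarrow> nat \<Rightarrow> 'c \<Rightarrow> real"
    and \<epsilon> :: "nat \<Rightarrow> real"
  defines "prior \<equiv> \<lambda>n. hist_prior n (m n) (Q n) (\<xi> n)"
    and "Uc \<equiv> \<lambda>n. hist_funs n (m n) - L2_nbhd n (m n) s0 (\<epsilon> n)"
    and "P\<^sub>b \<equiv> path_law M X"
    and "P\<^sub>0 \<equiv> path_law M' X'"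
  assumes drift: "drift_conditions b0"
    and dispersion: "dispersion_conditions s0"
    and BM: "brownian_motion M W"
    and sol: "strong_solution M W b0 s0 X"
    and BM': "brownian_motion M' W'"
    and sol': "strong_solution M' W' (\<lambda>_ _. 0) s0 X'"
    and bins: "\<And>n. n \<ge> 2 \<Longrightarrow> 1 \<le> m n \<and> m n < n"
    and coeffs: "\<And>n. n \<ge> 2 \<Longrightarrow> random_coefficients (n div m n) (Q n) (\<xi> n)"
    and well_defined_b:
      "\<And>n. n \<ge> 2 \<Longrightarrow> AE x in P\<^sub>b. posterior_well_defined n (prior n) (observations n x)"
    and well_defined_0:
      "\<And>n. n \<ge> 2 \<Longrightarrow> AE x in P\<^sub>0. posterior_well_defined n (prior n) (observations n x)"
    and eps_pos: "\<And>n. \<epsilon> n > 0"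
    and eps_lim: "\<epsilon> \<longlonglongrightarrow> 0"
    and consistent_0: "(\<lambda>n. \<integral>x. posterior n (prior n) (observations n x) (Uc n) \<partial>P\<^sub>0) \<longlonglongrightarrow> 0"
  shows "(\<lambda>n. \<integral>x. posterior n (prior n) (observations n x) (Uc n) \<partial>P\<^sub>b) \<longlonglongrightarrow> 0"
proof -
  interpret P: wiener M W
    using BM by (intro wiener.intro wiener_axioms.intro) (auto simp: brownian_motion_def)
  interpret Q: wiener M' W'
    using BM' by (intro wiener.intro wiener_axioms.intro) (auto simp: brownian_motion_def)
  define q where "q n d = posterior n (prior n) d (Uc n)" for n d
  define g where "g n = observation_functional n (q n)" for n
  have "(\<lambda>n. \<integral>d. g n d \<partial>distr M borel (sampled n X)) \<longlonglongrightarrow> 0"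
  proof (rule contiguity_transfer)
    show "prob_space (distr M borel (sampled n X))" if "0 < n" for n
      by (rule P.prob_space_distr[OF sampled_measurable[OF that P.strong_solution_measurable(2)[OF sol]]])
    show "prob_space (distr M' borel (sampled n X'))" if "0 < n" for n
      by (rule Q.prob_space_distr[OF sampled_measurable[OF that Q.strong_solution_measurable(2)[OF sol']]])
    show "\<exists>a>0. \<forall>n>0. \<forall>B\<in>sets (distr M' borel (sampled n X')).
        measure (distr M borel (sampled n X)) B \<le> a * measure (distr M' borel (sampled n X')) B + e"
      if "0 < e" for e
      using sampled_laws_uniformly_contiguous[OF drift dispersion BM sol BM' sol' that]
      by (metis sets_distr)
    show "0 \<le> g n d" "g n d \<le> 1" for n d
      by (simp_all add: g_def observation_functional_def q_def posterior_bounds)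
    have "\<forall>\<^sub>F n in sequentially. (\<integral>x. q n (observations n x) \<partial>P\<^sub>0) = (\<integral>d. g n d \<partial>distr M' borel (sampled n X'))"
      using eventually_gt_at_top[of 0]
    proof eventually_elim
      case (elim n)
      show ?case unfolding P\<^sub>0_def g_def
        using elim Q.strong_solution_measurable(2)[OF sol'] by (rule integral_path_law_observations)
    qed
    with consistent_0 show "(\<lambda>n. \<integral>d. g n d \<partial>distr M' borel (sampled n X')) \<longlonglongrightarrow> 0"
      unfolding q_def by (rule Lim_transform_eventually)
  qed (auto simp: g_def observation_functional_measurable)
  moreover have "\<forall>\<^sub>F n in sequentially. (\<integral>d. g n d \<partial>distr M borel (sampled n X)) = (\<integral>x. q n (observations n x) \<partial>P\<^sub>b)"
    using eventually_gt_at_top[of 0]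
  proof eventually_elim
    case (elim n)
    show ?case unfolding P\<^sub>b_def g_def
      using elim P.strong_solution_measurable(2)[OF sol] by (rule integral_path_law_observations[symmetric])
  qed
  ultimately show ?thesis
    unfolding q_def by (rule Lim_transform_eventually)
qed

end
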